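(* Let $N\in\{2,3\}$, let $\Omega=\{x\in\mathbb{R}^N : |x|<1\}$ be the unit ball, and let $\mathbf{n}>0$ be a constant with $\mathbf{n}\neq 1$. Then for any given $\tau\in(0,1)$ there exists a sequence $(w_m,v_m)_{m\in\mathbb{N}}$ of pairs of transmission eigenfunctions, associated with transmission eigenvalues $k_m$ of the problem for $(\Omega,\mathbf{n})$, such that $$k_m\to\infty\ \text{ as } m\to\infty,\qquad \lim_{m\to\infty}\frac{\|w_m\|_{L^2(\Omega_\tau)}}{\|w_m\|_{L^2(\Omega)}}=0\quad\text{and}\quad \lim_{m\to\infty}\frac{\|v_m\|_{L^2(\Omega_\tau)}}{\|v_m\|_{L^2(\Omega)}}=0,$$ where $\Omega_\tau=\{x\in\mathbb{R}^N : |x|<\tau\}$.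
   Context: Transmission eigenvalue problem for $(\Omega,\mathbf{n})$: a real number $k>0$ is called a transmission eigenvalue if there is a non-trivial pair $(w,v)\in H^1(\Omega)\times H^1(\Omega)$ (i.e. not $w\equiv v\equiv 0$) satisfying $$\Delta w+k^2\mathbf{n}^2 w=0\ \text{ in }\Omega,\qquad \Delta v+k^2 v=0\ \text{ in }\Omega,\qquad w=v,\ \ \frac{\partial w}{\partial\nu}=\frac{\partial v}{\partial\nu}\ \text{ on }\partial\Omega,$$ where $\nu$ is the exterior unit normal to $\partial\Omega$. Such $w,v$ are called transmission eigenfunctions associated with $k$. *)

theory Defs
  imports "HOL-Analysis.Analysis"
begin

text \<open>
  Functions on an open set \<open>\<Omega>\<close> are represented by total functions whose values outside
  \<open>\<Omega>\<close> are ignored, and elements of Lebesgue and Sobolev spaces by arbitrary representatives.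
  All function spaces are complex; every pairing below is bilinear (no conjugation).
\<close>

subsection \<open>Test functions\<close>

definition partial_deriv ::
    "'a::euclidean_space \<Rightarrow> ('a \<Rightarrow> complex) \<Rightarrow> 'a \<Rightarrow> complex" where
  "partial_deriv b f x = frechet_derivative f (at x) b"

definition laplacian :: "('a::euclidean_space \<Rightarrow> complex) \<Rightarrow> 'a \<Rightarrow> complex" where
  "laplacian f x = (\<Sum>b\<in>Basis. partial_deriv b (partial_deriv b f) x)"

primrec Ck :: "nat \<Rightarrow> ('a::euclidean_space \<Rightarrow> complex) \<Rightarrow> bool" where
  "Ck 0 f \<longleftrightarrow> continuous_on UNIV f"
| "Ck (Suc k) f \<longleftrightarrow> (\<forall>x. f differentiable (at x)) \<and> (\<forall>b\<in>Basis. Ck k (partial_deriv b f))"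

definition test_function :: "'a::euclidean_space set \<Rightarrow> ('a \<Rightarrow> complex) \<Rightarrow> bool" where
  "test_function \<Omega> \<phi> \<longleftrightarrow>
     (\<forall>k. Ck k \<phi>) \<and> (\<exists>K. compact K \<and> K \<subseteq> \<Omega> \<and> (\<forall>x. x \<notin> K \<longrightarrow> \<phi> x = 0))"


subsection \<open>The spaces \<open>L\<^sup>2\<close>, \<open>H\<^sup>1\<close> and \<open>H\<^sup>1\<^sub>0\<close>\<close>

definition in_L2 :: "'a::euclidean_space set \<Rightarrow> ('a \<Rightarrow> complex) \<Rightarrow> bool" where
  "in_L2 \<Omega> u \<longleftrightarrow> u \<in> borel_measurable (lebesgue_on \<Omega>) \<and>
     integrable (lebesgue_on \<Omega>) (\<lambda>x. (cmod (u x))\<^sup>2)"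

definition L2_norm :: "'a::euclidean_space set \<Rightarrow> ('a \<Rightarrow> complex) \<Rightarrow> real" where
  "L2_norm \<Omega> u = sqrt (LINT x|lebesgue_on \<Omega>. (cmod (u x))\<^sup>2)"

text \<open>
  \<open>G b\<close> is the weak partial derivative of \<open>u\<close> in the direction of the basis vector \<open>b\<close>;
  it is determined almost everywhere on \<open>\<Omega>\<close>.
\<close>

definition has_weak_gradient ::
    "'a::euclidean_space set \<Rightarrow> ('a \<Rightarrow> complex) \<Rightarrow> ('a \<Rightarrow> 'a \<Rightarrow> complex) \<Rightarrow> bool" where
  "has_weak_gradient \<Omega> u G \<longleftrightarrow> (\<forall>b\<in>Basis. in_L2 \<Omega> (G b) \<and>
     (\<forall>\<phi>. test_function \<Omega> \<phi> \<longrightarrow>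
        (LINT x|lebesgue_on \<Omega>. u x * partial_deriv b \<phi> x) =
        - (LINT x|lebesgue_on \<Omega>. G b x * \<phi> x)))"

definition in_H1 :: "'a::euclidean_space set \<Rightarrow> ('a \<Rightarrow> complex) \<Rightarrow> bool" where
  "in_H1 \<Omega> u \<longleftrightarrow> in_L2 \<Omega> u \<and> (\<exists>G. has_weak_gradient \<Omega> u G)"

text \<open>The closure of the test functions in \<open>H\<^sup>1(\<Omega>)\<close>.\<close>

definition in_H1_0 :: "'a::euclidean_space set \<Rightarrow> ('a \<Rightarrow> complex) \<Rightarrow> bool" where
  "in_H1_0 \<Omega> u \<longleftrightarrow> in_L2 \<Omega> u \<and>
     (\<exists>G \<phi>. has_weak_gradient \<Omega> u G \<and> (\<forall>j. test_function \<Omega> (\<phi> j)) \<and>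
        (\<lambda>j. L2_norm \<Omega> (\<lambda>x. u x - \<phi> j x)) \<longlonglongrightarrow> 0 \<and>
        (\<forall>b\<in>Basis. (\<lambda>j. L2_norm \<Omega> (\<lambda>x. G b x - partial_deriv b (\<phi> j) x)) \<longlonglongrightarrow> 0))"


subsection \<open>Laplacian and Cauchy data of \<open>H\<^sup>1\<close> functions\<close>

text \<open>\<open>\<Delta>u = f\<close> in the sense of distributions, with \<open>f\<close> in \<open>L\<^sup>2(\<Omega>)\<close>.\<close>

definition has_weak_laplacian ::
    "'a::euclidean_space set \<Rightarrow> ('a \<Rightarrow> complex) \<Rightarrow> ('a \<Rightarrow> complex) \<Rightarrow> bool" where
  "has_weak_laplacian \<Omega> u f \<longleftrightarrow> in_L2 \<Omega> f \<and>
     (\<forall>\<phi>. test_function \<Omega> \<phi> \<longrightarrow>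
        (LINT x|lebesgue_on \<Omega>. u x * laplacian \<phi> x) = (LINT x|lebesgue_on \<Omega>. f x * \<phi> x))"

text \<open>Equality of the boundary traces on \<open>\<partial>\<Omega>\<close>.\<close>

definition equal_on_boundary ::
    "'a::euclidean_space set \<Rightarrow> ('a \<Rightarrow> complex) \<Rightarrow> ('a \<Rightarrow> complex) \<Rightarrow> bool" where
  "equal_on_boundary \<Omega> u v \<longleftrightarrow> in_H1_0 \<Omega> (\<lambda>x. u x - v x)"

text \<open>
  The normal derivative, with respect to the exterior unit normal \<open>\<nu>\<close>, of an \<open>H\<^sup>1\<close> function
  with Laplacian in \<open>L\<^sup>2\<close> is in general only an element of \<open>H\<^sup>-\<^sup>1\<^sup>/\<^sup>2(\<partial>\<Omega>)\<close>.  It is defined by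
  Green's identity: \<open>\<integral>\<^bsub>\<partial>\<Omega>\<^esub> (\<partial>u/\<partial>\<nu>) \<phi> = \<integral>\<^bsub>\<Omega>\<^esub> \<nabla>u \<cdot> \<nabla>\<phi> + \<Delta>u \<phi>\<close> for all \<open>\<phi>\<close> in \<open>H\<^sup>1(\<Omega>)\<close>.
  The functional \<open>l\<close> is relevant on \<open>H\<^sup>1(\<Omega>)\<close> only, and is uniquely determined there;
  \<open>l \<phi>\<close> depends only on the trace of \<open>\<phi>\<close>.
\<close>

definition has_normal_derivative ::
    "'a::euclidean_space set \<Rightarrow> ('a \<Rightarrow> complex) \<Rightarrow> (('a \<Rightarrow> complex) \<Rightarrow> complex) \<Rightarrow> bool" where
  "has_normal_derivative \<Omega> u l \<longleftrightarrow>
     (\<exists>G f. has_weak_gradient \<Omega> u G \<and> has_weak_laplacian \<Omega> u f \<and>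
        (\<forall>\<phi> H. in_L2 \<Omega> \<phi> \<longrightarrow> has_weak_gradient \<Omega> \<phi> H \<longrightarrow>
           l \<phi> = (LINT x|lebesgue_on \<Omega>. (\<Sum>b\<in>Basis. G b x * H b x) + f x * \<phi> x)))"

definition equal_normal_derivative_on_boundary ::
    "'a::euclidean_space set \<Rightarrow> ('a \<Rightarrow> complex) \<Rightarrow> ('a \<Rightarrow> complex) \<Rightarrow> bool" where
  "equal_normal_derivative_on_boundary \<Omega> u v \<longleftrightarrow>
     (\<exists>l. has_normal_derivative \<Omega> u l \<and> has_normal_derivative \<Omega> v l)"


subsection \<open>The transmission eigenvalue problem\<close>

definition solves_transmission_problem ::
    "'a::euclidean_space set \<Rightarrow> ('a \<Rightarrow> real) \<Rightarrow> real \<Rightarrow> ('a \<Rightarrow> complex) \<Rightarrow> ('a \<Rightarrow> complex) \<Rightarrow> bool" where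
  "solves_transmission_problem \<Omega> n k w v \<longleftrightarrow>
     in_H1 \<Omega> w \<and> in_H1 \<Omega> v \<and>
     has_weak_laplacian \<Omega> w (\<lambda>x. - of_real (k\<^sup>2 * (n x)\<^sup>2) * w x) \<and>
     has_weak_laplacian \<Omega> v (\<lambda>x. - of_real (k\<^sup>2) * v x) \<and>
     equal_on_boundary \<Omega> w v \<and>
     equal_normal_derivative_on_boundary \<Omega> w v"

definition transmission_eigenfunctions ::
    "'a::euclidean_space set \<Rightarrow> ('a \<Rightarrow> real) \<Rightarrow> real \<Rightarrow> ('a \<Rightarrow> complex) \<Rightarrow> ('a \<Rightarrow> complex) \<Rightarrow> bool" where
  "transmission_eigenfunctions \<Omega> n k w v \<longleftrightarrow>
     solves_transmission_problem \<Omega> n k w v \<and>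
     \<not> (AE x in lebesgue_on \<Omega>. w x = 0 \<and> v x = 0)"

definition transmission_eigenvalue ::
    "'a::euclidean_space set \<Rightarrow> ('a \<Rightarrow> real) \<Rightarrow> real \<Rightarrow> bool" where
  "transmission_eigenvalue \<Omega> n k \<longleftrightarrow> k > 0 \<and> (\<exists>w v. transmission_eigenfunctions \<Omega> n k w v)"

end

theory Submission
  imports Defs "HOL-Real_Asymp.Real_Asymp"
begin

text \<open>
  Let \<open>b, d\<close> be distinct basis vectors and \<open>\<nu> = m + N/2 - 1\<close>. The functions
  \<open>\<Phi>(\<kappa>\<^sup>2 |x|\<^sup>2) (x\<^sub>b + i x\<^sub>d)\<^sup>m\<close>, with \<open>\<Phi>(z\<^sup>2)\<close> a multiple of \<open>z\<^bsup>-\<nu>\<^esup> J\<^sub>\<nu>(z)\<close>, are smooth solutions of the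
  Helmholtz equation with wave number \<open>\<kappa>\<close>. Two of them, with wave numbers \<open>n k\<close> and \<open>k\<close>, can be
  scaled to have the same Cauchy data on the unit sphere as soon as \<open>k\<close> is a critical point of
  \<open>\<Phi>(n\<^sup>2 k\<^sup>2) / \<Phi>(k\<^sup>2)\<close>. For \<open>n > 1\<close> (the case \<open>n < 1\<close> follows by exchanging the roles of \<open>w\<close> and \<open>v\<close>)
  Rolle's theorem gives such a point between two zeros of the numerator, and by Sturm comparison
  these exist with \<open>\<nu> < n k \<le> \<mu> \<nu>\<close> for any fixed \<open>\<mu> > 1\<close> once \<open>m\<close> is large. With \<open>\<mu> \<tau> < 1\<close> the
  arguments \<open>z = \<kappa> |x|\<close> stay below the turning point \<open>\<nu>\<close> on the smaller ball, and there Bessel's equation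
  forces \<open>z J\<^sub>\<nu>'(z) \<ge> c \<nu> J\<^sub>\<nu>(z)\<close> for a constant \<open>c > 0\<close>; hence a dilation by a fixed factor multiplies
  the eigenfunctions by a factor that is exponentially large in \<open>m\<close>.
\<close>

text \<open>Under dilation by \<sigma> the harmonic polynomial in a mode gains exactly \<sigma>^m,
  while the radial factor loses at most \<sigma>^((1 - c) \<nu>). Since \<nu> - m = N/2 - 1 does not
  depend on m, the net exponent is c m up to a constant, so every fixed c > 0 gives exponential
  decay of the norm ratio. The room for c comes from \<sigma> \<mu> \<tau> < 1: with \<sigma> =
  \<mu> = \<tau>^(-1/3) one may take c^2 = 1 - \<tau>^(2/3). No Bessel asymptotics enter: below the
  turning point Bessel's operator is factored into two first-order ones, and zeros come from
  comparison with a sine.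

  The boundary conditions are weak: equal traces mean that the difference lies in the closure of the
  test functions, and normal derivatives are tested against arbitrary H^1 functions. Both come down
  to a smooth function vanishing on the sphere, multiplied by cutoffs whose gradients blow up there
  no faster than 1/(1 - |x|). The linear decay of the smooth function compensates for this, and
  dominated convergence applies.\<close>

section \<open>Bessel functions\<close>

text \<open>\<open>J\<^sub>\<nu>(z) = (z/2)\<^sup>\<nu> / \<Gamma>(\<nu> + 1) \<cdot> Phi (\<nu> + 1) (z\<^sup>2)\<close>; the parameter is shifted by one.\<close>

definition Phi :: "real \<Rightarrow> real \<Rightarrow> real" where
  "Phi a t = (\<Sum>j. (- 1 / 4) ^ j / (fact j * pochhammer a j) * t ^ j)"

lemma Phi_0 [simp]: "Phi a 0 = 1"
proof -
  have "Phi a 0 = (- 1 / 4) ^ 0 / (fact 0 * pochhammer a 0)"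
    unfolding Phi_def by (rule powser_zero)
  then show ?thesis by simp
qed

lemma Phi_coeff_Suc:
  fixes a :: real
  assumes "a > 0"
  shows "(- 1 / 4) ^ Suc j / (fact (Suc j) * pochhammer a (Suc j)) =
    - 1 / (4 * (real j + 1) * (a + real j)) * ((- 1 / 4) ^ j / (fact j * pochhammer a j))"
  unfolding pochhammer_Suc fact_Suc power_Suc by (simp add: algebra_simps)

lemma Phi_coeff_shift:
  fixes a :: real
  assumes "a > 0"
  shows "pochhammer (a + 1) j = pochhammer a j * (a + real j) / a"
  using assms pochhammer_rec[of a j] pochhammer_Suc[of a j] by (simp add: field_simps)

lemma summable_Phi:
  fixes a t :: real
  assumes "a > 0"
  shows "summable (\<lambda>j. (- 1 / 4) ^ j / (fact j * pochhammer a j) * t ^ j)"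
\<comment> \<open>The ratio of consecutive terms is |t| / (4 (j + 1) (a + j)) in absolute value;
  from \<open>N\<close> on, j + 1 >= |t| and a + j >= 1, which leaves the factor 1/4.\<close>
proof (rule summable_ratio_test[where c = "1/4" and N = "Suc (nat \<lceil>\<bar>t\<bar>\<rceil>)"])
  let ?f = "\<lambda>j. (- 1 / 4) ^ j / (fact j * pochhammer a j) * (t :: real) ^ j"
  fix j assume j: "Suc (nat \<lceil>\<bar>t\<bar>\<rceil>) \<le> j"
  then have *: "\<bar>t\<bar> \<le> real j" "1 \<le> real j"
    by linarith+
  define d where "d = (real j + 1) * (a + real j)"
  have d: "d > 0" unfolding d_def using assms by (intro mult_pos_pos) auto
  have "?f (Suc j) = - 1 / (4 * (real j + 1) * (a + real j)) * t * ?f j"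
    unfolding Phi_coeff_Suc[OF assms] by simp
  also have "\<dots> = - (t / d / 4) * ?f j" unfolding d_def by simp
  finally have "norm (?f (Suc j)) = norm (- (t / d / 4)) * norm (?f j)"
    by (simp only: norm_mult)
  also have "norm (- (t / d / 4)) = \<bar>t\<bar> / d / 4"
    using d by (simp add: abs_mult)
  finally have eq: "norm (?f (Suc j)) = \<bar>t\<bar> / d / 4 * norm (?f j)" .
  have "\<bar>t\<bar> * 1 \<le> d"
    unfolding d_def by (rule mult_mono) (use * assms in auto)
  then have "\<bar>t\<bar> / d / 4 \<le> 1 / 4"
    using d by simp
  then show "norm (?f (Suc j)) \<le> 1 / 4 * norm (?f j)"
    unfolding eq by (rule mult_right_mono) simp
qed simp

text \<open>For t = z^2 this is the classical rule that z^(-\<nu>) J_\<nu> has derivative -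
  z^(-\<nu>) J_(\<nu>+1). Differentiation only shifts the parameter, so all later derivatives stay
  within the family.\<close>

lemma Phi_has_derivative:
  assumes "a > 0"
  shows "(Phi a has_real_derivative (- 1 / (4 * a) * Phi (a + 1) t)) (at t)"
proof -
  let ?c = "\<lambda>a j. (- 1 / 4) ^ j / (fact j * pochhammer a j) :: real"
  have "diffs (?c a) j = - 1 / (4 * a) * ?c (a + 1) j" for j
    unfolding diffs_def pochhammer_rec[of a j] fact_Suc power_Suc
    by (simp del: of_nat_Suc)
  then have "(\<Sum>j. diffs (?c a) j * t ^ j) = (\<Sum>j. - 1 / (4 * a) * (?c (a + 1) j * t ^ j))"
    by (simp only: mult.assoc)
  also have "\<dots> = - 1 / (4 * a) * Phi (a + 1) t"
    unfolding Phi_def using assms by (intro suminf_mult summable_Phi) auto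
  finally show ?thesis
    using termdiffs_strong_converges_everywhere[of "?c a" t] summable_Phi[OF assms]
    unfolding Phi_def[abs_def] by metis
qed

lemma Phi_chain [derivative_intros]:
  assumes "a > 0" "(g has_real_derivative g') (at t within S)"
  shows "((\<lambda>t. Phi a (g t)) has_real_derivative (- 1 / (4 * a) * Phi (a + 1) (g t) * g')) (at t within S)"
  by (rule DERIV_chain2[OF Phi_has_derivative[OF assms(1)] assms(2)])

lemma continuous_on_Phi [continuous_intros]:
  assumes "a > 0" "continuous_on S g"
  shows "continuous_on S (\<lambda>t. Phi a (g t))"
proof -
  have "continuous_on UNIV (Phi a)"
    by (rule DERIV_continuous_on, rule DERIV_subset[OF Phi_has_derivative]) (use assms in auto)
  then show ?thesis
    using assms(2) continuous_on_compose2 by blast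
qed

text \<open>Comparison of coefficients; for t = z^2 it is J_(a-1) + J_(a+1) = (2a/z) J_a. Together
  with the derivative rule it takes the place of Bessel's equation: second derivatives produce
  \<open>Phi (a + 2)\<close>, which this identity eliminates.\<close>

lemma Phi_recurrence:
  assumes "a > 0"
  shows "Phi a t = Phi (a + 1) t - t / (4 * a * (a + 1)) * Phi (a + 2) t"
proof -
  let ?c = "\<lambda>a j. (- 1 / 4) ^ j / (fact j * pochhammer a j) :: real"
  have "Phi a t = 1 + (\<Sum>j. ?c a (Suc j) * t ^ Suc j)"
    unfolding Phi_def using suminf_split_head[OF summable_Phi[OF assms, of t]] by simp
  moreover have "Phi (a + 1) t = 1 + (\<Sum>j. ?c (a + 1) (Suc j) * t ^ Suc j)"
    unfolding Phi_def using suminf_split_head[OF summable_Phi[of "a + 1" t]] assms by simp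
  moreover have "?c a (Suc j) * t ^ Suc j =
      ?c (a + 1) (Suc j) * t ^ Suc j - t / (4 * a * (a + 1)) * (?c (a + 2) j * t ^ j)" for j
  proof -
    define C where "C = ?c (a + 1) j"
    define d where "d = a + 1 + real j"
    have nz: "d \<noteq> 0" "a \<noteq> 0" "a + 1 \<noteq> 0" "real j + 1 \<noteq> 0"
      unfolding d_def using assms by linarith+
    have 1: "?c a (Suc j) = - C / (4 * a * (real j + 1))"
      unfolding C_def pochhammer_rec[of a j] fact_Suc power_Suc by (simp add: add.commute)
    have 2: "?c (a + 1) (Suc j) = - C / (4 * (real j + 1) * d)"
      using Phi_coeff_Suc[of "a + 1" j] assms unfolding C_def d_def by simp
    have "pochhammer (a + 2) j = pochhammer (a + 1) j * d / (a + 1)"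
      using Phi_coeff_shift[of "a + 1" j] assms unfolding d_def by (simp add: add.assoc)
    then have 3: "?c (a + 2) j = C * (a + 1) / d"
      unfolding C_def by simp
    obtain e where e: "e = real j + 1" by simp
    have d: "d = a + e" unfolding d_def e by simp
    have "- C / (4 * a * e) = - C / (4 * e * d) - C / (4 * a * d)"
      using nz unfolding d e[symmetric] by (simp add: divide_simps) algebra
    then have "- C / (4 * a * (real j + 1)) = - C / (4 * (real j + 1) * d) - C / (4 * a * d)"
      unfolding e .
    also have "C / (4 * a * d) = 1 / (4 * a * (a + 1)) * (C * (a + 1) / d)"
      using nz by simp
    finally have "?c a (Suc j) = ?c (a + 1) (Suc j) - 1 / (4 * a * (a + 1)) * ?c (a + 2) j"
      unfolding 1 2 3 .
    then show ?thesis by (simp only: left_diff_distrib power_Suc) (simp add: ac_simps)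
  qed
  then have "(\<Sum>j. ?c a (Suc j) * t ^ Suc j) =
      (\<Sum>j. ?c (a + 1) (Suc j) * t ^ Suc j) - t / (4 * a * (a + 1)) * Phi (a + 2) t"
  proof -
    have "summable (\<lambda>j. ?c (a + 1) (Suc j) * t ^ Suc j)"
      using summable_Phi[of "a + 1" t] assms by (subst summable_Suc_iff) auto
    moreover have "summable (\<lambda>j. ?c (a + 2) j * t ^ j)"
      using summable_Phi[of "a + 2" t] assms by auto
    ultimately show ?thesis
      unfolding Phi_def using \<open>\<And>j. ?c a (Suc j) * t ^ Suc j = _ j\<close>
      by (simp only: suminf_mult[symmetric] suminf_diff[symmetric] summable_mult)
  qed
  ultimately show ?thesis by simp
qed

section \<open>Growth of Bessel functions below the turning point\<close>

lemma powr_mult_derivative: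
  assumes "t > 0" "(Q has_real_derivative Q') (at t)"
  shows "((\<lambda>t. t powr \<mu> * Q t) has_real_derivative t powr (\<mu> - 1) * (\<mu> * Q t + t * Q')) (at t)"
proof -
  have "t powr \<mu> = t powr (\<mu> - 1) * t"
    using assms(1) by (simp add: powr_diff)
  then show ?thesis
    using assms by (auto intro!: derivative_eq_intros simp: algebra_simps)
qed

text \<open>The derivative is the positive factor \<open>t powr (\<mu> - 1)\<close> times \<mu> Q +
  t Q', so only the sign of that combination matters. Derivatives are asked for on the open interval
  and continuity on the closed one, which admits the endpoints 0 and \<open>T\<close>.\<close>

lemma powr_mult_mono:
  assumes "\<And>x. 0 < x \<Longrightarrow> x < T \<Longrightarrow> (Q has_real_derivative Q' x) (at x)"
    and "\<And>x. 0 < x \<Longrightarrow> x < T \<Longrightarrow> 0 \<le> \<mu> * Q x + x * Q' x"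
    and "continuous_on {0..T} Q" "\<mu> > 0" "0 \<le> s" "s \<le> t" "t \<le> T"
  shows "s powr \<mu> * Q s \<le> t powr \<mu> * Q t"
proof (cases "s = t")
  case False
  then have "s < t" using assms by simp
  then show ?thesis
  proof (rule DERIV_nonneg_imp_increasing_open[where f = "\<lambda>t. t powr \<mu> * Q t", OF less_imp_le])
    fix x assume x: "s < x" "x < t"
    then show "\<exists>y. ((\<lambda>t. t powr \<mu> * Q t) has_real_derivative y) (at x) \<and> 0 \<le> y"
      using powr_mult_derivative[OF _ assms(1), of x \<mu>] assms(2)[of x] assms
      by (intro exI[of _ "x powr (\<mu> - 1) * (\<mu> * Q x + x * Q' x)"]) auto
  next
    have "continuous_on {s..t} Q"
      by (rule continuous_on_subset[OF assms(3)]) (use assms in auto)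
    then show "continuous_on {s..t} (\<lambda>t. t powr \<mu> * Q t)"
      using assms by (intro continuous_intros continuous_on_powr') auto
  qed
qed auto

text \<open>For \<open>t = z\<^sup>2\<close> and \<open>\<nu> = a - 1\<close> the conclusion reads \<open>z J\<^sub>\<nu>'(z) \<ge> c \<nu> J\<^sub>\<nu>(z)\<close>.\<close>

lemma Phi_log_derivative_aux:
  assumes "a > 1" "0 \<le> c" "c \<le> 1" "T \<le> (a - 1)\<^sup>2 * (1 - c\<^sup>2)"
    and pos: "\<And>x. 0 < x \<Longrightarrow> x < T \<Longrightarrow> Phi a x > 0"
    and t: "0 < t" "t \<le> T"
  shows "0 \<le> (1 - c) * (a - 1) * Phi a t - t / (2 * a) * Phi (a + 1) t"
proof -
  \<comment> \<open>Let D = z d/dz, t = z^2, \<nu> = a - 1, and let J stand for z^\<nu> Phi a (z^2).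
    Then z^\<nu> Q is (D - c \<nu>) J, and Bessel's equation D^2 J = (\<nu>^2 - z^2) J gives (D + c
    \<nu>)(D - c \<nu>) J = ((1 - c^2) \<nu>^2 - z^2) J. Taking z^\<nu> out of the left side leaves
    2 (\<mu> Q + t Q') with the \<open>\<mu>\<close> below; this is the fact
    \<open>id\<close>.\<close>
  define Q where "Q = (\<lambda>t. (1 - c) * (a - 1) * Phi a t - t / (2 * a) * Phi (a + 1) t)"
  define \<mu> where "\<mu> = (1 + c) * (a - 1) / 2"
  define Q' where "Q' = (\<lambda>t. (1 - c) * (a - 1) * (- 1 / (4 * a) * Phi (a + 1) t)
      - (1 / (2 * a) * Phi (a + 1) t + t / (2 * a) * (- 1 / (4 * (a + 1)) * Phi (a + 2) t)))"
  have "(Q has_real_derivative Q' x) (at x)" for x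
    unfolding Q_def Q'_def
    by (rule derivative_eq_intros refl | use assms in force)+
       (use assms in \<open>simp add: field_simps\<close>)
  moreover have id: "2 * (\<mu> * Q x + x * Q' x) = ((a - 1)\<^sup>2 * (1 - c\<^sup>2) - x) * Phi a x" for x
  proof -
    define S where "S = Phi (a + 1) x / a"
    define R where "R = Phi (a + 2) x / (a * (a + 1))"
    have SR: "Phi (a + 1) x = a * S" "Phi (a + 2) x = a * (a + 1) * R"
      unfolding S_def R_def using assms by auto
    define b where "b = a + 1"
    have nz: "a \<noteq> 0" "b \<noteq> 0" using assms unfolding b_def by auto
    have P: "Phi a x = a * S - x * R / 4"
      unfolding Phi_recurrence[of a x, OF order.strict_trans[OF zero_less_one assms(1)]]
        SR b_def[symmetric] SR[unfolded b_def[symmetric]]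
      using nz by simp
    have Q: "Q x = (1 - c) * (a - 1) * (a * S - x * R / 4) - x * S / 2"
      unfolding Q_def P SR using assms by simp
    have Q': "Q' x = (1 - c) * (a - 1) * (- S / 4) - (S / 2 - x * R / 8)"
      unfolding Q'_def b_def[symmetric] SR[unfolded b_def[symmetric]] using nz by simp
    show ?thesis
      unfolding Q Q' P \<mu>_def by (simp add: field_simps power2_eq_square)
  qed
  moreover have "0 \<le> \<mu> * Q x + x * Q' x" if "0 < x" "x < T" for x
  proof -
    have "0 \<le> 2 * (\<mu> * Q x + x * Q' x)"
      unfolding id using pos[OF that] that assms(4) t by (intro mult_nonneg_nonneg) auto
    then show ?thesis by simp
  qed
  moreover have "continuous_on {0..T} Q"
    unfolding Q_def using assms by (intro continuous_intros) auto
  moreover have "\<mu> > 0" unfolding \<mu>_def using assms by simp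
  \<comment> \<open>Because \<mu> > 0 the left side is 0, so monotonicity from 0 decides the sign of
    \<open>Q t\<close>.\<close>
  ultimately have "0 powr \<mu> * Q 0 \<le> t powr \<mu> * Q t"
    using t powr_mult_mono[of T Q Q' \<mu> 0 t] by auto
  then have "0 \<le> Q t" using t by (simp add: zero_le_mult_iff)
  then show ?thesis unfolding Q_def .
qed

text \<open>The bound z J' >= c \<nu> J means that z^(-c \<nu>) J is nondecreasing. Up to a constant
  this function is z^((1 - c) \<nu>) Phi, and t = z^2 halves the exponent. Positivity below
  \<open>T\<close> is still assumed because \<open>Phi_pos\<close> is derived from this
  lemma.\<close>

lemma Phi_growth_aux:
  assumes "a > 1" "0 \<le> c" "c < 1" "T \<le> (a - 1)\<^sup>2 * (1 - c\<^sup>2)"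
    and pos: "\<And>x. 0 < x \<Longrightarrow> x < T \<Longrightarrow> Phi a x > 0"
    and st: "0 \<le> s" "s \<le> t" "t \<le> T"
  shows "s powr ((1 - c) * (a - 1) / 2) * Phi a s \<le> t powr ((1 - c) * (a - 1) / 2) * Phi a t"
proof (rule powr_mult_mono[where Q' = "\<lambda>x. - 1 / (4 * a) * Phi (a + 1) x" and T = T])
  fix x assume x: "0 < x" "x < T"
  show "(Phi a has_real_derivative - 1 / (4 * a) * Phi (a + 1) x) (at x)"
    using assms by (intro Phi_has_derivative) auto
  show "0 \<le> (1 - c) * (a - 1) / 2 * Phi a x + x * (- 1 / (4 * a) * Phi (a + 1) x)"
    using Phi_log_derivative_aux[of a c T x] assms x by (simp add: field_simps)
next
  show "continuous_on {0..T} (Phi a)"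
    using assms by (intro continuous_intros) auto
qed (use assms in auto)

text \<open>Let \<open>T\<close> be the smallest zero in [0, t]. Growth with c = 0 makes x^(\<nu>/2)
  Phi nondecreasing up to \<open>T\<close>, but it is positive at T/2 and vanishes at
  \<open>T\<close>. In other words, J_\<nu> has no positive zero up to its turning point \<nu> = a -
  1.\<close>

lemma Phi_pos:
  assumes "a > 1" "0 \<le> t" "t \<le> (a - 1)\<^sup>2"
  shows "Phi a t > 0"
proof (rule ccontr)
  assume neg: "\<not> Phi a t > 0"
  define Z where "Z = {x \<in> {0..t}. Phi a x = 0}"
  have cont: "continuous_on S (Phi a)" for S
    using assms by (intro continuous_intros) auto
  have "compact Z"
  proof -
    have "Z = {0..t} \<inter> Phi a -` {0}" unfolding Z_def by auto
    moreover have "closed ({0..t} \<inter> Phi a -` {0})"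
      by (rule continuous_closed_preimage[OF cont]) auto
    ultimately show ?thesis
      by (metis Int_lower1 bounded_closed_interval bounded_subset compact_eq_bounded_closed)
  qed
  moreover have "Z \<noteq> {}"
    using IVT2'[of "Phi a" t 0 0] neg assms cont[of "{0..t}"] unfolding Z_def by auto
  ultimately obtain T where T: "T \<in> Z" "\<And>x. x \<in> Z \<Longrightarrow> T \<le> x"
    using compact_attains_inf by metis
  have T0: "0 < T" "T \<le> t" "Phi a T = 0"
    using T(1) unfolding Z_def by (auto intro: order.not_eq_order_implies_strict)
  have pos: "Phi a x > 0" if "0 < x" "x < T" for x
  proof (rule ccontr)
    assume "\<not> Phi a x > 0"
    then have "\<exists>y\<ge>0. y \<le> x \<and> Phi a y = 0"
      using that cont[of "{0..x}"] by (intro IVT2') auto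
    then obtain y where "0 \<le> y" "y \<le> x" "Phi a y = 0" by blast
    then show False
      using T(2)[of y] that T0 unfolding Z_def by auto
  qed
  have "(T/2) powr ((1 - 0) * (a - 1) / 2) * Phi a (T/2) \<le> T powr ((1 - 0) * (a - 1) / 2) * Phi a T"
    by (rule Phi_growth_aux[where T = T]) (use assms T0 pos in auto)
  then show False
    using T0 pos[of "T/2"] by (simp add: mult_le_0_iff)
qed

lemma Phi_growth:
  assumes "a > 1" "0 \<le> c" "c < 1" "t \<le> (a - 1)\<^sup>2 * (1 - c\<^sup>2)" "0 \<le> s" "s \<le> t"
  shows "s powr ((1 - c) * (a - 1) / 2) * Phi a s \<le> t powr ((1 - c) * (a - 1) / 2) * Phi a t"
proof (rule Phi_growth_aux[where T = t])
  fix x assume x: "0 < x" "x < t"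
  have "(a - 1)\<^sup>2 * (1 - c\<^sup>2) \<le> (a - 1)\<^sup>2 * 1"
    by (intro mult_left_mono) auto
  then have "x \<le> (a - 1)\<^sup>2" using x assms by linarith
  then show "0 < Phi a x"
    using x assms by (intro Phi_pos) auto
qed (use assms in auto)

text \<open>The recurrence would carry a common zero to all parameters a + i. Once a + i - 1 exceeds
  the square root of t, the point t lies below the turning point, where \<open>Phi_pos\<close>
  excludes zeros. By the derivative rule this says that positive zeros of \<open>Phi a\<close> are
  simple.\<close>

lemma Phi_no_double_zero:
  assumes "a > 0" "t > 0" "Phi a t = 0" "Phi (a + 1) t = 0"
  shows False
proof -
  have "Phi (a + real i) t = 0 \<and> Phi (a + real i + 1) t = 0" for i
  proof (induction i)
    case (Suc i)
    have "Phi (a + real i + 2) t = 0"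
      using Phi_recurrence[of "a + real i" t] Suc assms by (auto simp: add_ac)
    with Suc show ?case by (simp add: add_ac)
  qed (use assms in auto)
  moreover obtain i :: nat where i_gt: "real i > t + 2" using reals_Archimedean2 by blast
  moreover have "Phi (a + real i) t > 0"
  proof (rule Phi_pos)
    have "t \<le> (a + real i - 1) * 1" using assms i_gt by simp
    also have "\<dots> \<le> (a + real i - 1) * (a + real i - 1)"
      using assms i_gt by (intro mult_left_mono) auto
    finally show "t \<le> (a + real i - 1)\<^sup>2" by (simp add: power2_eq_square)
  qed (use assms i_gt in auto)
  ultimately show False by (metis less_irrefl)
qed


text \<open>Dilating z by \<sigma> multiplies t = z^2 by \<sigma>^2. In the growth estimate a power
  of s then cancels, which is possible only for s > 0; at s = 0 both values of \<open>Phi\<close>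
  are 1.\<close>

lemma Phi_dilation:
  assumes "a > 1" "0 \<le> c" "c < 1" "\<sigma> \<ge> 1" "0 \<le> s" "\<sigma>\<^sup>2 * s \<le> (a - 1)\<^sup>2 * (1 - c\<^sup>2)"
  shows "Phi a s \<le> \<sigma> powr ((1 - c) * (a - 1)) * Phi a (\<sigma>\<^sup>2 * s)"
proof (cases "s = 0")
  case True
  then show ?thesis using assms by (simp add: ge_one_powr_ge_zero)
next
  case False
  define e where "e = (1 - c) * (a - 1) / 2"
  have le: "s \<le> \<sigma>\<^sup>2 * s"
    using assms mult_right_mono[of 1 "\<sigma>\<^sup>2" s] by (simp add: one_le_power)
  have "s powr e * Phi a s \<le> (\<sigma>\<^sup>2 * s) powr e * Phi a (\<sigma>\<^sup>2 * s)"
    unfolding e_def using assms le by (intro Phi_growth) auto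
  also have "(\<sigma>\<^sup>2 * s) powr e = s powr e * \<sigma> powr (2 * e)"
    using assms by (simp add: powr_mult powr_powr flip: powr_numeral)
  finally have "s powr e * Phi a s \<le> s powr e * (\<sigma> powr (2 * e) * Phi a (\<sigma>\<^sup>2 * s))"
    by (simp only: mult.assoc)
  moreover have "s powr e > 0" using False assms by simp
  ultimately show ?thesis unfolding e_def by simp
qed

section \<open>Zeros just above the turning point\<close>

text \<open>\<open>W\<close> is the Wronskian of Y and sin (\<omega> (s - \<alpha>)), which is
  nonnegative on this half period. If Y were positive throughout, W' = (\<omega>^2 - q) Y sin would
  be nonpositive, while the end values are W(\<alpha>) = -\<omega> Y(\<alpha>) < 0 and W(\<beta>) =
  \<omega> Y(\<beta>) > 0.\<close>

lemma Sturm_comparison: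
  fixes Y Y1 q :: "real \<Rightarrow> real"
  assumes "\<omega> > 0"
    and Y: "\<And>s. s \<in> {\<alpha>..\<alpha> + pi / \<omega>} \<Longrightarrow> (Y has_real_derivative Y1 s) (at s)"
    and Y1: "\<And>s. s \<in> {\<alpha>..\<alpha> + pi / \<omega>} \<Longrightarrow> (Y1 has_real_derivative - q s * Y s) (at s)"
    and q: "\<And>s. s \<in> {\<alpha>..\<alpha> + pi / \<omega>} \<Longrightarrow> \<omega>\<^sup>2 \<le> q s"
  shows "\<exists>s\<in>{\<alpha>..\<alpha> + pi / \<omega>}. Y s \<le> 0"
proof (rule ccontr)
  assume neg: "\<not> ?thesis"
  define \<beta> where "\<beta> = \<alpha> + pi / \<omega>"
  have "\<alpha> \<le> \<beta>" unfolding \<beta>_def using assms(1) by simp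
  define W where "W = (\<lambda>s. Y1 s * sin (\<omega> * (s - \<alpha>)) - \<omega> * Y s * cos (\<omega> * (s - \<alpha>)))"
  have "W \<beta> \<le> W \<alpha>"
  proof (rule DERIV_nonpos_imp_nonincreasing[OF \<open>\<alpha> \<le> \<beta>\<close>])
    fix s assume s: "\<alpha> \<le> s" "s \<le> \<beta>"
    then have I: "s \<in> {\<alpha>..\<alpha> + pi / \<omega>}" unfolding \<beta>_def by simp
    have "(W has_real_derivative (\<omega>\<^sup>2 - q s) * Y s * sin (\<omega> * (s - \<alpha>))) (at s)"
      unfolding W_def
      by (rule derivative_eq_intros Y[OF I] Y1[OF I] refl)+
         (simp add: algebra_simps power2_eq_square)
    moreover have "sin (\<omega> * (s - \<alpha>)) \<ge> 0"
    proof (rule sin_ge_zero)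
      show "\<omega> * (s - \<alpha>) \<le> pi"
        using s assms(1) unfolding \<beta>_def by (simp add: field_simps)
    qed (use s assms(1) in simp)
    moreover have "Y s \<ge> 0" using neg I by (meson linear)
    ultimately show "\<exists>y. (W has_real_derivative y) (at s) \<and> y \<le> 0"
      using q[OF I] by (meson diff_le_0_iff_le mult_nonpos_nonneg)
  qed
  moreover have "W \<beta> = \<omega> * Y \<beta>" "W \<alpha> = - \<omega> * Y \<alpha>"
    unfolding W_def \<beta>_def using assms(1) by simp_all
  moreover have "Y \<alpha> > 0" "Y \<beta> > 0"
    using neg \<open>\<alpha> \<le> \<beta>\<close> unfolding \<beta>_def by (meson atLeastAtMost_iff not_le order_refl)+
  moreover have "\<omega> * Y \<alpha> > 0" "\<omega> * Y \<beta> > 0"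
    using calculation assms(1) by simp_all
  ultimately show False by simp
qed

text \<open>The equation is linear, so the comparison applies to Y and to -Y and yields values of
  both signs.\<close>

lemma Sturm_zero:
  fixes Y Y1 q :: "real \<Rightarrow> real"
  assumes "\<omega> > 0"
    and Y: "\<And>s. s \<in> {\<alpha>..\<alpha> + pi / \<omega>} \<Longrightarrow> (Y has_real_derivative Y1 s) (at s)"
    and Y1: "\<And>s. s \<in> {\<alpha>..\<alpha> + pi / \<omega>} \<Longrightarrow> (Y1 has_real_derivative - q s * Y s) (at s)"
    and q: "\<And>s. s \<in> {\<alpha>..\<alpha> + pi / \<omega>} \<Longrightarrow> \<omega>\<^sup>2 \<le> q s"
  shows "\<exists>s\<in>{\<alpha>..\<alpha> + pi / \<omega>}. Y s = 0"
proof -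
  have "\<exists>s\<in>{\<alpha>..\<alpha> + pi / \<omega>}. Y s \<le> 0"
    by (rule Sturm_comparison[OF assms(1) Y Y1 q])
  then obtain s where s: "s \<in> {\<alpha>..\<alpha> + pi / \<omega>}" "Y s \<le> 0" by blast
  have "\<exists>s\<in>{\<alpha>..\<alpha> + pi / \<omega>}. - Y s \<le> 0"
  proof (rule Sturm_comparison[OF assms(1) _ _ q])
    fix s assume "s \<in> {\<alpha>..\<alpha> + pi / \<omega>}"
    note I = Y[OF this] Y1[OF this]
    show "((\<lambda>s. - Y s) has_real_derivative - Y1 s) (at s)"
      by (rule derivative_intros I)+
    show "((\<lambda>s. - Y1 s) has_real_derivative - q s * - Y s) (at s)"
      by (rule derivative_eq_intros I)+ simp
  qed
  then obtain t where t: "t \<in> {\<alpha>..\<alpha> + pi / \<omega>}" "Y t \<ge> 0" by auto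
  have cont: "continuous_on {\<alpha>..\<alpha> + pi / \<omega>} Y"
    using Y by (meson DERIV_isCont continuous_at_imp_continuous_on)
  have "connected (Y ` {\<alpha>..\<alpha> + pi / \<omega>})"
    by (intro connected_continuous_image cont) simp
  then have "0 \<in> Y ` {\<alpha>..\<alpha> + pi / \<omega>}"
    using s t connectedD_interval[of "Y ` {\<alpha>..\<alpha> + pi / \<omega>}" "Y s" "Y t" 0] by blast
  then show ?thesis by force
qed

text \<open>In the variable \<open>s = ln z\<close> the function \<open>Y s = z\<^sup>\<nu> \<Phi>(z\<^sup>2)\<close> solves \<open>Y'' = (\<nu>\<^sup>2 - z\<^sup>2) Y\<close>.\<close>

lemma Phi_zero_exists:
  assumes "\<nu> > 0" "\<mu> > 1"
  shows "\<exists>z. \<mu> * \<nu> \<le> z \<and> z \<le> \<mu> * \<nu> * exp (pi / (\<nu> * sqrt (\<mu>\<^sup>2 - 1))) \<and> Phi (\<nu> + 1) (z\<^sup>2) = 0"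
proof -
  \<comment> \<open>For z >= \<mu> \<nu> the coefficient z^2 - \<nu>^2 is at least (\<mu>^2 - 1)
    \<nu>^2 = \<omega>^2. An interval of length pi / \<omega> in s = ln z becomes the factor exp (pi
    / \<omega>) in z.\<close>
  define \<omega> where "\<omega> = \<nu> * sqrt (\<mu>\<^sup>2 - 1)"
  define \<alpha> where "\<alpha> = ln (\<mu> * \<nu>)"
  have mu2: "\<mu>\<^sup>2 > 1" using assms by (simp add: one_less_power)
  have om: "\<omega> > 0" unfolding \<omega>_def using assms mu2 by simp
  have ex: "exp (2 * s) = (exp s)\<^sup>2" for s :: real by (simp add: exp_double)
  define P where "P = (\<lambda>s. Phi (\<nu> + 1) (exp (2 * s)))"
  define P1 where "P1 = (\<lambda>s. Phi (\<nu> + 1 + 1) (exp (2 * s)))"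
  define P2 where "P2 = (\<lambda>s. Phi (\<nu> + 1 + 1 + 1) (exp (2 * s)))"
  define Y where "Y = (\<lambda>s. exp (\<nu> * s) * P s)"
  define Y1 where "Y1 = (\<lambda>s. exp (\<nu> * s) * (\<nu> * P s - exp (2 * s) / (2 * (\<nu> + 1)) * P1 s))"
  have dP: "(P has_real_derivative - exp (2 * s) / (2 * (\<nu> + 1)) * P1 s) (at s)" for s
    unfolding P_def P1_def
    by (rule derivative_eq_intros refl | use assms in force)+ (use assms in \<open>simp add: field_simps\<close>)
  have dP1: "(P1 has_real_derivative - exp (2 * s) / (2 * (\<nu> + 2)) * P2 s) (at s)" for s
    unfolding P1_def P2_def
    by (rule derivative_eq_intros refl | use assms in force)+
       (use assms in \<open>simp add: field_simps\<close>)
  have rec: "P s = P1 s - exp (2 * s) / (4 * (\<nu> + 1) * (\<nu> + 2)) * P2 s" for s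
    unfolding P_def P1_def P2_def using Phi_recurrence[of "\<nu> + 1" "exp (2 * s)"] assms
    by (simp add: add.assoc)
  have dY: "(Y has_real_derivative Y1 s) (at s)" for s
    unfolding Y_def Y1_def
    by (rule derivative_eq_intros refl dP)+ (simp add: algebra_simps)
  have dY1: "(Y1 has_real_derivative - (exp (2 * s) - \<nu>\<^sup>2) * Y s) (at s)" for s
  proof -
    define E where "E = exp (2 * s)"
    define A where "A = \<nu> + 1"
    define B where "B = \<nu> + 2"
    have nz: "A \<noteq> 0" "B \<noteq> 0" unfolding A_def B_def using assms by auto
    define S where "S = P1 s / A"
    define R where "R = P2 s / (A * B)"
    have SR: "P1 s = A * S" "P2 s = A * B * R" unfolding S_def R_def using nz by auto
    have Ps: "P s = A * S - E * R / 4"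
      using rec[of s] unfolding E_def[symmetric] A_def[symmetric] B_def[symmetric] SR
      using nz by simp
    have dE: "((\<lambda>s. exp (2 * s) / (2 * (\<nu> + 1))) has_real_derivative 2 * exp (2 * s) / (2 * (\<nu> + 1))) (at s)"
      by (rule DERIV_cdivide) (auto intro!: derivative_eq_intros)
    have "(Y1 has_real_derivative
       exp (\<nu> * s) * \<nu> * (\<nu> * P s - E / (2 * A) * P1 s) +
       exp (\<nu> * s) * (\<nu> * (- E / (2 * A) * P1 s) -
         (2 * E / (2 * A) * P1 s + E / (2 * A) * (- E / (2 * B) * P2 s)))) (at s)"
      unfolding Y1_def E_def A_def B_def
      by (rule dE dP dP1 derivative_eq_intros refl)+ (simp add: ac_simps)
    also have "exp (\<nu> * s) * \<nu> * (\<nu> * P s - E / (2 * A) * P1 s) +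
       exp (\<nu> * s) * (\<nu> * (- E / (2 * A) * P1 s) -
         (2 * E / (2 * A) * P1 s + E / (2 * A) * (- E / (2 * B) * P2 s))) =
       exp (\<nu> * s) * (\<nu> * (\<nu> * P s - E * S / 2) + (\<nu> * (- E * S / 2) - (E * S - E * E * R / 4)))"
      unfolding SR using nz by (simp add: algebra_simps)
    also have "\<dots> = - (E - \<nu>\<^sup>2) * Y s"
      unfolding Y_def Ps A_def by (simp add: algebra_simps power2_eq_square diff_divide_distrib)
    finally show ?thesis unfolding E_def .
  qed
  have "\<exists>s\<in>{\<alpha>..\<alpha> + pi / \<omega>}. Y s = 0"
  proof (rule Sturm_zero[OF om dY dY1])
    fix s assume s: "s \<in> {\<alpha>..\<alpha> + pi / \<omega>}"
    then have "exp \<alpha> \<le> exp s" by simp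
    then have "\<mu> * \<nu> \<le> exp s"
      unfolding \<alpha>_def using assms by simp
    then have "(\<mu> * \<nu>)\<^sup>2 \<le> (exp s)\<^sup>2" using assms by (intro power_mono) auto
    then show "\<omega>\<^sup>2 \<le> exp (2 * s) - \<nu>\<^sup>2"
      unfolding \<omega>_def ex using mu2 by (simp add: power_mult_distrib algebra_simps)
  qed
  then obtain s where s: "\<alpha> \<le> s" "s \<le> \<alpha> + pi / \<omega>" "Y s = 0" by auto
  show ?thesis
  proof (intro exI[of _ "exp s"] conjI)
    have e: "exp \<alpha> = \<mu> * \<nu>" unfolding \<alpha>_def using assms by simp
    show "\<mu> * \<nu> \<le> exp s" using s(1) e by (metis exp_le_cancel_iff)
    have "exp s \<le> exp (\<alpha> + pi / \<omega>)" using s(2) by simp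
    then show "exp s \<le> \<mu> * \<nu> * exp (pi / (\<nu> * sqrt (\<mu>\<^sup>2 - 1)))"
      unfolding exp_add e \<omega>_def .
    show "Phi (\<nu> + 1) ((exp s)\<^sup>2) = 0"
      using s(3) unfolding Y_def P_def ex by simp
  qed
qed

text \<open>The factor exp (pi / (\<nu> sqrt (\<mu>^2 - 1))) tends to 1 as \<nu> grows, so the zero
  lies within any prescribed ratio \<rho> > 1 of \<mu> \<nu>.\<close>

lemma eventually_Phi_zero:
  assumes "\<mu> > 1" "\<rho> > 1"
  shows "\<forall>\<^sub>F \<nu> in at_top. \<exists>z. \<mu> * \<nu> \<le> z \<and> z \<le> \<rho> * (\<mu> * \<nu>) \<and> Phi (\<nu> + 1) (z\<^sup>2) = 0"
proof -
  define d where "d = sqrt (\<mu>\<^sup>2 - 1)"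
  have d: "d > 0" unfolding d_def using assms by (simp add: one_less_power)
  have L: "ln \<rho> > 0" using assms by simp
  show ?thesis
    using eventually_ge_at_top[of "pi / (d * ln \<rho>)"] eventually_gt_at_top[of 0]
  proof eventually_elim
    case (elim \<nu>)
    have "pi / (\<nu> * d) \<le> ln \<rho>"
      using elim d L by (simp add: field_simps)
    then have "exp (pi / (\<nu> * d)) \<le> \<rho>"
      using assms by (simp add: ln_ge_iff)
    then have "\<mu> * \<nu> * exp (pi / (\<nu> * d)) \<le> \<rho> * (\<mu> * \<nu>)"
      using assms elim by (simp add: mult.commute)
    then show ?case
      using Phi_zero_exists[OF elim(2) assms(1)] unfolding d_def by (meson order_trans)
  qed
qed

text \<open>
  The transmission condition says that \<open>\<Phi>(n\<^sup>2 k\<^sup>2) / \<Phi>(k\<^sup>2)\<close> has a critical point at \<open>k\<close>;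
  there is one between two zeros of the numerator.
\<close>

lemma eventually_eigenvalue:
  assumes "1 < \<kappa>" "\<kappa> \<le> n"
  shows "\<forall>\<^sub>F \<nu> in at_top. \<exists>k. \<nu> \<le> n * k \<and> n * k \<le> \<kappa> * \<nu> \<and>
    Phi (\<nu> + 1) (k\<^sup>2) \<noteq> 0 \<and> Phi (\<nu> + 1) ((n * k)\<^sup>2) \<noteq> 0 \<and>
    n\<^sup>2 * Phi (\<nu> + 2) ((n * k)\<^sup>2) * Phi (\<nu> + 1) (k\<^sup>2) = Phi (\<nu> + 2) (k\<^sup>2) * Phi (\<nu> + 1) ((n * k)\<^sup>2)"
proof -
  define g where "g = root 4 \<kappa>"
  \<comment> \<open>With a fourth root of \<kappa> the two zeros lie in [g \<nu>, g^2 \<nu>] and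
    [g^3 \<nu>, g^4 \<nu>]: these intervals are disjoint, above \<nu>, and end at \<kappa>
    \<nu>.\<close>
  have g: "g > 1" "g ^ 4 = \<kappa>"
    unfolding g_def using assms by auto
  have g3: "g ^ 3 > 1" using g by (simp add: one_less_power)
  show ?thesis
    using eventually_Phi_zero[OF g(1) g(1)] eventually_Phi_zero[OF g3 g(1)] eventually_gt_at_top[of 0]
  proof eventually_elim
    case (elim \<nu>)
    obtain y where y: "g * \<nu> \<le> y" "y \<le> g * (g * \<nu>)" "Phi (\<nu> + 1) (y\<^sup>2) = 0" using elim by blast
    obtain z where z: "g ^ 3 * \<nu> \<le> z" "z \<le> g * (g ^ 3 * \<nu>)" "Phi (\<nu> + 1) (z\<^sup>2) = 0" using elim by blast
    have "g * (g * \<nu>) < g ^ 3 * \<nu>"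
      using g elim by (simp add: power3_eq_cube)
    then have yz: "y < z" using y z by simp
    have "g * (g ^ 3 * \<nu>) = g ^ 4 * \<nu>" by (simp add: power_numeral_reduce)
    then have zl: "z \<le> \<kappa> * \<nu>" using z(2) g(2) by metis
    have ny: "\<nu> \<le> y" using y(1) g(1) elim(3) mult_right_mono[of 1 g \<nu>] by linarith
    have n0: "n > 0" using assms by simp
    define q where "q = (\<lambda>k. Phi (\<nu> + 1) ((n * k)\<^sup>2) / Phi (\<nu> + 1) (k\<^sup>2))"
    define q' where "q' = (\<lambda>k. (- 2 * n\<^sup>2 * k / (4 * (\<nu> + 1)) * Phi (\<nu> + 1 + 1) ((n * k)\<^sup>2) * Phi (\<nu> + 1) (k\<^sup>2)
      - Phi (\<nu> + 1) ((n * k)\<^sup>2) * (- 2 * k / (4 * (\<nu> + 1)) * Phi (\<nu> + 1 + 1) (k\<^sup>2)))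
      / (Phi (\<nu> + 1) (k\<^sup>2) * Phi (\<nu> + 1) (k\<^sup>2)))"
    \<comment> \<open>This is where \<kappa> <= n is used: k <= z / n <= \<kappa> \<nu> / n <=
      \<nu>, so the denominator of \<open>q\<close> stays below the turning point while the
      numerator oscillates.\<close>
    have pos: "Phi (\<nu> + 1) (k\<^sup>2) > 0" if "y / n \<le> k" "k \<le> z / n" for k
    proof (rule Phi_pos)
      have "0 \<le> k" using that n0 ny elim by (smt (verit) divide_nonneg_pos)
      moreover have "z \<le> n * \<nu>"
        using zl assms elim by (meson less_imp_le mult_right_mono order_trans)
      then have "k \<le> \<nu>" using that n0 by (smt (verit) divide_le_eq mult.commute)
      ultimately show "k\<^sup>2 \<le> (\<nu> + 1 - 1)\<^sup>2" by (simp add: power_mono)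
    qed (use elim in auto)
    have der: "(q has_real_derivative q' k) (at k)" if "y / n \<le> k" "k \<le> z / n" for k
    proof -
      have "Phi (\<nu> + 1) (k\<^sup>2) \<noteq> 0" using pos[OF that] by simp
      then show ?thesis
        unfolding q_def q'_def using elim
        by (auto intro!: derivative_eq_intros simp: field_simps power2_eq_square)
    qed
    have lt: "y / n < z / n" using yz n0 by (simp add: divide_strict_right_mono)
    have "\<exists>k>y / n. k < z / n \<and> (q has_real_derivative 0) (at k)"
    proof (rule Rolle[OF lt])
      show "q (y / n) = q (z / n)" unfolding q_def using y z n0 by simp
      show "continuous_on {y / n..z / n} q"
        using der by (meson DERIV_isCont atLeastAtMost_iff continuous_at_imp_continuous_on)
      show "q differentiable (at x)" if "y / n < x" "x < z / n" for x
        using der[of x] that by (auto simp: real_differentiable_def)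
    qed
    then obtain k where k: "y / n < k" "k < z / n" "(q has_real_derivative 0) (at k)" by blast
    have "q' k = 0" using DERIV_unique[OF k(3) der] k by simp
    moreover have k0: "k > 0" using k ny elim n0 by (smt (verit) divide_pos_pos)
    moreover have pk: "Phi (\<nu> + 1) (k\<^sup>2) > 0" using pos k by simp
    moreover have "q' k = - (k / (2 * (\<nu> + 1))) * (n\<^sup>2 * Phi (\<nu> + 1 + 1) ((n * k)\<^sup>2) * Phi (\<nu> + 1) (k\<^sup>2) -
        Phi (\<nu> + 1 + 1) (k\<^sup>2) * Phi (\<nu> + 1) ((n * k)\<^sup>2)) / (Phi (\<nu> + 1) (k\<^sup>2) * Phi (\<nu> + 1) (k\<^sup>2))"
    proof -
      obtain A where A: "A = \<nu> + 1" by simp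
      show ?thesis unfolding q'_def A[symmetric] by (simp add: algebra_simps)
    qed
    ultimately have eq: "n\<^sup>2 * Phi (\<nu> + 2) ((n * k)\<^sup>2) * Phi (\<nu> + 1) (k\<^sup>2) =
        Phi (\<nu> + 2) (k\<^sup>2) * Phi (\<nu> + 1) ((n * k)\<^sup>2)"
      using elim(3) by (simp add: add.assoc)
    \<comment> \<open>This value becomes one of the two amplitudes. If it vanished, the critical
      point equation would force \<open>Phi (\<nu> + 2)\<close> to vanish at the same point, making
      it a double zero.\<close>
    have "Phi (\<nu> + 1) ((n * k)\<^sup>2) \<noteq> 0"
    proof
      assume *: "Phi (\<nu> + 1) ((n * k)\<^sup>2) = 0"
      then have "Phi (\<nu> + 1 + 1) ((n * k)\<^sup>2) = 0" using eq pk n0 by (simp add: add.assoc)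
      then show False
        using Phi_no_double_zero[OF _ _ *] elim k0 n0 by simp
    qed
    moreover have "\<nu> \<le> n * k" "n * k \<le> \<kappa> * \<nu>"
      using k ny zl n0 by (simp_all add: field_simps)
    ultimately show ?case using eq pk by (intro exI[of _ k]) auto
  qed
qed

section \<open>Calculus of smooth functions\<close>

lemma partial_deriv_at:
  "(f has_derivative D) (at x) \<Longrightarrow> partial_deriv b f x = D b"
  unfolding partial_deriv_def using frechet_derivative_at by metis

lemma partial_deriv_add:
  assumes "f differentiable (at x)" "g differentiable (at x)"
  shows "partial_deriv b (\<lambda>x. f x + g x) x = partial_deriv b f x + partial_deriv b g x"
  using assms unfolding partial_deriv_def frechet_derivative_works
  by (metis (no_types) frechet_derivative_at has_derivative_add)

lemma partial_deriv_diff: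
  assumes "f differentiable (at x)" "g differentiable (at x)"
  shows "partial_deriv b (\<lambda>x. f x - g x) x = partial_deriv b f x - partial_deriv b g x"
  using assms unfolding partial_deriv_def frechet_derivative_works
  by (metis (no_types) frechet_derivative_at has_derivative_diff)

lemma partial_deriv_mult:
  assumes "f differentiable (at x)" "g differentiable (at x)"
  shows "partial_deriv b (\<lambda>x. f x * g x) x = f x * partial_deriv b g x + partial_deriv b f x * g x"
  using partial_deriv_at[OF has_derivative_mult[OF assms[unfolded frechet_derivative_works]]]
  unfolding partial_deriv_def .

definition smooth :: "('a::euclidean_space \<Rightarrow> complex) \<Rightarrow> bool" where
  "smooth f \<longleftrightarrow> (\<forall>k. Ck k f)"

lemma Ck_Suc_imp_Ck: "Ck (Suc k) f \<Longrightarrow> Ck k f"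
proof (induction k arbitrary: f)
  case 0
  then show ?case
    by (auto intro!: continuous_at_imp_continuous_on differentiable_imp_continuous_within)
qed auto

lemma smooth_differentiable: "smooth f \<Longrightarrow> f differentiable (at x)"
  unfolding smooth_def by (metis Ck.simps(2))

lemma smooth_partial_deriv: "smooth f \<Longrightarrow> b \<in> Basis \<Longrightarrow> smooth (partial_deriv b f)"
  unfolding smooth_def by (metis Ck.simps(2))

lemma smooth_continuous_on: "smooth f \<Longrightarrow> continuous_on S f"
  unfolding smooth_def by (metis Ck.simps(1) continuous_on_subset subset_UNIV)

lemma smooth_has_derivative: 
  assumes "smooth f" 
  shows "(f has_derivative (\<lambda>h. \<Sum>b\<in>Basis. (h \<bullet> b) *\<^sub>R partial_deriv b f x)) (at x)"
proof -
  have d: "(f has_derivative frechet_derivative f (at x)) (at x)"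
    using smooth_differentiable[OF assms] frechet_derivative_works by blast
  then have lin: "linear (frechet_derivative f (at x))"
    by (rule has_derivative_linear)
  have "frechet_derivative f (at x) h = (\<Sum>b\<in>Basis. (h \<bullet> b) *\<^sub>R partial_deriv b f x)" for h
  proof -
    have "frechet_derivative f (at x) h = frechet_derivative f (at x) (\<Sum>b\<in>Basis. (h \<bullet> b) *\<^sub>R b)"
      by (simp add: euclidean_representation)
    then show ?thesis
      by (simp add: linear_sum[OF lin] linear_scale[OF lin] partial_deriv_def)
  qed
  then have "frechet_derivative f (at x) = (\<lambda>h. \<Sum>b\<in>Basis. (h \<bullet> b) *\<^sub>R partial_deriv b f x)" by auto
  with d show ?thesis by simp
qed

lemma Ck_add: "Ck k f \<Longrightarrow> Ck k g \<Longrightarrow> Ck k (\<lambda>x. f x + g x)"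
proof (induction k arbitrary: f g)
  case 0
  then show ?case by (auto intro: continuous_intros)
next
  case (Suc k)
  then have "partial_deriv b (\<lambda>x. f x + g x) = (\<lambda>x. partial_deriv b f x + partial_deriv b g x)" for b
    by (auto simp: partial_deriv_add)
  with Suc show ?case by auto
qed

lemma Ck_mult: "Ck k f \<Longrightarrow> Ck k g \<Longrightarrow> Ck k (\<lambda>x. f x * g x)"
proof (induction k arbitrary: f g)
  case 0
  then show ?case by (auto intro: continuous_intros)
next
  case (Suc k)
  then have "partial_deriv b (\<lambda>x. f x * g x) = (\<lambda>x. f x * partial_deriv b g x + partial_deriv b f x * g x)" for b
    by (auto simp: partial_deriv_mult)
  with Suc Ck_Suc_imp_Ck[of k f] Ck_Suc_imp_Ck[of k g] show ?case
    by (auto intro!: Ck_add Suc.IH)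
qed

lemma partial_deriv_const: "partial_deriv b (\<lambda>x. c) = (\<lambda>x. 0)"
  by (rule ext, rule partial_deriv_at[where D = "\<lambda>_. 0"]) simp

lemma Ck_const: "Ck k (\<lambda>x. c)"
proof (induction k arbitrary: c)
  case (Suc k)
  then show ?case by (simp add: partial_deriv_const)
qed simp

lemma smooth_const [simp]: "smooth (\<lambda>x. c)"
  unfolding smooth_def by (simp add: Ck_const)

lemma smooth_add: "smooth f \<Longrightarrow> smooth g \<Longrightarrow> smooth (\<lambda>x. f x + g x)"
  unfolding smooth_def by (simp add: Ck_add)

lemma smooth_mult: "smooth f \<Longrightarrow> smooth g \<Longrightarrow> smooth (\<lambda>x. f x * g x)"
  unfolding smooth_def by (simp add: Ck_mult)

lemma smooth_uminus: "smooth f \<Longrightarrow> smooth (\<lambda>x. - f x)"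
  using smooth_mult[of "\<lambda>_. -1" f] by simp

lemma smooth_diff: "smooth f \<Longrightarrow> smooth g \<Longrightarrow> smooth (\<lambda>x. f x - g x)"
  using smooth_add[OF _ smooth_uminus, of f g] by simp

lemma smooth_power: "smooth f \<Longrightarrow> smooth (\<lambda>x. f x ^ m)"
  by (induction m) (auto intro: smooth_mult)

lemma smooth_sum: "(\<And>i. i \<in> I \<Longrightarrow> smooth (f i)) \<Longrightarrow> smooth (\<lambda>x. \<Sum>i\<in>I. f i x)"
  by (induction I rule: infinite_finite_induct) (auto intro: smooth_add)

lemma smooth_laplacian: "smooth f \<Longrightarrow> smooth (laplacian f)"
  unfolding laplacian_def[abs_def] by (intro smooth_sum smooth_partial_deriv)

lemma partial_deriv_inner: "partial_deriv b (\<lambda>x. of_real (x \<bullet> c)) x = of_real (b \<bullet> c)"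
  by (rule partial_deriv_at) (auto intro!: derivative_eq_intros)

lemma smooth_inner: "smooth (\<lambda>x. of_real (x \<bullet> c))"
  unfolding smooth_def
proof
  show "Ck k (\<lambda>x. complex_of_real (x \<bullet> c))" for k
  proof (cases k)
    case (Suc k)
    have "(\<lambda>x. complex_of_real (x \<bullet> c)) differentiable at x" for x
      unfolding differentiable_def by (rule exI) (rule derivative_intros)+
    with Suc show ?thesis
      by (simp add: partial_deriv_inner[abs_def] Ck_const)
  qed (auto intro!: continuous_intros)
qed

lemma has_derivative_radial:
  fixes h :: "real \<Rightarrow> real"
  assumes "(h has_real_derivative h') (at (x \<bullet> x))"
  shows "((\<lambda>x. complex_of_real (h (x \<bullet> x))) has_derivative (\<lambda>y. of_real (h' * (2 * (x \<bullet> y))))) (at x)"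
proof -
  have "((\<lambda>x. h (x \<bullet> x)) has_derivative (\<lambda>y. h' * (x \<bullet> y + y \<bullet> x))) (at x)"
    using has_derivative_compose[OF has_derivative_inner[OF has_derivative_ident has_derivative_ident]
        assms[unfolded has_field_derivative_def], of UNIV]
    by simp
  then show ?thesis
    by (auto intro: derivative_eq_intros simp: inner_commute)
qed

lemma partial_deriv_radial:
  fixes h :: "real \<Rightarrow> real"
  assumes "(h has_real_derivative h') (at (x \<bullet> x))"
  shows "partial_deriv b (\<lambda>x. complex_of_real (h (x \<bullet> x))) x = 2 * of_real (x \<bullet> b) * of_real h'"
  using partial_deriv_at[OF has_derivative_radial[OF assms], of b] by simp

text \<open>A partial derivative of the radial function with profile \<open>h i\<close> is a
  coordinate function times the one with profile \<open>h (Suc i)\<close>. Supplying the whole chain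
  of derivatives lets the induction on k run for all i at once. Profiles are functions of |x|^2,
  which avoids the singularity of |x| at the origin.\<close>

lemma smooth_radial:
  fixes h :: "nat \<Rightarrow> real \<Rightarrow> real"
  assumes "\<And>i t. (h i has_real_derivative h (Suc i) t) (at t)"
  shows "smooth (\<lambda>x::'a::euclidean_space. of_real (h i (x \<bullet> x)))"
  unfolding smooth_def
proof
  show "Ck k (\<lambda>x::'a. complex_of_real (h i (x \<bullet> x)))" for k
  proof (induction k arbitrary: i)
    case 0
    have "continuous_on UNIV (h i)"
      using assms by (meson DERIV_isCont continuous_at_imp_continuous_on)
    then show ?case
      by (auto intro!: continuous_intros intro: continuous_on_compose2)
  next
    case (Suc k)
    have "partial_deriv b (\<lambda>x::'a. complex_of_real (h i (x \<bullet> x))) =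
        (\<lambda>x. 2 * of_real (x \<bullet> b) * of_real (h (Suc i) (x \<bullet> x)))" for b
      by (rule ext) (rule partial_deriv_radial[OF assms])
    moreover have "Ck k (\<lambda>x::'a. 2 * complex_of_real (x \<bullet> b))" for b
      using smooth_mult[OF smooth_const smooth_inner, of 2 b] unfolding smooth_def by simp
    moreover have "(\<lambda>x::'a. complex_of_real (h i (x \<bullet> x))) differentiable at x" for x
      unfolding differentiable_def using has_derivative_radial[OF assms] by blast
    ultimately show ?case
      by (auto intro!: Ck_mult[OF _ Suc.IH])
  qed
qed

lemma smooth_lipschitz:
  assumes "smooth f" "convex S" "compact S"
  obtains L where "L \<ge> 0" "\<And>x y. x \<in> S \<Longrightarrow> y \<in> S \<Longrightarrow> cmod (f x - f y) \<le> L * norm (x - y)"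
proof -
  have "continuous_on S (\<lambda>x. \<Sum>b\<in>Basis. cmod (partial_deriv b f x))"
    using assms(1) by (intro continuous_intros smooth_continuous_on smooth_partial_deriv)
  then have "bounded ((\<lambda>x. \<Sum>b\<in>Basis. cmod (partial_deriv b f x)) ` S)"
    using assms(3) compact_continuous_image compact_imp_bounded by blast
  then obtain L where L: "L > 0" "\<And>x. x \<in> S \<Longrightarrow> norm (\<Sum>b\<in>Basis. cmod (partial_deriv b f x)) \<le> L"
    unfolding bounded_pos by auto
  have "cmod (f x - f y) \<le> L * norm (x - y)" if "x \<in> S" "y \<in> S" for x y
  proof (rule differentiable_bound[OF assms(2) _ _ that])
    fix x assume x: "x \<in> S"
    show "(f has_derivative (\<lambda>h. \<Sum>b\<in>Basis. (h \<bullet> b) *\<^sub>R partial_deriv b f x)) (at x within S)"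
      by (rule has_derivative_at_withinI[OF smooth_has_derivative[OF assms(1)]])
    show "onorm (\<lambda>h. \<Sum>b\<in>Basis. (h \<bullet> b) *\<^sub>R partial_deriv b f x) \<le> L"
    proof (rule onorm_le)
      fix h
      have "cmod (\<Sum>b\<in>Basis. (h \<bullet> b) *\<^sub>R partial_deriv b f x) \<le>
          (\<Sum>b\<in>Basis. cmod ((h \<bullet> b) *\<^sub>R partial_deriv b f x))"
        by (rule norm_sum)
      also have "\<dots> \<le> (\<Sum>b\<in>Basis. cmod (partial_deriv b f x) * norm h)"
        by (intro sum_mono) (simp add: mult.commute[of _ "norm h"] mult_right_mono Basis_le_norm)
      also have "\<dots> = (\<Sum>b\<in>Basis. cmod (partial_deriv b f x)) * norm h"
        by (simp add: sum_distrib_right)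
      also have "\<dots> \<le> L * norm h"
        using L(2)[OF x] by (intro mult_right_mono) auto
      finally show "cmod (\<Sum>b\<in>Basis. (h \<bullet> b) *\<^sub>R partial_deriv b f x) \<le> L * norm h" .
    qed
  qed
  then show ?thesis using that[of L] L(1) by simp
qed

section \<open>Test functions\<close>

lemma test_function_smooth: "test_function \<Omega> \<phi> \<Longrightarrow> smooth \<phi>"
  unfolding test_function_def smooth_def by blast

lemma test_function_mult:
  assumes "smooth f" "test_function \<Omega> \<phi>"
  shows "test_function \<Omega> (\<lambda>x. f x * \<phi> x)"
  using assms smooth_mult[of f \<phi>] unfolding test_function_def smooth_def by force

lemma partial_deriv_outside:
  assumes "closed K" "\<And>x. x \<notin> K \<Longrightarrow> f x = 0" "x \<notin> K"
  shows "partial_deriv b f x = 0"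
proof -
  have "(f has_derivative (\<lambda>_. 0)) (at x)"
  proof (rule has_derivative_transform_within_open[where s = "- K"])
    show "((\<lambda>_. 0) has_derivative (\<lambda>_. 0)) (at x)" by simp
  qed (use assms in auto)
  then show ?thesis using partial_deriv_at by blast
qed

lemma test_function_partial_deriv:
  assumes "test_function \<Omega> \<phi>" "b \<in> Basis"
  shows "test_function \<Omega> (partial_deriv b \<phi>)"
proof -
  obtain K where K: "compact K" "K \<subseteq> \<Omega>" "\<And>x. x \<notin> K \<Longrightarrow> \<phi> x = 0"
    using assms unfolding test_function_def by blast
  have "partial_deriv b \<phi> x = 0" if "x \<notin> K" for x
    using partial_deriv_outside[OF compact_imp_closed[OF K(1)] K(3) that] .
  moreover have "smooth (partial_deriv b \<phi>)"
    using smooth_partial_deriv[OF test_function_smooth[OF assms(1)] assms(2)] .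
  ultimately show ?thesis
    unfolding test_function_def using K smooth_def by blast
qed

text \<open>By translation invariance the difference quotients integrate to \<open>0\<close>.\<close>

lemma integral_partial_deriv_eq_0:
  fixes \<phi> :: "'a::euclidean_space \<Rightarrow> complex"
  assumes "test_function UNIV \<phi>" "b \<in> Basis"
  shows "(LINT x|lborel. partial_deriv b \<phi> x) = 0"
proof -
  have sm: "smooth \<phi>" using assms test_function_smooth by blast
  obtain K where K: "compact K" "\<And>x. x \<notin> K \<Longrightarrow> \<phi> x = 0"
    using assms unfolding test_function_def by blast
  obtain R where R: "R > 0" "K \<subseteq> ball 0 R"
    using bounded_subset_ballD[OF compact_imp_bounded[OF K(1)], of 0] by auto
  obtain L where L: "L \<ge> 0" "\<And>x y. x \<in> cball 0 (R + 2) \<Longrightarrow> y \<in> cball 0 (R + 2) \<Longrightarrow> cmod (\<phi> x - \<phi> y) \<le> L * norm (x - y)"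
    using smooth_lipschitz[OF sm convex_cball compact_cball] by blast
  define s where "s = (\<lambda>n x. (\<phi> (inverse (real (Suc n)) *\<^sub>R b + x) - \<phi> x) * of_nat (Suc n))"
  have meas: "\<phi> \<in> borel_measurable borel"
    using smooth_continuous_on[OF sm] by (rule borel_measurable_continuous_onI)
  have int: "integrable lborel \<phi>"
  proof -
    have "integrable lborel (\<lambda>x. indicator (cball 0 R) x *\<^sub>R \<phi> x)"
      by (rule borel_integrable_compact) (auto intro: smooth_continuous_on[OF sm])
    moreover have "indicator (cball 0 R) x *\<^sub>R \<phi> x = \<phi> x" for x
      using K(2)[of x] R(2) by (cases "x \<in> K") (auto simp: indicator_def)
    ultimately show ?thesis by simp
  qed
  have shift: "has_bochner_integral lborel (\<lambda>x. \<phi> (c + x)) (integral\<^sup>L lborel \<phi>)" for c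
  proof -
    have *: "integrable (distr lborel borel ((+) c)) \<phi>"
      unfolding lborel_distr_plus by (rule int)
    have "integrable lborel (\<lambda>x. \<phi> (c + x))"
      by (rule integrable_distr[OF _ *]) simp
    moreover have "integral\<^sup>L (distr lborel borel ((+) c)) \<phi> = (LINT x|lborel. \<phi> (c + x))"
      by (rule integral_distr) (use meas in auto)
    ultimately show ?thesis
      unfolding lborel_distr_plus by (simp add: has_bochner_integral_iff)
  qed
  have s0: "(LINT x|lborel. s n x) = 0" for n
    unfolding s_def using shift[of "inverse (real (Suc n)) *\<^sub>R b"] int
    by (simp add: has_bochner_integral_iff)
  have "(\<lambda>n. LINT x|lborel. s n x) \<longlonglongrightarrow> (LINT x|lborel. partial_deriv b \<phi> x)"
  \<comment> \<open>The steps have length at most 1. For |x| <= R + 1 both points lie in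
    \<open>cball 0 (R + 2)\<close>, where \<open>L\<close> is a Lipschitz constant; for |x| > R + 1
    both lie outside \<open>K\<close> and the quotient is 0.\<close>
  proof (rule integral_dominated_convergence[where w = "\<lambda>x. indicator (cball 0 (R + 1)) x * L"])
    show "(\<lambda>x. partial_deriv b \<phi> x) \<in> borel_measurable lborel"
      using smooth_continuous_on[OF smooth_partial_deriv[OF sm assms(2)]]
      by (simp add: borel_measurable_continuous_onI)
    show "s n \<in> borel_measurable lborel" for n
      unfolding s_def using meas by measurable
    show "integrable lborel (\<lambda>x::'a. indicator (cball 0 (R + 1)) x * L)"
      by (intro integrable_mult_left integrable_real_indicator emeasure_bounded_finite) auto
    show "AE x in lborel. cmod (s n x) \<le> indicator (cball 0 (R + 1)) x * L" for n
    proof (rule AE_I2)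
      fix x :: 'a
      define d where "d = inverse (real (Suc n))"
      have d: "0 < d" "d \<le> 1" "d * real (Suc n) = 1" unfolding d_def by (auto simp: field_simps)
      have nb: "norm (d *\<^sub>R b) = d" using d assms(2) by simp
      have sx: "s n x = (\<phi> (d *\<^sub>R b + x) - \<phi> x) * of_nat (Suc n)" unfolding s_def d_def ..
      have tri: "norm (d *\<^sub>R b + x) \<le> d + norm x" "norm x \<le> d + norm (d *\<^sub>R b + x)"
        using norm_triangle_ineq[of "d *\<^sub>R b" x] norm_triangle_ineq4[of "d *\<^sub>R b + x" "d *\<^sub>R b"] nb by auto
      show "cmod (s n x) \<le> indicator (cball 0 (R + 1)) x * L"
      proof (cases "x \<in> cball 0 (R + 1)")
        case True
        have "cmod (\<phi> (d *\<^sub>R b + x) - \<phi> x) \<le> L * norm (d *\<^sub>R b + x - x)"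
          using True d tri by (intro L(2)) auto
        then have "cmod (\<phi> (d *\<^sub>R b + x) - \<phi> x) * real (Suc n) \<le> L * d * real (Suc n)"
          using nb by (intro mult_right_mono) auto
        also have "\<dots> = L" using d(3) by (simp only: mult.assoc mult_1_right)
        finally have "cmod (s n x) \<le> L"
          unfolding sx norm_mult norm_of_nat .
        then show ?thesis using True by simp
      next
        case False
        then have "norm x > R" "norm (d *\<^sub>R b + x) > R" using tri d by auto
        then have "\<phi> x = 0" "\<phi> (d *\<^sub>R b + x) = 0" using R(2) by (auto intro!: K(2))
        then show ?thesis using False unfolding sx by simp
      qed
    qed
    show "AE x in lborel. (\<lambda>n. s n x) \<longlonglongrightarrow> partial_deriv b \<phi> x"
    proof (rule AE_I2)
      fix x :: 'a
      have "((\<lambda>t. \<phi> (x + t *\<^sub>R b)) has_derivative (\<lambda>t. frechet_derivative \<phi> (at x) (t *\<^sub>R b))) (at 0)"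
      proof (rule has_derivative_compose[where g = \<phi> and f = "\<lambda>t. x + t *\<^sub>R b" and g' = "frechet_derivative \<phi> (at x)"])
        show "((\<lambda>t. x + t *\<^sub>R b) has_derivative (\<lambda>t. t *\<^sub>R b)) (at 0)"
          by (auto intro!: derivative_eq_intros)
        show "(\<phi> has_derivative frechet_derivative \<phi> (at x)) (at (x + 0 *\<^sub>R b))"
          using smooth_differentiable[OF sm] frechet_derivative_works by force
      qed
      moreover have "linear (frechet_derivative \<phi> (at x))"
        using smooth_differentiable[OF sm] linear_frechet_derivative by blast
      ultimately have "((\<lambda>t. \<phi> (x + t *\<^sub>R b)) has_vector_derivative partial_deriv b \<phi> x) (at 0)"
        unfolding has_vector_derivative_def partial_deriv_def by (simp add: linear_scale)
      then have lim: "((\<lambda>t. (\<phi> (x + t *\<^sub>R b) - \<phi> x) /\<^sub>R t) \<longlongrightarrow> partial_deriv b \<phi> x) (at 0)"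
      proof -
        have "((\<lambda>t. norm (\<phi> (x + t *\<^sub>R b) - \<phi> x - t *\<^sub>R partial_deriv b \<phi> x) / norm t) \<longlongrightarrow> 0) (at 0)"
          using \<open>(_ has_vector_derivative _) _\<close> unfolding has_vector_derivative_def has_derivative_at by simp
        moreover have "\<forall>\<^sub>F t in at 0. norm (\<phi> (x + t *\<^sub>R b) - \<phi> x - t *\<^sub>R partial_deriv b \<phi> x) / norm t =
            norm ((\<phi> (x + t *\<^sub>R b) - \<phi> x) /\<^sub>R t - partial_deriv b \<phi> x)"
        proof (rule eventually_at_ball'[THEN eventually_mono, of 1 0 UNIV])
          fix t :: real assume "t \<in> ball 0 1 \<and> t \<noteq> 0 \<and> t \<in> UNIV"
          then have "(\<phi> (x + t *\<^sub>R b) - \<phi> x) /\<^sub>R t - partial_deriv b \<phi> x =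
              (\<phi> (x + t *\<^sub>R b) - \<phi> x - t *\<^sub>R partial_deriv b \<phi> x) /\<^sub>R t"
            by (simp add: scaleR_diff_right)
          then show "norm (\<phi> (x + t *\<^sub>R b) - \<phi> x - t *\<^sub>R partial_deriv b \<phi> x) / norm t =
              norm ((\<phi> (x + t *\<^sub>R b) - \<phi> x) /\<^sub>R t - partial_deriv b \<phi> x)"
            by (simp add: divide_inverse mult.commute)
        qed simp
        ultimately have "((\<lambda>t. norm ((\<phi> (x + t *\<^sub>R b) - \<phi> x) /\<^sub>R t - partial_deriv b \<phi> x)) \<longlongrightarrow> 0) (at 0)"
          by (rule Lim_transform_eventually)
        then show ?thesis
          by (simp add: tendsto_norm_zero_iff LIM_zero_iff)
      qed
      have "(\<lambda>n. (\<phi> (x + inverse (real (Suc n)) *\<^sub>R b) - \<phi> x) /\<^sub>R inverse (real (Suc n))) \<longlonglongrightarrow> partial_deriv b \<phi> x"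
        by (rule filterlim_compose[OF lim])
           (use LIMSEQ_inverse_real_of_nat in \<open>auto simp: filterlim_at simp del: of_nat_Suc\<close>)
      then show "(\<lambda>n. s n x) \<longlonglongrightarrow> partial_deriv b \<phi> x"
        unfolding s_def by (simp add: scaleR_conv_of_real mult.commute add.commute)
    qed
  qed
  then show ?thesis
    unfolding s0 using LIMSEQ_unique tendsto_const by metis
qed

section \<open>Smooth functions as elements of Sobolev spaces\<close>

text \<open>The passage from integrals over \<Omega> to \<open>lborel\<close> on the whole space,
  where translation invariance was used.\<close>

lemma integral_lebesgue_on_supported:
  fixes f :: "'a::euclidean_space \<Rightarrow> complex"
  assumes "\<Omega> \<in> sets lebesgue" "continuous_on UNIV f" "\<And>x. x \<notin> \<Omega> \<Longrightarrow> f x = 0"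
  shows "(LINT x|lebesgue_on \<Omega>. f x) = (LINT x|lborel. f x)"
proof -
  have "(LINT x|lebesgue_on \<Omega>. f x) = (LINT x|lebesgue. indicator \<Omega> x *\<^sub>R f x)"
    using assms(1) by (intro integral_restrict_space) auto
  also have "(\<lambda>x. indicator \<Omega> x *\<^sub>R f x) = f"
    using assms(3) by (auto simp: indicator_def)
  also have "(LINT x|lebesgue. f x) = (LINT x|lborel. f x)"
    using assms(2) by (intro integral_completion) (simp add: borel_measurable_continuous_onI)
  finally show ?thesis .
qed

lemma continuous_measurable_lebesgue_on:
  fixes f :: "'a::euclidean_space \<Rightarrow> 'b::{second_countable_topology,real_normed_vector}"
  assumes "continuous_on UNIV f"
  shows "f \<in> borel_measurable (lebesgue_on \<Omega>)"
proof -
  have "f \<in> borel_measurable lborel"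
    using assms by (simp add: borel_measurable_continuous_onI)
  then show ?thesis
    by (rule measurable_restrict_space1[OF measurable_completion])
qed

lemma continuous_integrable_lebesgue_on:
  fixes f :: "'a::euclidean_space \<Rightarrow> 'b::{second_countable_topology,banach}"
  assumes "continuous_on UNIV f" "bounded \<Omega>" "\<Omega> \<in> sets lebesgue"
  shows "integrable (lebesgue_on \<Omega>) f"
proof -
  obtain R where R: "\<Omega> \<subseteq> cball 0 R"
    using bounded_subset_ballD[OF assms(2), of 0] ball_subset_cball by (meson subset_trans)
  have "integrable lborel (\<lambda>x. indicator (cball 0 R) x *\<^sub>R f x)"
    by (rule borel_integrable_compact) (auto intro: continuous_on_subset[OF assms(1)])
  then have "integrable lebesgue (\<lambda>x. indicator (cball 0 R) x *\<^sub>R f x)"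
    by (subst integrable_completion) auto
  then have "set_integrable lebesgue (cball 0 R) f"
    unfolding set_integrable_def .
  then have "set_integrable lebesgue \<Omega> f"
    by (rule set_integrable_subset[OF _ assms(3) R])
  then show ?thesis
    unfolding set_integrable_def using assms(3) by (subst integrable_restrict_space) auto
qed

lemma smooth_in_L2:
  assumes "smooth f" "bounded \<Omega>" "\<Omega> \<in> sets lebesgue"
  shows "in_L2 \<Omega> f"
  unfolding in_L2_def using smooth_continuous_on[OF assms(1)] assms(2,3)
  by (intro conjI continuous_measurable_lebesgue_on continuous_integrable_lebesgue_on continuous_intros)

text \<open>The product u \<phi> is itself a test function, so its partial derivative has integral 0
  over the whole space. The support of \<phi> in \<Omega> replaces any regularity of the
  boundary.\<close>

lemma smooth_integration_by_parts:
  assumes "smooth u" "test_function \<Omega> \<phi>" "b \<in> Basis" "bounded \<Omega>" "\<Omega> \<in> sets lebesgue"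
  shows "(LINT x|lebesgue_on \<Omega>. u x * partial_deriv b \<phi> x) =
    - (LINT x|lebesgue_on \<Omega>. partial_deriv b u x * \<phi> x)"
proof -
  let ?p = "\<lambda>x. u x * \<phi> x"
  have tf: "test_function \<Omega> ?p" by (rule test_function_mult[OF assms(1,2)])
  have s: "smooth \<phi>" "smooth (partial_deriv b u)" "smooth (partial_deriv b \<phi>)" "smooth (partial_deriv b ?p)"
    using test_function_smooth[OF assms(2)] test_function_smooth[OF tf] smooth_partial_deriv assms(1,3) by blast+
  note [continuous_intros] = assms(1)[THEN smooth_continuous_on] s[THEN smooth_continuous_on]
  have "test_function UNIV ?p"
    using tf unfolding test_function_def by blast
  then have "(LINT x|lborel. partial_deriv b ?p x) = 0"
    using assms(3) by (rule integral_partial_deriv_eq_0)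
  moreover have "partial_deriv b ?p x = 0" if "x \<notin> \<Omega>" for x
  proof -
    have "test_function \<Omega> (partial_deriv b ?p)" by (rule test_function_partial_deriv[OF tf assms(3)])
    then show ?thesis using that unfolding test_function_def by blast
  qed
  ultimately have "(LINT x|lebesgue_on \<Omega>. partial_deriv b ?p x) = 0"
    by (subst integral_lebesgue_on_supported) (use assms(5) s(4)[THEN smooth_continuous_on] in auto)
  moreover have "partial_deriv b ?p = (\<lambda>x. u x * partial_deriv b \<phi> x + partial_deriv b u x * \<phi> x)"
    using partial_deriv_mult smooth_differentiable[OF assms(1)] smooth_differentiable[OF s(1)] by blast
  moreover have "(LINT x|lebesgue_on \<Omega>. u x * partial_deriv b \<phi> x + partial_deriv b u x * \<phi> x) =
      (LINT x|lebesgue_on \<Omega>. u x * partial_deriv b \<phi> x) + (LINT x|lebesgue_on \<Omega>. partial_deriv b u x * \<phi> x)"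
    by (intro Bochner_Integration.integral_add continuous_integrable_lebesgue_on continuous_intros assms)
  ultimately show ?thesis by (simp add: eq_neg_iff_add_eq_0)
qed

lemma smooth_has_weak_gradient:
  assumes "smooth u" "bounded \<Omega>" "\<Omega> \<in> sets lebesgue"
  shows "has_weak_gradient \<Omega> u (\<lambda>b. partial_deriv b u)"
  unfolding has_weak_gradient_def
  using smooth_integration_by_parts[OF assms(1) _ _ assms(2,3)]
    smooth_in_L2[OF smooth_partial_deriv[OF assms(1)] assms(2,3)] by blast

lemma smooth_in_H1:
  assumes "smooth u" "bounded \<Omega>" "\<Omega> \<in> sets lebesgue"
  shows "in_H1 \<Omega> u"
  unfolding in_H1_def using smooth_in_L2[OF assms] smooth_has_weak_gradient[OF assms] by blast

lemma smooth_has_weak_laplacian: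
  assumes "smooth u" "bounded \<Omega>" "\<Omega> \<in> sets lebesgue"
  shows "has_weak_laplacian \<Omega> u (laplacian u)"
  unfolding has_weak_laplacian_def
proof (intro conjI allI impI)
  show "in_L2 \<Omega> (laplacian u)"
    by (rule smooth_in_L2[OF smooth_laplacian[OF assms(1)] assms(2,3)])
  fix \<phi> :: "'a \<Rightarrow> complex" assume tf: "test_function \<Omega> \<phi>"
  have sm: "smooth \<phi>" by (rule test_function_smooth[OF tf])
  have int: "integrable (lebesgue_on \<Omega>) (\<lambda>x. f x * g x)" if "smooth f" "smooth g" for f g :: "'a \<Rightarrow> complex"
    using smooth_continuous_on[OF smooth_mult[OF that]] assms(2,3)
    by (rule continuous_integrable_lebesgue_on)
  have "(LINT x|lebesgue_on \<Omega>. u x * laplacian \<phi> x) =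
      (\<Sum>b\<in>Basis. LINT x|lebesgue_on \<Omega>. u x * partial_deriv b (partial_deriv b \<phi>) x)"
    unfolding laplacian_def sum_distrib_left
    by (intro Bochner_Integration.integral_sum int assms(1) smooth_partial_deriv sm)
  also have "\<dots> = (\<Sum>b\<in>Basis. LINT x|lebesgue_on \<Omega>. partial_deriv b (partial_deriv b u) x * \<phi> x)"
  proof (rule sum.cong[OF refl])
    fix b :: 'a assume b: "b \<in> Basis"
    have "(LINT x|lebesgue_on \<Omega>. u x * partial_deriv b (partial_deriv b \<phi>) x) =
        - (LINT x|lebesgue_on \<Omega>. partial_deriv b u x * partial_deriv b \<phi> x)"
      by (rule smooth_integration_by_parts[OF assms(1) test_function_partial_deriv[OF tf b] b assms(2,3)])
    moreover have "(LINT x|lebesgue_on \<Omega>. partial_deriv b u x * partial_deriv b \<phi> x) =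
        - (LINT x|lebesgue_on \<Omega>. partial_deriv b (partial_deriv b u) x * \<phi> x)"
      by (rule smooth_integration_by_parts[OF smooth_partial_deriv[OF assms(1) b] tf b assms(2,3)])
    ultimately show "(LINT x|lebesgue_on \<Omega>. u x * partial_deriv b (partial_deriv b \<phi>) x) =
        (LINT x|lebesgue_on \<Omega>. partial_deriv b (partial_deriv b u) x * \<phi> x)" by simp
  qed
  also have "\<dots> = (LINT x|lebesgue_on \<Omega>. laplacian u x * \<phi> x)"
    unfolding laplacian_def sum_distrib_right
    by (intro Bochner_Integration.integral_sum[symmetric] int smooth_partial_deriv assms(1) sm)
  finally show "(LINT x|lebesgue_on \<Omega>. u x * laplacian \<phi> x) = (LINT x|lebesgue_on \<Omega>. laplacian u x * \<phi> x)" .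
qed
section \<open>Cutoff functions in the unit ball\<close>

lemma poly_times_exp_tendsto_0:
  fixes q :: "real poly"
  assumes "\<epsilon> > 0"
  shows "((\<lambda>y. poly q y * exp (- \<epsilon> * y)) \<longlongrightarrow> 0) at_top"
proof -
  have "((\<lambda>y. y ^ k * exp (- \<epsilon> * y)) \<longlongrightarrow> 0) at_top" for k
  proof -
    have "filterlim (\<lambda>y. \<epsilon> * y) at_top at_top"
      using assms by (intro filterlim_tendsto_pos_mult_at_top[OF tendsto_const]) (auto simp: filterlim_ident)
    from filterlim_compose[OF tendsto_power_div_exp_0[of k] this]
    have "((\<lambda>y. (1 / \<epsilon> ^ k) * ((\<epsilon> * y) ^ k / exp (\<epsilon> * y))) \<longlongrightarrow> (1 / \<epsilon> ^ k) * 0) at_top"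
      by (rule tendsto_mult_left)
    moreover have "(1 / \<epsilon> ^ k) * ((\<epsilon> * y) ^ k / exp (\<epsilon> * y)) = y ^ k * exp (- \<epsilon> * y)" for y
      using assms by (simp add: power_mult_distrib exp_minus field_simps)
    ultimately show ?thesis by simp
  qed
  then have "((\<lambda>y. \<Sum>k\<le>degree q. coeff q k * (y ^ k * exp (- \<epsilon> * y))) \<longlongrightarrow> (\<Sum>k\<le>degree q. coeff q k * 0)) at_top"
    by (intro tendsto_intros)
  then show ?thesis
    by (simp add: poly_altdef sum_distrib_right mult.assoc)
qed

text \<open>The classical flat function exp (-\<epsilon>/d), with a polynomial in 1/d as an extra
  factor so that the family is closed under differentiation.\<close>

definition flat_exp :: "real \<Rightarrow> real poly \<Rightarrow> real \<Rightarrow> real" where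
  "flat_exp \<epsilon> q d = (if d > 0 then poly q (1 / d) * exp (- \<epsilon> * (1 / d)) else 0)"

text \<open>For d > 0 this is the chain rule with y = 1/d, whose derivative -y^2 accounts for
  \<open>monom 1 2\<close>. At d = 0 the exponential beats every power of 1/d, so both one-sided
  difference quotients tend to 0.\<close>

lemma flat_exp_has_derivative:
  assumes "\<epsilon> > 0"
  shows "(flat_exp \<epsilon> q has_real_derivative flat_exp \<epsilon> (monom 1 2 * (smult \<epsilon> q - pderiv q)) d) (at d)"
proof -
  consider "d > 0" | "d < 0" | "d = 0" by linarith
  then show ?thesis
  proof cases
    case 1
    have inv: "((\<lambda>d. 1 / d) has_real_derivative - ((1 / d)\<^sup>2)) (at d)"
      using 1 by (auto intro!: derivative_eq_intros simp: power2_eq_square)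
    have e: "((\<lambda>d. exp (- \<epsilon> * (1 / d))) has_real_derivative exp (- \<epsilon> * (1 / d)) * (- \<epsilon> * - ((1 / d)\<^sup>2))) (at d)"
      by (rule DERIV_chain2[OF DERIV_exp DERIV_cmult[OF inv]])
    have "((\<lambda>d. poly q (1 / d) * exp (- \<epsilon> * (1 / d))) has_real_derivative
        flat_exp \<epsilon> (monom 1 2 * (smult \<epsilon> q - pderiv q)) d) (at d)"
      using DERIV_mult[OF DERIV_chain2[OF poly_DERIV inv, of q] e] 1
      unfolding flat_exp_def by (simp add: poly_monom algebra_simps)
    then show ?thesis
    proof (rule has_field_derivative_transform_within_open)
      show "open {0::real<..}" "d \<in> {0<..}" using 1 by auto
    qed (auto simp: flat_exp_def)
  next
    case 2
    have "((\<lambda>_. 0) has_real_derivative 0) (at d)" by simp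
    then have "(flat_exp \<epsilon> q has_real_derivative 0) (at d)"
    proof (rule has_field_derivative_transform_within_open)
      show "open {..<0::real}" "d \<in> {..<0}" using 2 by auto
    qed (auto simp: flat_exp_def)
    then show ?thesis using 2 by (simp add: flat_exp_def)
  next
    case 3
    have r: "((\<lambda>h. flat_exp \<epsilon> q h / h) \<longlongrightarrow> 0) (at_right 0)"
    proof -
      \<comment> \<open>\<open>pCons 0 q\<close> is y q(y): dividing by h adds one more factor y =
        1/h.\<close>
      have "((\<lambda>h. poly (pCons 0 q) (inverse h) * exp (- \<epsilon> * inverse h)) \<longlongrightarrow> 0) (at_right 0)"
        by (rule filterlim_compose[OF poly_times_exp_tendsto_0[OF assms] filterlim_inverse_at_top_right])
      then show ?thesis
        by (rule Lim_transform_eventually)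
           (auto simp: eventually_at_right_field flat_exp_def divide_inverse intro!: exI[of _ 1])
    qed
    have l: "((\<lambda>h. flat_exp \<epsilon> q h / h) \<longlongrightarrow> 0) (at_left 0)"
      by (rule tendsto_eventually) (auto simp: eventually_at_left_field flat_exp_def intro!: exI[of _ "-1"])
    have "((\<lambda>h. flat_exp \<epsilon> q h / h) \<longlongrightarrow> 0) (at 0)"
      using filterlim_split_at[OF l r] .
    then show ?thesis
      using 3 by (simp add: DERIV_def flat_exp_def)
  qed
qed

text \<open>Each step differentiates once; the minus sign is the inner derivative of 1 - \<delta> -
  t.\<close>

primrec cutoff_poly :: "real \<Rightarrow> nat \<Rightarrow> real poly" where
  "cutoff_poly \<epsilon> 0 = 1"
| "cutoff_poly \<epsilon> (Suc i) = - (monom 1 2 * (smult \<epsilon> (cutoff_poly \<epsilon> i) - pderiv (cutoff_poly \<epsilon> i)))"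

text \<open>The parameter \<delta> acts twice. As a shift it keeps the support in t <= 1 - \<delta>,
  away from the sphere. As the strength of the exponential it makes the profile tend to 1 for every
  t < 1 as \<delta> tends to 0, while the slope times 1 - t stays bounded independently of
  \<delta>.\<close>

definition cutoff_profile :: "real \<Rightarrow> nat \<Rightarrow> real \<Rightarrow> real" where
  "cutoff_profile \<delta> i t = flat_exp \<delta> (cutoff_poly \<delta> i) (1 - \<delta> - t)"

lemma cutoff_profile_has_derivative:
  assumes "\<delta> > 0"
  shows "(cutoff_profile \<delta> i has_real_derivative cutoff_profile \<delta> (Suc i) t) (at t)"
proof -
  have "((\<lambda>t. 1 - \<delta> - t) has_real_derivative - 1) (at t)"
    by (auto intro!: derivative_eq_intros)
  from DERIV_chain2[OF flat_exp_has_derivative[OF assms, of "cutoff_poly \<delta> i"] this]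
  show ?thesis
    unfolding cutoff_profile_def[abs_def] by (simp add: flat_exp_def if_distrib[of uminus] cong: if_cong)
qed

lemma cutoff_profile_0: "cutoff_profile \<delta> 0 t = (if t < 1 - \<delta> then exp (- \<delta> / (1 - \<delta> - t)) else 0)"
  unfolding cutoff_profile_def flat_exp_def by simp

lemma cutoff_profile_1:
  "cutoff_profile \<delta> 1 t = (if t < 1 - \<delta> then - \<delta> / (1 - \<delta> - t)\<^sup>2 * exp (- \<delta> / (1 - \<delta> - t)) else 0)"
  unfolding cutoff_profile_def flat_exp_def
  by (simp add: poly_monom power_one_over pderiv_1)

text \<open>With d = 1 - \<delta> - t and y = \<delta>/d the product equals (y + y^2) exp (-y),
  which no longer depends on \<delta> and t separately. The bound uses 1 + y + y^2/2 <= exp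
  y.\<close>

lemma cutoff_profile_1_bound:
  assumes "\<delta> > 0" "t < 1"
  shows "\<bar>cutoff_profile \<delta> 1 t\<bar> * (1 - t) \<le> 3"
proof (cases "t < 1 - \<delta>")
  case True
  define d where "d = 1 - \<delta> - t"
  define y where "y = \<delta> / d"
  have d: "d > 0" "1 - t = d + \<delta>" unfolding d_def using True by auto
  have y: "y > 0" unfolding y_def using d assms by simp
  have "\<bar>cutoff_profile \<delta> 1 t\<bar> * (1 - t) = \<delta> / d\<^sup>2 * (d + \<delta>) * exp (- y)"
    using True assms d unfolding cutoff_profile_1 d(2) by (simp add: d_def[symmetric] y_def abs_mult)
  also have "\<delta> / d\<^sup>2 * (d + \<delta>) = y + y\<^sup>2"
    unfolding y_def using d by (simp add: field_simps power2_eq_square)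
  also have "(y + y\<^sup>2) * exp (- y) \<le> 3 * exp y * exp (- y)"
  proof (rule mult_right_mono)
    show "y + y\<^sup>2 \<le> 3 * exp y"
      using exp_lower_Taylor_quadratic[of y] y zero_le_power2[of y] by linarith
  qed simp
  also have "3 * exp y * exp (- y) = 3" by (simp add: exp_minus)
  finally show ?thesis .
next
  case False
  then show ?thesis unfolding cutoff_profile_1 by simp
qed

lemma cutoff_profile_0_tendsto:
  assumes "t < 1"
  shows "(\<lambda>j. cutoff_profile (inverse (real (Suc j))) 0 t) \<longlonglongrightarrow> 1"
proof -
  have "(\<lambda>j. exp (- inverse (real (Suc j)) / (1 - inverse (real (Suc j)) - t))) \<longlonglongrightarrow> exp (- 0 / (1 - 0 - t))"
    using assms by (intro tendsto_intros LIMSEQ_inverse_real_of_nat) auto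
  then have "(\<lambda>j. exp (- inverse (real (Suc j)) / (1 - inverse (real (Suc j)) - t))) \<longlonglongrightarrow> 1"
    by (simp del: of_nat_Suc)
  then show ?thesis
  proof (rule Lim_transform_eventually)
    have "\<forall>\<^sub>F j in sequentially. inverse (real (Suc j)) < 1 - t"
      using assms by (intro order_tendstoD(2)[OF LIMSEQ_inverse_real_of_nat]) auto
    then show "\<forall>\<^sub>F j in sequentially. exp (- inverse (real (Suc j)) / (1 - inverse (real (Suc j)) - t)) = cutoff_profile (inverse (real (Suc j))) 0 t"
      by eventually_elim (simp add: cutoff_profile_0 del: One_nat_def of_nat_Suc)
  qed
qed

lemma cutoff_profile_1_tendsto:
  assumes "t < 1"
  shows "(\<lambda>j. cutoff_profile (inverse (real (Suc j))) 1 t) \<longlonglongrightarrow> 0"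
proof -
  have "(\<lambda>j. - inverse (real (Suc j)) / (1 - inverse (real (Suc j)) - t)\<^sup>2 *
      exp (- inverse (real (Suc j)) / (1 - inverse (real (Suc j)) - t))) \<longlonglongrightarrow> - 0 / (1 - 0 - t)\<^sup>2 * exp (- 0 / (1 - 0 - t))"
    using assms by (intro tendsto_intros LIMSEQ_inverse_real_of_nat) auto
  then have "(\<lambda>j. - inverse (real (Suc j)) / (1 - inverse (real (Suc j)) - t)\<^sup>2 *
      exp (- inverse (real (Suc j)) / (1 - inverse (real (Suc j)) - t))) \<longlonglongrightarrow> 0"
    by (simp del: of_nat_Suc)
  then show ?thesis
  proof (rule Lim_transform_eventually)
    have "\<forall>\<^sub>F j in sequentially. inverse (real (Suc j)) < 1 - t"
      using assms by (intro order_tendstoD(2)[OF LIMSEQ_inverse_real_of_nat]) auto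
    then show "\<forall>\<^sub>F j in sequentially. - inverse (real (Suc j)) / (1 - inverse (real (Suc j)) - t)\<^sup>2 *
      exp (- inverse (real (Suc j)) / (1 - inverse (real (Suc j)) - t)) = cutoff_profile (inverse (real (Suc j))) 1 t"
      by eventually_elim (simp add: cutoff_profile_1 del: One_nat_def of_nat_Suc)
  qed
qed

text \<open>Here \<delta> = 1/(j + 1). For j = 0 the function is identically 0; only the limit in j
  matters.\<close>

definition ball_cutoff :: "nat \<Rightarrow> 'a::euclidean_space \<Rightarrow> complex" where
  "ball_cutoff j x = of_real (cutoff_profile (inverse (real (Suc j))) 0 (x \<bullet> x))"

lemma partial_deriv_ball_cutoff:
  "partial_deriv b (ball_cutoff j) x = 2 * of_real (x \<bullet> b) * of_real (cutoff_profile (inverse (real (Suc j))) 1 (x \<bullet> x))"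
  unfolding ball_cutoff_def[abs_def]
  using partial_deriv_radial[OF cutoff_profile_has_derivative[of "inverse (real (Suc j))" 0]] by simp

lemma inner_self_less_1: "norm x < 1 \<Longrightarrow> x \<bullet> x < 1"
  by (metis norm_ge_zero norm_eq_sqrt_inner real_sqrt_lt_1_iff)

lemma test_function_ball_cutoff: "test_function (ball 0 1) (ball_cutoff j)"
  unfolding test_function_def
proof (intro conjI allI exI[of _ "cball 0 (sqrt (1 - inverse (real (Suc j))))"] impI)
  let ?\<delta> = "inverse (real (Suc j))"
  have d: "?\<delta> > 0" "?\<delta> \<le> 1" by (auto simp: field_simps)
  show "Ck k (ball_cutoff j)" for k
    using smooth_radial[where h = "cutoff_profile ?\<delta>" and i = 0, OF cutoff_profile_has_derivative[OF d(1)]]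
    unfolding smooth_def ball_cutoff_def[abs_def] by blast
  show "cball 0 (sqrt (1 - ?\<delta>)) \<subseteq> ball 0 1"
  proof -
    have "sqrt (1 - ?\<delta>) < 1" using d by simp
    then show ?thesis
      unfolding subset_eq Ball_def mem_ball mem_cball by (meson order.strict_trans1)
  qed
  show "ball_cutoff j x = 0" if "x \<notin> cball 0 (sqrt (1 - ?\<delta>))" for x :: 'a
  proof -
    have "sqrt (1 - ?\<delta>) < sqrt (x \<bullet> x)" using that by (simp add: norm_eq_sqrt_inner)
    then have "1 - ?\<delta> < x \<bullet> x" by simp
    then show ?thesis unfolding ball_cutoff_def cutoff_profile_0 by simp
  qed
qed simp

lemma ball_cutoff_bound: "cmod (ball_cutoff j x) \<le> 1"
  unfolding ball_cutoff_def cutoff_profile_0 by simp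

lemma ball_cutoff_tendsto: "norm x < 1 \<Longrightarrow> (\<lambda>j. ball_cutoff j x) \<longlonglongrightarrow> 1"
  unfolding ball_cutoff_def using cutoff_profile_0_tendsto[OF inner_self_less_1[of x]]
  by (metis of_real_1 tendsto_of_real)

lemma partial_deriv_ball_cutoff_tendsto:
  assumes "norm x < 1"
  shows "(\<lambda>j. partial_deriv b (ball_cutoff j) x) \<longlonglongrightarrow> 0"
proof -
  have "(\<lambda>j. 2 * of_real (x \<bullet> b) * complex_of_real (cutoff_profile (inverse (real (Suc j))) 1 (x \<bullet> x)))
      \<longlonglongrightarrow> 2 * of_real (x \<bullet> b) * of_real 0"
    using cutoff_profile_1_tendsto[OF inner_self_less_1[OF assms]] by (intro tendsto_intros)
  then show ?thesis unfolding partial_deriv_ball_cutoff by simp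
qed

text \<open>The chain rule on |x|^2 contributes 2 |x \<bullet> b| <= 2, the profile contributes 3,
  and 1 - |x| <= 1 - |x|^2 converts the distances.\<close>

lemma partial_deriv_ball_cutoff_bound:
  assumes "norm x < 1" "b \<in> Basis"
  shows "cmod (partial_deriv b (ball_cutoff j) x) * (1 - norm x) \<le> 6"
proof -
  let ?c = "\<bar>cutoff_profile (inverse (real (Suc j))) 1 (x \<bullet> x)\<bar>"
  have "\<bar>x \<bullet> b\<bar> \<le> 1" using Basis_le_norm[OF assms(2), of x] assms(1) by simp
  have n: "norm x * norm x \<le> norm x * 1" using assms(1) by (intro mult_left_mono) auto
  have "cmod (partial_deriv b (ball_cutoff j) x) * (1 - norm x) = \<bar>x \<bullet> b\<bar> * (2 * ?c * (1 - norm x))"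
    unfolding partial_deriv_ball_cutoff by (simp add: norm_mult)
  also have "\<dots> \<le> 1 * (2 * ?c * (1 - norm x))"
    using \<open>\<bar>x \<bullet> b\<bar> \<le> 1\<close> assms(1) by (intro mult_right_mono) auto
  also have "\<dots> \<le> 2 * ?c * (1 - x \<bullet> x)"
    using n by (simp add: dot_square_norm power2_eq_square mult_left_mono)
  also have "\<dots> \<le> 6"
    using cutoff_profile_1_bound[OF _ inner_self_less_1[OF assms(1)], of "inverse (real (Suc j))"]
    by (simp add: mult.commute)
  finally show ?thesis .
qed

section \<open>Boundary values on the unit sphere\<close>

lemma ball_measurable [simp]: "ball a r \<in> sets lebesgue"
  by (simp add: sets_completionI_sets)

lemma finite_measure_lebesgue_on_ball: "finite_measure (lebesgue_on (ball (a::'a::euclidean_space) r))"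
  using emeasure_bounded_finite[OF bounded_ball, of a r]
  by (intro finite_measureI) (simp add: emeasure_restrict_space less_top)

text \<open>Compare g at x with its value 0 at the radial projection of x to the sphere, using a
  Lipschitz constant on the closed ball. At x = 0 any unit vector serves as the projection.\<close>

lemma smooth_boundary_decay:
  fixes g :: "'a::euclidean_space \<Rightarrow> complex"
  assumes "smooth g" "\<And>x. norm x = 1 \<Longrightarrow> g x = 0"
  obtains L where "L \<ge> 0" "\<And>x. norm x < 1 \<Longrightarrow> cmod (g x) \<le> L * (1 - norm x)"
proof -
  obtain L where L: "L \<ge> 0" "\<And>x y. x \<in> cball 0 1 \<Longrightarrow> y \<in> cball 0 1 \<Longrightarrow> cmod (g x - g y) \<le> L * norm (x - y)"
    using smooth_lipschitz[OF assms(1) convex_cball compact_cball] by blast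
  have "cmod (g x) \<le> L * (1 - norm x)" if x: "norm x < 1" for x
  proof -
    obtain e :: 'a where e: "norm e = 1" using vector_choose_size[of 1] by auto
    define y where "y = (if x = 0 then e else x /\<^sub>R norm x)"
    have "norm y = 1" using e unfolding y_def by auto
    moreover have "norm (x - y) = 1 - norm x"
    proof (cases "x = 0")
      case False
      then have "x - y = (norm x - 1) *\<^sub>R y" unfolding y_def by (simp add: scaleR_left_diff_distrib left_diff_distrib)
      then show ?thesis using x \<open>norm y = 1\<close> by simp
    qed (use e in \<open>simp add: y_def\<close>)
    ultimately show ?thesis using L(2)[of x y] x assms(2)[of y] by simp
  qed
  then show ?thesis using L(1) that by blast
qed

lemma smooth_bounded_on_ball:
  fixes g :: "'a::euclidean_space \<Rightarrow> complex"
  assumes "smooth g"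
  obtains C where "C \<ge> 0" "\<And>x. norm x < 1 \<Longrightarrow> cmod (g x) \<le> C"
proof -
  have "bounded (g ` cball 0 1)"
    using assms by (intro compact_imp_bounded compact_continuous_image smooth_continuous_on) auto
  then show ?thesis
    using that unfolding bounded_pos by (metis image_eqI less_imp_le mem_cball_0)
qed

lemma partial_deriv_cutoff_mult:
  assumes "smooth g"
  shows "partial_deriv b (\<lambda>x. g x * ball_cutoff j x) x =
    g x * partial_deriv b (ball_cutoff j) x + partial_deriv b g x * ball_cutoff j x"
  by (intro partial_deriv_mult smooth_differentiable assms test_function_smooth[OF test_function_ball_cutoff])

lemma cutoff_mult_tendsto:
  "norm x < 1 \<Longrightarrow> (\<lambda>j. g x * ball_cutoff j x) \<longlonglongrightarrow> g x"
  using tendsto_mult[OF tendsto_const[of "g x"] ball_cutoff_tendsto[of x]] by simp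

lemma cutoff_mult_bound: "cmod z \<le> C \<Longrightarrow> cmod (z * ball_cutoff j x) \<le> C"
  using mult_left_mono[OF ball_cutoff_bound[of j x], of "cmod z"] by (simp add: norm_mult)

lemma partial_deriv_cutoff_mult_tendsto:
  assumes "smooth g" "norm x < 1"
  shows "(\<lambda>j. partial_deriv b (\<lambda>x. g x * ball_cutoff j x) x) \<longlonglongrightarrow> partial_deriv b g x"
proof -
  have "(\<lambda>j. g x * partial_deriv b (ball_cutoff j) x + partial_deriv b g x * ball_cutoff j x)
      \<longlonglongrightarrow> g x * 0 + partial_deriv b g x * 1"
    by (intro tendsto_intros partial_deriv_ball_cutoff_tendsto ball_cutoff_tendsto assms)
  then show ?thesis by (simp add: partial_deriv_cutoff_mult[OF assms(1)])
qed

text \<open>In the product rule the dangerous term is g times the gradient of the cutoff, of size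
  1/(1 - |x|); the linear decay of g at the sphere cancels it uniformly in j.\<close>

lemma partial_deriv_cutoff_mult_bound:
  fixes g :: "'a::euclidean_space \<Rightarrow> complex"
  assumes "smooth g" "\<And>x. norm x = 1 \<Longrightarrow> g x = 0" "b \<in> Basis"
  shows "\<exists>C. \<forall>j x. norm x < 1 \<longrightarrow> cmod (partial_deriv b (\<lambda>x. g x * ball_cutoff j x) x) \<le> C"
proof -
  obtain L where L: "L \<ge> 0" "\<And>x. norm x < 1 \<Longrightarrow> cmod (g x) \<le> L * (1 - norm x)"
    using smooth_boundary_decay[OF assms(1,2)] by blast
  obtain M where M: "M \<ge> 0" "\<And>x. norm x < 1 \<Longrightarrow> cmod (partial_deriv b g x) \<le> M"
    using smooth_bounded_on_ball[OF smooth_partial_deriv[OF assms(1,3)]] by blast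
  have "cmod (partial_deriv b (\<lambda>x. g x * ball_cutoff j x) x) \<le> L * 6 + M" if x: "norm x < 1" for j x
  proof -
    have "cmod (g x * partial_deriv b (ball_cutoff j) x) \<le> L * (1 - norm x) * cmod (partial_deriv b (ball_cutoff j) x)"
      using L(2)[OF x] by (simp add: norm_mult mult_right_mono)
    also have "\<dots> = L * (cmod (partial_deriv b (ball_cutoff j) x) * (1 - norm x))"
      by (simp add: ac_simps)
    also have "\<dots> \<le> L * 6"
      by (intro mult_left_mono partial_deriv_ball_cutoff_bound x assms(3) L(1))
    finally show ?thesis
      unfolding partial_deriv_cutoff_mult[OF assms(1)]
      using cutoff_mult_bound[OF M(2)[OF x], of j] norm_triangle_mono by blast
  qed
  then show ?thesis by blast
qed

lemma L2_norm_tendsto_0: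
  fixes f :: "nat \<Rightarrow> 'a::euclidean_space \<Rightarrow> complex"
  assumes "\<And>j. continuous_on UNIV (f j)" "\<And>j x. norm x < 1 \<Longrightarrow> cmod (f j x) \<le> C"
    and "\<And>x. norm x < 1 \<Longrightarrow> (\<lambda>j. f j x) \<longlonglongrightarrow> 0"
  shows "(\<lambda>j. L2_norm (ball 0 1) (f j)) \<longlonglongrightarrow> 0"
proof -
  interpret finite_measure "lebesgue_on (ball (0::'a) 1)" by (rule finite_measure_lebesgue_on_ball)
  have "(\<lambda>j. LINT x|lebesgue_on (ball 0 1). (cmod (f j x))\<^sup>2) \<longlonglongrightarrow> (LINT x|lebesgue_on (ball (0::'a) 1). 0)"
  proof (rule integral_dominated_convergence[where w = "\<lambda>_. C\<^sup>2"])
    show "(\<lambda>x. (cmod (f j x))\<^sup>2) \<in> borel_measurable (lebesgue_on (ball 0 1))" for j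
      by (intro continuous_measurable_lebesgue_on continuous_intros assms(1))
    show "AE x in lebesgue_on (ball 0 1). norm ((cmod (f j x))\<^sup>2) \<le> C\<^sup>2" for j
      using assms(2) by (intro AE_I2) (auto simp: power_mono)
    show "AE x in lebesgue_on (ball 0 1). (\<lambda>j. (cmod (f j x))\<^sup>2) \<longlonglongrightarrow> 0"
    proof (rule AE_I2)
      fix x :: 'a assume "x \<in> space (lebesgue_on (ball 0 1))"
      then have "(\<lambda>j. (cmod (f j x))\<^sup>2) \<longlonglongrightarrow> (cmod 0)\<^sup>2"
        by (intro tendsto_intros assms(3)) auto
      then show "(\<lambda>j. (cmod (f j x))\<^sup>2) \<longlonglongrightarrow> 0" by simp
    qed
  qed auto
  then have "(\<lambda>j. sqrt (LINT x|lebesgue_on (ball 0 1). (cmod (f j x))\<^sup>2)) \<longlonglongrightarrow> sqrt 0"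
    by (intro tendsto_intros) simp
  then show ?thesis unfolding L2_norm_def by simp
qed

lemma test_function_cutoff_mult:
  assumes "smooth g"
  shows "test_function (ball 0 1) (\<lambda>x. g x * ball_cutoff j x)"
  using assms test_function_ball_cutoff by (rule test_function_mult)

text \<open>The products g times \<open>ball_cutoff j\<close> are test functions. They and their
  partial derivatives converge pointwise in the ball with bounds independent of j, hence in L^2; the
  vanishing of g on the sphere is what bounds the derivatives.\<close>

lemma smooth_in_H1_0:
  fixes g :: "'a::euclidean_space \<Rightarrow> complex"
  assumes "smooth g" "\<And>x. norm x = 1 \<Longrightarrow> g x = 0"
  shows "in_H1_0 (ball 0 1) g"
  unfolding in_H1_0_def
proof (intro conjI exI allI ballI)
  let ?\<phi> = "\<lambda>j x. g x * ball_cutoff j x"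
  show "in_L2 (ball 0 1) g" by (rule smooth_in_L2[OF assms(1)]) auto
  show "has_weak_gradient (ball 0 1) g (\<lambda>b. partial_deriv b g)"
    by (rule smooth_has_weak_gradient[OF assms(1)]) auto
  show tf: "test_function (ball 0 1) (?\<phi> j)" for j
    by (rule test_function_cutoff_mult[OF assms(1)])
  have sm: "smooth (?\<phi> j)" for j using test_function_smooth[OF tf] .
  obtain C where C: "\<And>x. norm x < 1 \<Longrightarrow> cmod (g x) \<le> C"
    using smooth_bounded_on_ball[OF assms(1)] by blast
  show "(\<lambda>j. L2_norm (ball 0 1) (\<lambda>x. g x - ?\<phi> j x)) \<longlonglongrightarrow> 0"
  proof (rule L2_norm_tendsto_0[where C = "C + C"])
    show "continuous_on UNIV (\<lambda>x. g x - ?\<phi> j x)" for j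
      by (intro smooth_continuous_on smooth_diff assms(1) sm)
    show "cmod (g x - ?\<phi> j x) \<le> C + C" if "norm x < 1" for j x
      using C[OF that] by (intro order.trans[OF norm_triangle_ineq4] add_mono cutoff_mult_bound)
    show "(\<lambda>j. g x - ?\<phi> j x) \<longlonglongrightarrow> 0" if "norm x < 1" for x
      using tendsto_diff[OF tendsto_const[of "g x"] cutoff_mult_tendsto[OF that, of g]] by simp
  qed
  fix b :: 'a assume b: "b \<in> Basis"
  note sb = smooth_partial_deriv[OF assms(1) b]
  obtain D where D: "\<And>j x. norm x < 1 \<Longrightarrow> cmod (partial_deriv b (?\<phi> j) x) \<le> D"
    using partial_deriv_cutoff_mult_bound[OF assms b] by auto
  obtain D' where D': "\<And>x. norm x < 1 \<Longrightarrow> cmod (partial_deriv b g x) \<le> D'"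
    using smooth_bounded_on_ball[OF sb] by blast
  show "(\<lambda>j. L2_norm (ball 0 1) (\<lambda>x. partial_deriv b g x - partial_deriv b (?\<phi> j) x)) \<longlonglongrightarrow> 0"
  proof (rule L2_norm_tendsto_0[where C = "D' + D"])
    show "continuous_on UNIV (\<lambda>x. partial_deriv b g x - partial_deriv b (?\<phi> j) x)" for j
      by (intro smooth_continuous_on smooth_diff sb smooth_partial_deriv[OF sm b])
    show "cmod (partial_deriv b g x - partial_deriv b (?\<phi> j) x) \<le> D' + D" if "norm x < 1" for j x
      using D[OF that] D'[OF that] by (intro order.trans[OF norm_triangle_ineq4] add_mono)
    show "(\<lambda>j. partial_deriv b g x - partial_deriv b (?\<phi> j) x) \<longlonglongrightarrow> 0" if "norm x < 1" for x
      using tendsto_diff[OF tendsto_const[of "partial_deriv b g x"] partial_deriv_cutoff_mult_tendsto[OF assms(1) that, of b]] by simp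
  qed
qed

section \<open>Weak gradients paired with smooth functions, and normal derivatives\<close>

lemma in_L2_integrable_ball:
  assumes "in_L2 (ball (0::'a::euclidean_space) 1) f"
  shows "integrable (lebesgue_on (ball 0 1)) f"
proof -
  interpret finite_measure "lebesgue_on (ball (0::'a) 1)" by (rule finite_measure_lebesgue_on_ball)
  have "integrable (lebesgue_on (ball 0 1)) (\<lambda>x. (cmod (f x))\<^sup>2 + 1)"
    using assms unfolding in_L2_def by (intro Bochner_Integration.integrable_add) auto
  then show ?thesis
  proof (rule Bochner_Integration.integrable_bound)
    show "f \<in> borel_measurable (lebesgue_on (ball 0 1))" using assms unfolding in_L2_def by simp
    show "AE x in lebesgue_on (ball 0 1). cmod (f x) \<le> norm ((cmod (f x))\<^sup>2 + 1)"
    proof (rule AE_I2)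
      fix x
      have "0 \<le> (cmod (f x) - 1)\<^sup>2" by simp
      then show "cmod (f x) \<le> norm ((cmod (f x))\<^sup>2 + 1)"
        by (simp add: power2_diff) (smt (verit) norm_ge_zero zero_le_power2)
    qed
  qed
qed

lemma integral_mult_tendsto:
  fixes f :: "'a::euclidean_space \<Rightarrow> complex"
  assumes "in_L2 (ball 0 1) f" "\<And>j. smooth (s j)" "smooth g"
    and "\<And>j x. norm x < 1 \<Longrightarrow> cmod (s j x) \<le> C"
    and "\<And>x. norm x < 1 \<Longrightarrow> (\<lambda>j. s j x) \<longlonglongrightarrow> g x"
  shows "(\<lambda>j. LINT x|lebesgue_on (ball 0 1). f x * s j x) \<longlonglongrightarrow> (LINT x|lebesgue_on (ball 0 1). f x * g x)"
proof (rule integral_dominated_convergence[where w = "\<lambda>x. cmod (f x) * C"])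
  note f = in_L2_integrable_ball[OF assms(1)]
  have fm: "f \<in> borel_measurable (lebesgue_on (ball 0 1))" using f by simp
  show "(\<lambda>x. f x * g x) \<in> borel_measurable (lebesgue_on (ball 0 1))"
    by (intro borel_measurable_times fm continuous_measurable_lebesgue_on smooth_continuous_on assms(3))
  show "(\<lambda>x. f x * s j x) \<in> borel_measurable (lebesgue_on (ball 0 1))" for j
    by (intro borel_measurable_times fm continuous_measurable_lebesgue_on smooth_continuous_on assms(2))
  show "integrable (lebesgue_on (ball 0 1)) (\<lambda>x. cmod (f x) * C)"
    using f by (intro integrable_mult_left integrable_norm)
  show "AE x in lebesgue_on (ball 0 1). (\<lambda>j. f x * s j x) \<longlonglongrightarrow> f x * g x"
    using assms(5) by (intro AE_I2 tendsto_intros) auto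
  show "AE x in lebesgue_on (ball 0 1). cmod (f x * s j x) \<le> cmod (f x) * C" for j
    using assms(4) by (intro AE_I2) (auto simp: norm_mult intro!: mult_left_mono)
qed

lemma in_L2_integrable_mult_smooth:
  assumes "in_L2 (ball (0::'a::euclidean_space) 1) f" "smooth g"
  shows "integrable (lebesgue_on (ball 0 1)) (\<lambda>x. f x * g x)"
proof -
  note f = in_L2_integrable_ball[OF assms(1)]
  obtain C where C: "C \<ge> 0" "\<And>x. norm x < 1 \<Longrightarrow> cmod (g x) \<le> C"
    using smooth_bounded_on_ball[OF assms(2)] by blast
  show ?thesis
  proof (rule Bochner_Integration.integrable_bound)
    show "integrable (lebesgue_on (ball 0 1)) (\<lambda>x. f x * of_real C)"
      using f by (intro integrable_mult_left)
    show "(\<lambda>x. f x * g x) \<in> borel_measurable (lebesgue_on (ball 0 1))"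
      by (intro borel_measurable_times borel_measurable_integrable[OF f]
          continuous_measurable_lebesgue_on smooth_continuous_on assms(2))
    show "AE x in lebesgue_on (ball 0 1). cmod (f x * g x) \<le> norm (f x * of_real C)"
      using C by (intro AE_I2) (auto simp: norm_mult intro!: mult_left_mono)
  qed
qed

text \<open>Cut g off and pass to the limit in the definition of the weak gradient; the derivatives
  of the products converge boundedly because g vanishes on the sphere. This plays the role of
  Green's formula with zero boundary term for an arbitrary H^1 function \<phi>.\<close>

lemma weak_gradient_smooth_zero_boundary:
  fixes g :: "'a::euclidean_space \<Rightarrow> complex"
  assumes "in_L2 (ball 0 1) \<phi>" "has_weak_gradient (ball 0 1) \<phi> H" "b \<in> Basis"
    and "smooth g" "\<And>x. norm x = 1 \<Longrightarrow> g x = 0"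
  shows "(LINT x|lebesgue_on (ball 0 1). \<phi> x * partial_deriv b g x) = - (LINT x|lebesgue_on (ball 0 1). H b x * g x)"
proof (rule LIMSEQ_unique)
  let ?s = "\<lambda>j x. g x * ball_cutoff j x"
  have tf: "test_function (ball 0 1) (?s j)" for j by (rule test_function_cutoff_mult[OF assms(4)])
  obtain C where C: "\<And>x. norm x < 1 \<Longrightarrow> cmod (g x) \<le> C"
    using smooth_bounded_on_ball[OF assms(4)] by blast
  obtain D where D: "\<And>j x. norm x < 1 \<Longrightarrow> cmod (partial_deriv b (?s j) x) \<le> D"
    using partial_deriv_cutoff_mult_bound[OF assms(4,5,3)] by auto
  show "(\<lambda>j. LINT x|lebesgue_on (ball 0 1). \<phi> x * partial_deriv b (?s j) x) \<longlonglongrightarrow>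
      (LINT x|lebesgue_on (ball 0 1). \<phi> x * partial_deriv b g x)"
    by (rule integral_mult_tendsto[OF assms(1) smooth_partial_deriv[OF test_function_smooth[OF tf] assms(3)]
          smooth_partial_deriv[OF assms(4,3)] D partial_deriv_cutoff_mult_tendsto[OF assms(4)]])
  have "(\<lambda>j. - (LINT x|lebesgue_on (ball 0 1). H b x * ?s j x)) \<longlonglongrightarrow> - (LINT x|lebesgue_on (ball 0 1). H b x * g x)"
    using assms(2,3) unfolding has_weak_gradient_def
    by (intro tendsto_minus integral_mult_tendsto[where C = C] test_function_smooth[OF tf] assms(4)
        cutoff_mult_bound C cutoff_mult_tendsto) auto
  then show "(\<lambda>j. LINT x|lebesgue_on (ball 0 1). \<phi> x * partial_deriv b (?s j) x) \<longlonglongrightarrow>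
      - (LINT x|lebesgue_on (ball 0 1). H b x * g x)"
    using assms(2,3) tf unfolding has_weak_gradient_def by simp
qed

text \<open>Only the products with the cutoffs enter the limit, not their derivatives, so g may be
  nonzero on the sphere. It makes the normal derivative functional independent of the representative
  of the weak gradient.\<close>

lemma weak_gradient_integral_unique:
  fixes g :: "'a::euclidean_space \<Rightarrow> complex"
  assumes "has_weak_gradient (ball 0 1) \<phi> H" "has_weak_gradient (ball 0 1) \<phi> H'" "b \<in> Basis" "smooth g"
  shows "(LINT x|lebesgue_on (ball 0 1). H b x * g x) = (LINT x|lebesgue_on (ball 0 1). H' b x * g x)"
proof -
  let ?s = "\<lambda>j x. g x * ball_cutoff j x"
  have tf: "test_function (ball 0 1) (?s j)" for j by (rule test_function_cutoff_mult[OF assms(4)])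
  obtain C where C: "\<And>x. norm x < 1 \<Longrightarrow> cmod (g x) \<le> C"
    using smooth_bounded_on_ball[OF assms(4)] by blast
  have lim: "(\<lambda>j. LINT x|lebesgue_on (ball 0 1). f x * ?s j x) \<longlonglongrightarrow> (LINT x|lebesgue_on (ball 0 1). f x * g x)"
    if "in_L2 (ball 0 1) f" for f
    by (intro integral_mult_tendsto[where C = C] test_function_smooth[OF tf] assms(4)
        cutoff_mult_bound C cutoff_mult_tendsto that) auto
  have eq: "(LINT x|lebesgue_on (ball 0 1). H b x * ?s j x) = (LINT x|lebesgue_on (ball 0 1). H' b x * ?s j x)" for j
  proof -
    have "(LINT x|lebesgue_on (ball 0 1). \<phi> x * partial_deriv b (?s j) x) = - (LINT x|lebesgue_on (ball 0 1). K b x * ?s j x)"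
      if "has_weak_gradient (ball 0 1) \<phi> K" for K
      using that assms(3) tf[of j] unfolding has_weak_gradient_def by blast
    from this[OF assms(1)] this[OF assms(2)] show ?thesis by simp
  qed
  have "in_L2 (ball 0 1) (H b)" "in_L2 (ball 0 1) (H' b)"
    using assms(1-3) unfolding has_weak_gradient_def by auto
  from lim[OF this(1)] lim[OF this(2)] show ?thesis
    unfolding eq by (rule LIMSEQ_unique)
qed

lemma weak_Green_integral_split:
  fixes u :: "'a::euclidean_space \<Rightarrow> complex"
  assumes "in_L2 (ball 0 1) \<phi>" "has_weak_gradient (ball 0 1) \<phi> H" "smooth u"
  shows "(LINT x|lebesgue_on (ball 0 1). (\<Sum>b\<in>Basis. partial_deriv b u x * H b x) + laplacian u x * \<phi> x) =
    (\<Sum>b\<in>Basis. LINT x|lebesgue_on (ball 0 1). H b x * partial_deriv b u x) +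
    (\<Sum>b\<in>Basis. LINT x|lebesgue_on (ball 0 1). \<phi> x * partial_deriv b (partial_deriv b u) x)"
proof -
  have i: "integrable (lebesgue_on (ball 0 1)) (\<lambda>x. H b x * partial_deriv b u x)"
    "integrable (lebesgue_on (ball 0 1)) (\<lambda>x. \<phi> x * partial_deriv b (partial_deriv b u) x)" if "b \<in> Basis" for b
    using that assms unfolding has_weak_gradient_def
    by (auto intro!: in_L2_integrable_mult_smooth smooth_partial_deriv)
  have "(LINT x|lebesgue_on (ball 0 1). (\<Sum>b\<in>Basis. partial_deriv b u x * H b x) + laplacian u x * \<phi> x) =
     (LINT x|lebesgue_on (ball 0 1). (\<Sum>b\<in>Basis. H b x * partial_deriv b u x) +
        (\<Sum>b\<in>Basis. \<phi> x * partial_deriv b (partial_deriv b u) x))"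
    unfolding laplacian_def sum_distrib_left[symmetric] by (simp add: mult.commute)
  also have "\<dots> = (LINT x|lebesgue_on (ball 0 1). (\<Sum>b\<in>Basis. H b x * partial_deriv b u x)) +
      (LINT x|lebesgue_on (ball 0 1). (\<Sum>b\<in>Basis. \<phi> x * partial_deriv b (partial_deriv b u) x))"
    by (intro Bochner_Integration.integral_add Bochner_Integration.integrable_sum i)
  also have "\<dots> = (\<Sum>b\<in>Basis. LINT x|lebesgue_on (ball 0 1). H b x * partial_deriv b u x) +
    (\<Sum>b\<in>Basis. LINT x|lebesgue_on (ball 0 1). \<phi> x * partial_deriv b (partial_deriv b u) x)"
    by (intro arg_cong2[where f = "(+)"] Bochner_Integration.integral_sum i)
  finally show ?thesis .
qed

text \<open>The Green functionals of w and v differ by a sum over b of integrals of H_b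
  \<partial>_b(w - v) + \<phi> \<partial>_b \<partial>_b(w - v). Each summand integrates to 0 by
  \<open>weak_gradient_smooth_zero_boundary\<close> applied to \<partial>_b(w - v). Comparing the
  full gradients on the sphere is what lets each component be treated separately.\<close>

lemma smooth_equal_normal_derivative:
  fixes w v :: "'a::euclidean_space \<Rightarrow> complex"
  assumes "smooth w" "smooth v"
    and eq: "\<And>b x. b \<in> Basis \<Longrightarrow> norm x = 1 \<Longrightarrow> partial_deriv b w x = partial_deriv b v x"
  shows "equal_normal_derivative_on_boundary (ball 0 1) w v"
proof -
  let ?B = "lebesgue_on (ball (0::'a) 1)"
  let ?I = "\<lambda>u \<phi> H. LINT x|?B. (\<Sum>b\<in>Basis. partial_deriv b u x * H b x) + laplacian u x * \<phi> x"
  \<comment> \<open>The functional receives only \<phi>, so it must pick some weak gradient; fact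
    \<open>w\<close> shows that the choice does not affect the value.\<close>
  define l where "l = (\<lambda>\<phi>. ?I w \<phi> (SOME H. has_weak_gradient (ball 0 1) \<phi> H))"
  have w: "l \<phi> = ?I w \<phi> H" if "in_L2 (ball 0 1) \<phi>" "has_weak_gradient (ball 0 1) \<phi> H" for \<phi> H
  proof -
    define H' where "H' = (SOME H. has_weak_gradient (ball 0 1) \<phi> H)"
    have H': "has_weak_gradient (ball 0 1) \<phi> H'" unfolding H'_def using that(2) by (rule someI[of "has_weak_gradient (ball 0 1) \<phi>"])
    show ?thesis
      unfolding l_def H'_def[symmetric] weak_Green_integral_split[OF that(1) H' assms(1)]
        weak_Green_integral_split[OF that assms(1)]
      by (intro arg_cong2[where f = "(+)"] sum.cong refl weak_gradient_integral_unique[OF H' that(2)]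
          smooth_partial_deriv assms(1))
  qed
  have v: "?I w \<phi> H = ?I v \<phi> H" if \<phi>: "in_L2 (ball 0 1) \<phi>" "has_weak_gradient (ball 0 1) \<phi> H" for \<phi> H
  proof -
    have "(LINT x|?B. H b x * partial_deriv b w x) + (LINT x|?B. \<phi> x * partial_deriv b (partial_deriv b w) x) =
        (LINT x|?B. H b x * partial_deriv b v x) + (LINT x|?B. \<phi> x * partial_deriv b (partial_deriv b v) x)"
      if b: "b \<in> Basis" for b
    proof -
      let ?w = "partial_deriv b w" let ?v = "partial_deriv b v"
      have s: "smooth ?w" "smooth ?v" using smooth_partial_deriv[OF _ b] assms by auto
      have "partial_deriv b (\<lambda>x. ?w x - ?v x) = (\<lambda>x. partial_deriv b ?w x - partial_deriv b ?v x)"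
        using partial_deriv_diff smooth_differentiable[OF s(1)] smooth_differentiable[OF s(2)] by blast
      have L2: "in_L2 (ball 0 1) (H b)" using \<phi>(2) b unfolding has_weak_gradient_def by blast
      have "(LINT x|?B. \<phi> x * partial_deriv b (\<lambda>x. ?w x - ?v x) x) = - (LINT x|?B. H b x * (?w x - ?v x))"
        by (rule weak_gradient_smooth_zero_boundary[OF \<phi> b smooth_diff[OF s]]) (use eq b in auto)
      also have "(LINT x|?B. H b x * (?w x - ?v x)) = (LINT x|?B. H b x * ?w x) - (LINT x|?B. H b x * ?v x)"
        unfolding right_diff_distrib
        by (intro Bochner_Integration.integral_diff in_L2_integrable_mult_smooth L2 s)
      also have "(LINT x|?B. \<phi> x * partial_deriv b (\<lambda>x. ?w x - ?v x) x) =
          (LINT x|?B. \<phi> x * partial_deriv b ?w x) - (LINT x|?B. \<phi> x * partial_deriv b ?v x)"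
        unfolding \<open>partial_deriv b _ = _\<close> right_diff_distrib
        by (intro Bochner_Integration.integral_diff in_L2_integrable_mult_smooth \<phi>(1) smooth_partial_deriv s b)
      finally show ?thesis by (simp add: algebra_simps)
    qed
    then show ?thesis
      unfolding weak_Green_integral_split[OF \<phi> assms(1)] weak_Green_integral_split[OF \<phi> assms(2)]
        sum.distrib[symmetric] by (rule sum.cong[OF refl])
  qed
  have nd: "has_normal_derivative (ball 0 1) u l"
    if "smooth u" "\<And>\<phi> H. in_L2 (ball 0 1) \<phi> \<Longrightarrow> has_weak_gradient (ball 0 1) \<phi> H \<Longrightarrow> l \<phi> = ?I u \<phi> H" for u
    unfolding has_normal_derivative_def
    by (rule exI[of _ "\<lambda>b. partial_deriv b u"], rule exI[of _ "laplacian u"])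
       (use that in \<open>auto intro!: smooth_has_weak_gradient smooth_has_weak_laplacian\<close>)
  show ?thesis
    unfolding equal_normal_derivative_on_boundary_def
    using nd[OF assms(1) w] nd[OF assms(2)] w v by auto
qed

section \<open>Separated solutions of the Helmholtz equation\<close>

lemma laplacian_mult:
  fixes f g :: "'a::euclidean_space \<Rightarrow> complex"
  assumes "smooth f" "smooth g"
  shows "laplacian (\<lambda>x. f x * g x) x = f x * laplacian g x
    + 2 * (\<Sum>b\<in>Basis. partial_deriv b f x * partial_deriv b g x) + laplacian f x * g x"
proof -
  have *: "partial_deriv b (partial_deriv b (\<lambda>x. f x * g x)) x = f x * partial_deriv b (partial_deriv b g) x
      + 2 * (partial_deriv b f x * partial_deriv b g x) + partial_deriv b (partial_deriv b f) x * g x"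
    if b: "b \<in> Basis" for b
  proof -
    note d = smooth_differentiable[OF assms(1)] smooth_differentiable[OF assms(2)]
      smooth_differentiable[OF smooth_partial_deriv[OF assms(1) b]]
      smooth_differentiable[OF smooth_partial_deriv[OF assms(2) b]]
    have "partial_deriv b (\<lambda>x. f x * g x) = (\<lambda>x. f x * partial_deriv b g x + partial_deriv b f x * g x)"
      using partial_deriv_mult[OF d(1,2)] by blast
    moreover have "partial_deriv b (\<lambda>x. f x * partial_deriv b g x + partial_deriv b f x * g x) x =
        partial_deriv b (\<lambda>x. f x * partial_deriv b g x) x + partial_deriv b (\<lambda>x. partial_deriv b f x * g x) x"
      by (intro partial_deriv_add differentiable_mult d)
    ultimately show ?thesis
      by (simp add: partial_deriv_mult d algebra_simps)
  qed
  show ?thesis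
    unfolding laplacian_def by (simp add: * sum.distrib sum_distrib_left sum_distrib_right)
qed

lemma smooth_Phi_radial:
  assumes "a > 0"
  shows "smooth (\<lambda>x::'a::euclidean_space. of_real (Phi a (\<kappa>\<^sup>2 * (x \<bullet> x))))"
proof -
  \<comment> \<open>\<open>h i\<close> is the i-th derivative of t \<mapsto> Phi a (\<kappa>^2 t):
    each differentiation shifts the parameter and contributes -\<kappa>^2 / (4 (a + i)), and the
    denominators collect into the Pochhammer symbol.\<close>
  define h where "h = (\<lambda>i t. (- (\<kappa>\<^sup>2) / 4) ^ i / pochhammer a i * Phi (a + real i) (\<kappa>\<^sup>2 * t))"
  have "(h i has_real_derivative h (Suc i) t) (at t)" for i t
  proof -
    have "((\<lambda>t. Phi (a + real i) (\<kappa>\<^sup>2 * t)) has_real_derivative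
        - 1 / (4 * (a + real i)) * Phi (a + real i + 1) (\<kappa>\<^sup>2 * t) * \<kappa>\<^sup>2) (at t)"
      by (rule Phi_chain) (use assms in \<open>auto intro!: derivative_eq_intros\<close>)
    from DERIV_cmult[OF this, of "(- (\<kappa>\<^sup>2) / 4) ^ i / pochhammer a i"]
    show ?thesis
      unfolding h_def pochhammer_Suc power_Suc by (simp add: add_ac mult_ac)
  qed
  from smooth_radial[where h = h and i = 0, OF this] show ?thesis
    unfolding h_def by simp
qed

lemma partial_deriv_Phi_radial:
  assumes "a > 0"
  shows "partial_deriv b (\<lambda>x. of_real (Phi a (\<kappa>\<^sup>2 * (x \<bullet> x)))) x =
    of_real (- (\<kappa>\<^sup>2) / (2 * a)) * of_real (x \<bullet> b) * of_real (Phi (a + 1) (\<kappa>\<^sup>2 * (x \<bullet> x)))"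
proof -
  have "((\<lambda>t. Phi a (\<kappa>\<^sup>2 * t)) has_real_derivative - (\<kappa>\<^sup>2) / (4 * a) * Phi (a + 1) (\<kappa>\<^sup>2 * (x \<bullet> x))) (at (x \<bullet> x))"
    by (rule DERIV_cong[OF Phi_chain[OF assms DERIV_cmult_Id]]) simp
  from partial_deriv_radial[OF this, of b] show ?thesis by simp
qed

lemma laplacian_Phi_radial:
  assumes "a > 0"
  shows "laplacian (\<lambda>x::'a::euclidean_space. of_real (Phi a (\<kappa>\<^sup>2 * (x \<bullet> x)))) x =
    of_real (- (\<kappa>\<^sup>2) / (2 * a) * (real DIM('a) * Phi (a + 1) (\<kappa>\<^sup>2 * (x \<bullet> x))
      - \<kappa>\<^sup>2 / (2 * (a + 1)) * (x \<bullet> x) * Phi (a + 2) (\<kappa>\<^sup>2 * (x \<bullet> x))))"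
proof -
  let ?P = "\<lambda>j x::'a. complex_of_real (Phi (a + j) (\<kappa>\<^sup>2 * (x \<bullet> x)))"
  let ?r = "complex_of_real (- (\<kappa>\<^sup>2) / (2 * a))"
  have a1: "a + 1 > 0" using assms by simp
  have sm: "smooth (?P 1)" using smooth_Phi_radial[OF a1] .
  have dd: "partial_deriv b (partial_deriv b (\<lambda>x. of_real (Phi a (\<kappa>\<^sup>2 * (x \<bullet> x))))) x =
      ?r * (?P 1 x - of_real (\<kappa>\<^sup>2 / (2 * (a + 1))) * of_real ((x \<bullet> b) * (x \<bullet> b)) * ?P 2 x)"
    if b: "b \<in> Basis" for b
  proof -
    have "partial_deriv b (\<lambda>x. of_real (Phi a (\<kappa>\<^sup>2 * (x \<bullet> x)))) = (\<lambda>x. ?r * (of_real (x \<bullet> b) * ?P 1 x))"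
      using partial_deriv_Phi_radial[OF assms] by (auto simp: mult.assoc)
    moreover have "partial_deriv b (\<lambda>x. ?r * (of_real (x \<bullet> b) * ?P 1 x)) x =
        ?r * (of_real (x \<bullet> b) * partial_deriv b (?P 1) x + partial_deriv b (\<lambda>x. of_real (x \<bullet> b)) x * ?P 1 x)"
      by (subst partial_deriv_mult,
          (intro smooth_differentiable smooth_const smooth_mult smooth_inner sm)+,
          subst partial_deriv_mult,
          (intro smooth_differentiable smooth_inner sm)+,
          simp add: partial_deriv_const)
    ultimately show ?thesis
      unfolding partial_deriv_inner using b partial_deriv_Phi_radial[OF a1, of b \<kappa> x]
      by (simp add: add.assoc algebra_simps)
  qed
  have gen: "(\<Sum>b\<in>(Basis::'a set). r * (P - K * of_real (f b) * Q)) =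
      r * (of_nat DIM('a) * P - K * of_real (\<Sum>b\<in>Basis. f b) * Q)" for r P K Q :: complex and f
    by (simp add: sum_subtractf sum_distrib_left sum_distrib_right right_diff_distrib)
  have sq: "(\<Sum>b\<in>Basis. (x \<bullet> b) * (x \<bullet> b)) = x \<bullet> x"
    by (rule euclidean_inner[symmetric])
  have "laplacian (\<lambda>x::'a. of_real (Phi a (\<kappa>\<^sup>2 * (x \<bullet> x)))) x =
      (\<Sum>b\<in>Basis. ?r * (?P 1 x - of_real (\<kappa>\<^sup>2 / (2 * (a + 1))) * of_real ((x \<bullet> b) * (x \<bullet> b)) * ?P 2 x))"
    unfolding laplacian_def using dd by (rule sum.cong[OF refl])
  also have "\<dots> = ?r * (of_nat DIM('a) * ?P 1 x
      - of_real (\<kappa>\<^sup>2 / (2 * (a + 1))) * of_real (\<Sum>b\<in>Basis. (x \<bullet> b) * (x \<bullet> b)) * ?P 2 x)"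
    by (rule gen)
  finally show ?thesis unfolding sq by simp
qed

definition planar :: "'a::euclidean_space \<Rightarrow> 'a \<Rightarrow> 'a \<Rightarrow> complex" where
  "planar b c x = of_real (x \<bullet> b) + \<i> * of_real (x \<bullet> c)"

lemma smooth_planar: "smooth (planar b c)"
  unfolding planar_def[abs_def] by (intro smooth_add smooth_mult smooth_inner smooth_const)

lemma partial_deriv_planar_power:
  "partial_deriv e (\<lambda>x. planar b c x ^ m) x = of_nat m * planar b c x ^ (m - 1) * planar b c e"
proof (rule partial_deriv_at)
  have "(planar b c has_derivative planar b c) (at x)"
    unfolding planar_def[abs_def] by (auto intro!: derivative_eq_intros)
  then show "((\<lambda>x. planar b c x ^ m) has_derivative (\<lambda>e. of_nat m * planar b c x ^ (m - 1) * planar b c e)) (at x)"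
    by (auto intro!: derivative_eq_intros simp: ac_simps)
qed

text \<open>The two nonzero terms are 1 and i^2 = -1. As \<open>planar\<close> is linear,
  \<open>planar b c e\<close> is its derivative in direction e; its gradient is thus a null vector,
  which is why all its powers are harmonic.\<close>

lemma sum_Basis_planar_sq:
  fixes b c :: "'a::euclidean_space"
  assumes "b \<in> Basis" "c \<in> Basis" "b \<noteq> c"
  shows "(\<Sum>e\<in>Basis. planar b c e * planar b c e) = 0"
proof -
  have "planar b c e * planar b c e = (if e = b then 1 else 0) - (if e = c then 1 else 0)"
    if "e \<in> Basis" for e
    using assms that unfolding planar_def by (auto simp: inner_Basis)
  then show ?thesis using assms by (simp add: sum_subtractf)
qed

lemma laplacian_planar_power:
  fixes b c :: "'a::euclidean_space"
  assumes "b \<in> Basis" "c \<in> Basis" "b \<noteq> c"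
  shows "laplacian (\<lambda>x. planar b c x ^ m) x = 0"
proof -
  have "partial_deriv e (partial_deriv e (\<lambda>x. planar b c x ^ m)) x =
      of_nat m * of_nat (m - 1) * planar b c x ^ (m - 1 - 1) * (planar b c e * planar b c e)" for e
  proof -
    have "partial_deriv e (\<lambda>x. planar b c x ^ m) = (\<lambda>x. (of_nat m * planar b c e) * planar b c x ^ (m - 1))"
      by (rule ext) (simp add: partial_deriv_planar_power)
    moreover have "partial_deriv e (\<lambda>x. (of_nat m * planar b c e) * planar b c x ^ (m - 1)) x =
        (of_nat m * planar b c e) * (of_nat (m - 1) * planar b c x ^ (m - 1 - 1) * planar b c e)"
      unfolding partial_deriv_planar_power[symmetric]
      by (subst partial_deriv_mult, (intro smooth_differentiable smooth_const smooth_power smooth_planar)+,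
          simp add: partial_deriv_const)
    ultimately show ?thesis by (simp add: ac_simps)
  qed
  then have "laplacian (\<lambda>x. planar b c x ^ m) x =
      of_nat m * of_nat (m - 1) * planar b c x ^ (m - 1 - 1) * (\<Sum>e\<in>Basis. planar b c e * planar b c e)"
    unfolding laplacian_def by (simp add: sum_distrib_left)
  then show ?thesis using sum_Basis_planar_sq[OF assms] by simp
qed

text \<open>Euler's identity for a function homogeneous of degree 1; it evaluates the mixed term
  between a radial gradient and that of a power of \<open>planar\<close>.\<close>

lemma sum_inner_planar:
  fixes x :: "'a::euclidean_space"
  shows "(\<Sum>e\<in>Basis. of_real (x \<bullet> e) * planar b c e) = planar b c x"
proof -
  have "(\<Sum>e\<in>Basis. complex_of_real (x \<bullet> e) * planar b c e) =
      of_real (\<Sum>e\<in>Basis. (x \<bullet> e) * (b \<bullet> e)) + \<i> * of_real (\<Sum>e\<in>Basis. (x \<bullet> e) * (c \<bullet> e))"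
    unfolding planar_def by (simp add: sum.distrib sum_distrib_left algebra_simps inner_commute)
  then show ?thesis
    unfolding euclidean_inner[of x b, symmetric] euclidean_inner[of x c, symmetric] planar_def .
qed

text \<open>
  Up to a constant this is \<open>J\<^sub>\<nu>(\<kappa> r) r\<^bsup>1 - N/2\<^esup>\<close> times a spherical harmonic of degree \<open>m\<close>,
  where \<open>r = |x|\<close> and \<open>\<nu> = m + N/2 - 1\<close>.
\<close>

definition mode :: "'a::euclidean_space \<Rightarrow> 'a \<Rightarrow> nat \<Rightarrow> real \<Rightarrow> 'a \<Rightarrow> complex" where
  "mode b c m \<kappa> x = of_real (Phi (real m + real DIM('a) / 2) (\<kappa>\<^sup>2 * (x \<bullet> x))) * planar b c x ^ m"

lemma DIM_half_pos: "real m + real DIM('a::euclidean_space) / 2 > 0"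
  by (simp add: add_nonneg_pos)

lemma smooth_mode: "smooth (mode b c m \<kappa>)"
  unfolding mode_def[abs_def]
  by (intro smooth_mult smooth_Phi_radial DIM_half_pos smooth_power smooth_planar)

text \<open>The radial Laplacian contributes the dimension N and the mixed term contributes 2m, by
  Euler's identity. The parameter a = m + N/2 is chosen so that N + 2m = 2a; then the recurrence
  collapses the sum to a multiple of \<open>Phi a\<close>.\<close>

lemma laplacian_mode:
  fixes b c x :: "'a::euclidean_space"
  assumes "b \<in> Basis" "c \<in> Basis" "b \<noteq> c"
  shows "laplacian (mode b c m \<kappa>) x = - of_real (\<kappa>\<^sup>2) * mode b c m \<kappa> x"
proof -
  define a where "a = real m + real DIM('a) / 2"
  have a: "a > 0" unfolding a_def by (rule DIM_half_pos)
  define p where "p = planar b c x"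
  define P1 where "P1 = Phi (a + 1) (\<kappa>\<^sup>2 * (x \<bullet> x))"
  define P2 where "P2 = Phi (a + 2) (\<kappa>\<^sup>2 * (x \<bullet> x))"
  have cross: "(\<Sum>e\<in>Basis. partial_deriv e (\<lambda>x. of_real (Phi a (\<kappa>\<^sup>2 * (x \<bullet> x)))) x *
      partial_deriv e (\<lambda>x. planar b c x ^ m) x) = of_real (- (\<kappa>\<^sup>2) / (2 * a) * P1 * real m) * p ^ m"
  proof -
    have "(\<Sum>e\<in>Basis. partial_deriv e (\<lambda>x. of_real (Phi a (\<kappa>\<^sup>2 * (x \<bullet> x)))) x *
        partial_deriv e (\<lambda>x. planar b c x ^ m) x) =
        of_real (- (\<kappa>\<^sup>2) / (2 * a)) * of_real P1 * of_nat m * p ^ (m - 1) *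
          (\<Sum>e\<in>Basis. of_real (x \<bullet> e) * planar b c e)"
      unfolding partial_deriv_Phi_radial[OF a] partial_deriv_planar_power sum_distrib_left
        P1_def p_def
      by (intro sum.cong refl) (simp only: ac_simps)
    also have "\<dots> = of_real (- (\<kappa>\<^sup>2) / (2 * a)) * of_real P1 * (of_nat m * (p ^ (m - 1) * p))"
      unfolding sum_inner_planar p_def by (simp only: ac_simps)
    also have "of_nat m * (p ^ (m - 1) * p) = of_nat m * p ^ m"
      by (cases m) (auto simp: ac_simps)
    finally show ?thesis by simp
  qed
  define X where "X = - (\<kappa>\<^sup>2) / (2 * a) * P1 * real m"
  define Y where "Y = - (\<kappa>\<^sup>2) / (2 * a) * (real DIM('a) * P1 - \<kappa>\<^sup>2 / (2 * (a + 1)) * (x \<bullet> x) * P2)"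
  have XY: "Y + 2 * X = - (\<kappa>\<^sup>2) * Phi a (\<kappa>\<^sup>2 * (x \<bullet> x))"
  proof -
    have N: "real DIM('a) = 2 * (a - real m)" unfolding a_def by simp
    obtain B where B: "B = a + 1" by simp
    have nz: "a \<noteq> 0" "B \<noteq> 0" using a B by auto
    have rec: "Phi a (\<kappa>\<^sup>2 * (x \<bullet> x)) = P1 - \<kappa>\<^sup>2 * (x \<bullet> x) / (4 * a * B) * P2"
      unfolding P1_def P2_def B by (rule Phi_recurrence[OF a])
    show ?thesis
      unfolding X_def Y_def N B[symmetric] rec
      using nz by (simp add: field_simps)
  qed
  have "laplacian (\<lambda>x. of_real (Phi a (\<kappa>\<^sup>2 * (x \<bullet> x))) * planar b c x ^ m) x =
      2 * (of_real X * p ^ m) + of_real Y * p ^ m"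
    unfolding laplacian_mult[OF smooth_Phi_radial[OF a] smooth_power[OF smooth_planar]]
      laplacian_planar_power[OF assms] cross laplacian_Phi_radial[OF a]
      P1_def[symmetric] P2_def[symmetric] p_def[symmetric] X_def[symmetric] Y_def[symmetric]
    by simp
  also have "\<dots> = of_real (Y + 2 * X) * p ^ m"
    by (simp add: algebra_simps)
  finally show ?thesis unfolding XY mode_def[abs_def] a_def p_def by simp
qed

lemma laplacian_cmult: "smooth f \<Longrightarrow> laplacian (\<lambda>x. z * f x) x = z * laplacian f x"
  using laplacian_mult[OF smooth_const, of f z x]
  by (simp add: partial_deriv_const laplacian_def[of "\<lambda>x. z"])

lemma partial_deriv_cmult: "smooth f \<Longrightarrow> partial_deriv b (\<lambda>x. z * f x) x = z * partial_deriv b f x"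
  using partial_deriv_mult[OF smooth_differentiable[OF smooth_const] smooth_differentiable, of f b z x]
  by (simp add: partial_deriv_const)

text \<open>On the sphere \<kappa> enters only through the two numbers Phi a (\<kappa>^2) and
  \<kappa>^2 Phi (a + 1) (\<kappa>^2). Two scalar equations therefore match the values and the full
  gradients of two modes there.\<close>

lemma partial_deriv_mode:
  fixes b c :: "'a::euclidean_space" and m :: nat
  defines "a \<equiv> real m + real DIM('a) / 2"
  assumes "norm x = 1"
  shows "partial_deriv e (mode b c m \<kappa>) x =
    of_real (Phi a (\<kappa>\<^sup>2)) * partial_deriv e (\<lambda>x. planar b c x ^ m) x
    - of_real (\<kappa>\<^sup>2 * Phi (a + 1) (\<kappa>\<^sup>2)) * (of_real (x \<bullet> e / (2 * a)) * planar b c x ^ m)"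
proof -
  have a: "a > 0" unfolding a_def by (rule DIM_half_pos)
  have x: "x \<bullet> x = 1" using assms by (simp add: dot_square_norm)
  show ?thesis
    unfolding mode_def[abs_def] a_def[symmetric]
    by (subst partial_deriv_mult,
        (intro smooth_differentiable smooth_Phi_radial a smooth_power smooth_planar)+)
       (simp add: partial_deriv_Phi_radial[OF a] x)
qed

lemma mode_solves_transmission_problem:
  fixes b c :: "'a::euclidean_space" and m :: nat
  defines "a \<equiv> real m + real DIM('a) / 2"
  assumes bc: "b \<in> Basis" "c \<in> Basis" "b \<noteq> c"
    and eq: "\<alpha> * Phi a ((n * k)\<^sup>2) = \<beta> * Phi a (k\<^sup>2)"
      "\<alpha> * ((n * k)\<^sup>2 * Phi (a + 1) ((n * k)\<^sup>2)) = \<beta> * (k\<^sup>2 * Phi (a + 1) (k\<^sup>2))"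
  shows "solves_transmission_problem (ball 0 1) (\<lambda>_. n) k
    (\<lambda>x. of_real \<alpha> * mode b c m (n * k) x) (\<lambda>x. of_real \<beta> * mode b c m k x)"
proof -
  let ?w = "\<lambda>x. of_real \<alpha> * mode b c m (n * k) x"
  let ?v = "\<lambda>x. of_real \<beta> * mode b c m k x"
  have s: "smooth ?w" "smooth ?v" by (intro smooth_mult smooth_const smooth_mode)+
  have lap: "laplacian (\<lambda>x. of_real \<gamma> * mode b c m \<kappa> x) = (\<lambda>x. - of_real (\<kappa>\<^sup>2) * (of_real \<gamma> * mode b c m \<kappa> x))"
    for \<gamma> \<kappa> :: real
    by (rule ext) (simp add: laplacian_cmult[OF smooth_mode] laplacian_mode[OF bc])
  note eqc = eq[THEN arg_cong[where f = complex_of_real], unfolded of_real_mult[of \<alpha>] of_real_mult[of \<beta>]]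
  show ?thesis
    unfolding solves_transmission_problem_def
  proof (intro conjI)
    show "in_H1 (ball 0 1) ?w" "in_H1 (ball 0 1) ?v" by (rule smooth_in_H1; simp add: s)+
    show "has_weak_laplacian (ball 0 1) ?w (\<lambda>x. - of_real (k\<^sup>2 * n\<^sup>2) * ?w x)"
      using smooth_has_weak_laplacian[OF s(1), of "ball 0 1"] unfolding lap
      by (simp add: power_mult_distrib mult.commute)
    show "has_weak_laplacian (ball 0 1) ?v (\<lambda>x. - of_real (k\<^sup>2) * ?v x)"
      using smooth_has_weak_laplacian[OF s(2), of "ball 0 1"] unfolding lap by simp
    show "equal_on_boundary (ball 0 1) ?w ?v"
      unfolding equal_on_boundary_def
    proof (rule smooth_in_H1_0[OF smooth_diff[OF s]])
      fix x :: 'a assume "norm x = 1"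
      then have "x \<bullet> x = 1" by (simp add: dot_square_norm)
      then show "?w x - ?v x = 0"
        using eqc(1) unfolding mode_def a_def by (simp add: mult.assoc[symmetric])
    qed
    show "equal_normal_derivative_on_boundary (ball 0 1) ?w ?v"
    proof (rule smooth_equal_normal_derivative[OF s])
      fix e x :: 'a assume "norm x = 1"
      then show "partial_deriv e ?w x = partial_deriv e ?v x"
        unfolding partial_deriv_cmult[OF smooth_mode] partial_deriv_mode[OF \<open>norm x = 1\<close>] a_def[symmetric]
          right_diff_distrib mult.assoc[symmetric] eqc by simp
    qed
  qed
qed

section \<open>Localization\<close>

text \<open>Square the pointwise bound, integrate over the ball of radius \<tau>, insert the
  Jacobian \<sigma>^N >= 1 and substitute \<sigma> x. The result is an integral over the ball of
  radius \<sigma> \<tau>, which lies in the unit ball.\<close>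

lemma L2_norm_dilation:
  fixes f :: "'a::euclidean_space \<Rightarrow> complex"
  assumes "continuous_on UNIV f" "\<sigma> > 0" "\<sigma> * \<tau> \<le> 1" "K \<ge> 0" "\<sigma> \<ge> 1"
    and le: "\<And>x. norm x < \<tau> \<Longrightarrow> K * cmod (f x) \<le> cmod (f (\<sigma> *\<^sub>R x))"
  shows "K * L2_norm (ball 0 \<tau>) f \<le> L2_norm (ball 0 1) f"
proof -
  let ?g = "\<lambda>x. (cmod (f x))\<^sup>2"
  have cont: "continuous_on UNIV (\<lambda>x. (cmod (f (s *\<^sub>R x)))\<^sup>2)" for s
    by (intro continuous_intros continuous_on_compose2[OF assms(1)]) auto
  have cont1: "continuous_on UNIV ?g" using cont[of 1] by simp
  have int: "integrable (lebesgue_on (ball 0 r)) (\<lambda>x. (cmod (f (s *\<^sub>R x)))\<^sup>2)" for r s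
    by (rule continuous_integrable_lebesgue_on[OF cont]) auto
  have intl: "integrable lborel (\<lambda>x. indicator (ball 0 r) x * ?g x)" for r
  proof -
    have "integrable lebesgue (\<lambda>x. indicator (ball 0 r) x *\<^sub>R ?g x)"
      using int[of r 1] by (subst (asm) integrable_restrict_space) auto
    then show ?thesis
      using borel_measurable_continuous_onI[OF cont1]
      by (subst (asm) integrable_completion) (auto intro!: borel_measurable_times borel_measurable_indicator)
  qed
  have lb: "(LINT x|lebesgue_on (ball 0 r). h x) = (LINT x|lborel. indicator (ball 0 r) x * h x)"
    if "continuous_on UNIV h" for r and h :: "'a \<Rightarrow> real"
  proof -
    have "(LINT x|lebesgue_on (ball 0 r). h x) = (LINT x|lebesgue. indicator (ball 0 r) x *\<^sub>R h x)"
      by (intro integral_restrict_space) auto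
    also have "\<dots> = (LINT x|lborel. indicator (ball 0 r) x *\<^sub>R h x)"
    proof (rule integral_completion)
      show "(\<lambda>x. indicator (ball 0 r) x *\<^sub>R h x) \<in> borel_measurable lborel"
        using borel_measurable_continuous_onI[OF that]
        by (intro borel_measurable_scaleR borel_measurable_indicator) auto
    qed
    finally show ?thesis by simp
  qed
  have "K\<^sup>2 * (LINT x|lebesgue_on (ball 0 \<tau>). ?g x) = (LINT x|lebesgue_on (ball 0 \<tau>). K\<^sup>2 * ?g x)"
    by simp
  also have "\<dots> \<le> (LINT x|lebesgue_on (ball 0 \<tau>). (cmod (f (\<sigma> *\<^sub>R x)))\<^sup>2)"
  proof (rule integral_mono)
    show "integrable (lebesgue_on (ball 0 \<tau>)) (\<lambda>x. K\<^sup>2 * ?g x)"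
      using int[of \<tau> 1] by simp
    show "K\<^sup>2 * ?g x \<le> (cmod (f (\<sigma> *\<^sub>R x)))\<^sup>2" if "x \<in> space (lebesgue_on (ball 0 \<tau>))" for x
      using power_mono[OF le[of x], of 2] that assms(4) by (simp add: power_mult_distrib)
  qed (rule int)
  also have "\<dots> \<le> \<sigma> ^ DIM('a) * (LINT x|lebesgue_on (ball 0 \<tau>). (cmod (f (\<sigma> *\<^sub>R x)))\<^sup>2)"
  proof -
    have "0 \<le> (LINT x|lebesgue_on (ball 0 \<tau>). (cmod (f (\<sigma> *\<^sub>R x)))\<^sup>2)"
      by (rule Bochner_Integration.integral_nonneg) simp
    then show ?thesis using mult_right_mono[OF one_le_power[OF assms(5)]] by fastforce
  qed
  also have "\<dots> = (LINT x|lborel. indicator (ball 0 (\<sigma> * \<tau>)) x * ?g x)"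
  proof -
    let ?F = "\<lambda>x. indicator (ball 0 (\<sigma> * \<tau>)) x * ?g x"
    let ?T = "\<lambda>x::'a. 0 + \<sigma> *\<^sub>R x"
    have F: "?F \<in> borel_measurable borel"
      using borel_measurable_continuous_onI[OF cont1]
      by (intro borel_measurable_times borel_measurable_indicator) auto
    have "integral\<^sup>L lborel ?F = integral\<^sup>L (density (distr lborel borel ?T) (\<lambda>_. \<bar>\<sigma>\<bar> ^ DIM('a))) ?F"
      using lborel_affine[of \<sigma> "0::'a"] assms(2) by simp
    also have "\<dots> = (LINT x|distr lborel borel ?T. \<bar>\<sigma>\<bar> ^ DIM('a) *\<^sub>R ?F x)"
      by (rule integral_density) (use F in auto)
    also have "\<dots> = (LINT x|lborel. \<bar>\<sigma>\<bar> ^ DIM('a) *\<^sub>R ?F (?T x))"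
      by (rule integral_distr) (use F in auto)
    also have "\<dots> = \<sigma> ^ DIM('a) * (LINT x|lborel. ?F (\<sigma> *\<^sub>R x))"
      using assms(2) by simp
    also have "(\<lambda>x. ?F (\<sigma> *\<^sub>R x)) = (\<lambda>x. indicator (ball 0 \<tau>) x * (cmod (f (\<sigma> *\<^sub>R x)))\<^sup>2)"
      using assms(2) by (auto simp: indicator_def)
    finally show ?thesis unfolding lb[OF cont] by simp
  qed
  also have "\<dots> \<le> (LINT x|lborel. indicator (ball 0 1) x * ?g x)"
  proof (rule integral_mono[OF intl intl])
    show "indicator (ball 0 (\<sigma> * \<tau>)) x * ?g x \<le> indicator (ball 0 1) x * ?g x" for x
      using assms(3) by (auto simp: indicator_def)
  qed
  also have "\<dots> = (LINT x|lebesgue_on (ball 0 1). ?g x)"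
    using lb[OF cont1] by simp
  finally have "sqrt (K\<^sup>2 * (LINT x|lebesgue_on (ball 0 \<tau>). ?g x)) \<le> sqrt (LINT x|lebesgue_on (ball 0 1). ?g x)"
    by simp
  then show ?thesis
    unfolding L2_norm_def using assms(4) by (simp add: real_sqrt_mult)
qed

text \<open>The power of \<open>planar\<close> gains \<sigma>^m, and \<open>Phi_dilation\<close>
  gives up at most \<sigma>^((1 - c) \<nu>). The last hypothesis keeps the dilated argument \<sigma>
  \<kappa> |x| in the range where the logarithmic derivative bound with constant c is valid.\<close>

lemma mode_dilation:
  fixes x :: "'a::euclidean_space" and m :: nat
  defines "\<nu> \<equiv> real m + real DIM('a) / 2 - 1"
  assumes "\<nu> > 0" "0 \<le> c" "c < 1" "\<sigma> \<ge> 1" "norm x \<le> \<tau>" "(\<sigma> * \<kappa> * \<tau>)\<^sup>2 \<le> \<nu>\<^sup>2 * (1 - c\<^sup>2)"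
  shows "\<sigma> powr (real m - (1 - c) * \<nu>) * cmod (mode b d m \<kappa> x) \<le> cmod (mode b d m \<kappa> (\<sigma> *\<^sub>R x))"
proof -
  define a where "a = real m + real DIM('a) / 2"
  have a: "a > 1" "a - 1 = \<nu>" using assms unfolding a_def \<nu>_def by auto
  define s where "s = \<kappa>\<^sup>2 * (x \<bullet> x)"
  have s0: "0 \<le> s" unfolding s_def by simp
  have "s \<le> \<kappa>\<^sup>2 * \<tau>\<^sup>2"
    unfolding s_def dot_square_norm using assms(6) by (intro mult_left_mono power_mono) auto
  then have "\<sigma>\<^sup>2 * s \<le> \<sigma>\<^sup>2 * (\<kappa>\<^sup>2 * \<tau>\<^sup>2)" by (intro mult_left_mono) auto
  then have ss: "\<sigma>\<^sup>2 * s \<le> (a - 1)\<^sup>2 * (1 - c\<^sup>2)"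
    using assms(7) unfolding a by (simp add: power_mult_distrib mult.assoc)
  also have "\<dots> \<le> (a - 1)\<^sup>2" using mult_left_mono[of "1 - c\<^sup>2" 1 "(a - 1)\<^sup>2"] by simp
  finally have sa: "\<sigma>\<^sup>2 * s \<le> (a - 1)\<^sup>2" .
  moreover have "s \<le> \<sigma>\<^sup>2 * s" using mult_right_mono[of 1 "\<sigma>\<^sup>2" s] assms s0 by (simp add: one_le_power)
  ultimately have pos: "Phi a s > 0" "Phi a (\<sigma>\<^sup>2 * s) > 0"
    using s0 a by (auto intro!: Phi_pos)
  have P: "Phi a s \<le> \<sigma> powr ((1 - c) * \<nu>) * Phi a (\<sigma>\<^sup>2 * s)"
    using Phi_dilation[OF a(1) assms(3,4,5) s0 ss] unfolding a(2) .
  have sig: "\<sigma> > 0" using assms by simp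
  have "planar b d (\<sigma> *\<^sub>R x) = of_real \<sigma> * planar b d x"
    unfolding planar_def by (simp add: algebra_simps)
  then have pl: "cmod (planar b d (\<sigma> *\<^sub>R x) ^ m) = \<sigma> ^ m * cmod (planar b d x ^ m)"
    using sig by (simp add: norm_mult norm_power power_mult_distrib)
  have e: "\<sigma> powr (real m - (1 - c) * \<nu>) * \<sigma> powr ((1 - c) * \<nu>) = \<sigma> ^ m"
    using sig by (simp add: powr_add[symmetric] powr_realpow)
  have "\<sigma> powr (real m - (1 - c) * \<nu>) * Phi a s \<le> \<sigma> powr (real m - (1 - c) * \<nu>) * (\<sigma> powr ((1 - c) * \<nu>) * Phi a (\<sigma>\<^sup>2 * s))"
    by (rule mult_left_mono[OF P]) simp
  also have "\<dots> = \<sigma> ^ m * Phi a (\<sigma>\<^sup>2 * s)"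
    unfolding mult.assoc[symmetric] e ..
  finally have le: "\<sigma> powr (real m - (1 - c) * \<nu>) * Phi a s \<le> \<sigma> ^ m * Phi a (\<sigma>\<^sup>2 * s)" .
  have m1: "cmod (mode b d m \<kappa> x) = Phi a s * cmod (planar b d x ^ m)"
    unfolding mode_def a_def[symmetric] s_def[symmetric] norm_mult using pos by simp
  have "\<kappa>\<^sup>2 * ((\<sigma> *\<^sub>R x) \<bullet> (\<sigma> *\<^sub>R x)) = \<sigma>\<^sup>2 * s"
    unfolding s_def by (simp add: power2_eq_square)
  then have m2: "cmod (mode b d m \<kappa> (\<sigma> *\<^sub>R x)) = Phi a (\<sigma>\<^sup>2 * s) * (\<sigma> ^ m * cmod (planar b d x ^ m))"
    unfolding mode_def a_def[symmetric] norm_mult[of _ "_ ^ m"] pl using pos by simp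
  show ?thesis
    unfolding m1 m2 using mult_right_mono[OF le, of "cmod (planar b d x ^ m)"] by (simp add: mult_ac)
qed

lemma AE_zero_ball_imp_zero:
  fixes f :: "'a::euclidean_space \<Rightarrow> complex"
  assumes "continuous_on UNIV f" "AE x in lebesgue_on (ball 0 1). f x = 0" "norm x < 1"
  shows "f x = 0"
proof (rule ccontr)
  assume "f x \<noteq> 0"
  define S where "S = ball 0 1 \<inter> {x. f x \<noteq> 0}"
  have "open {x. f x \<noteq> 0}"
    using assms(1) by (intro open_Collect_neq) auto
  then have "open S" unfolding S_def by (intro open_Int) auto
  moreover have "x \<in> S" using assms(3) \<open>f x \<noteq> 0\<close> unfolding S_def by simp
  ultimately have "\<not> negligible S" using open_not_negligible by blast
  moreover have "AE x in lebesgue. x \<in> ball 0 1 \<longrightarrow> f x = 0"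
    using assms(2) by (subst (asm) AE_restrict_space_iff) auto
  then have "AE x in lebesgue. x \<notin> S"
    by eventually_elim (auto simp: S_def)
  then have "S \<in> null_sets lebesgue"
    using \<open>open S\<close> by (subst AE_iff_null_sets) (auto simp: sets_completionI_sets)
  ultimately show False by (simp add: negligible_iff_null_sets)
qed

lemma L2_norm_0_imp_AE:
  fixes f :: "'a::euclidean_space \<Rightarrow> complex"
  assumes "continuous_on UNIV f" "L2_norm (ball 0 1) f = 0"
  shows "AE x in lebesgue_on (ball 0 1). f x = 0"
proof -
  have "continuous_on UNIV (\<lambda>x. (cmod (f x))\<^sup>2)"
    by (intro continuous_intros assms(1))
  then have "integrable (lebesgue_on (ball 0 1)) (\<lambda>x. (cmod (f x))\<^sup>2)"
    by (rule continuous_integrable_lebesgue_on) auto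
  then have "AE x in lebesgue_on (ball 0 1). (cmod (f x))\<^sup>2 = 0"
    using assms(2) unfolding L2_norm_def
    by (subst integral_nonneg_eq_0_iff_AE[symmetric]) auto
  then show ?thesis by simp
qed

lemma mode_nonzero:
  fixes b c :: "'a::euclidean_space"
  assumes "b \<in> Basis" "c \<in> Basis" "b \<noteq> c" "real m + real DIM('a) / 2 > 1"
  obtains x where "norm x < 1" "mode b c m \<kappa> x \<noteq> 0"
proof -
  define a where "a = real m + real DIM('a) / 2"
  \<comment> \<open>The point e b on one axis: e <= 1/2 keeps it in the ball, |\<kappa>| e <= a - 1
    keeps the argument below the turning point, and the + 1 covers \<kappa> = 0.\<close>
  define e where "e = min (1 / 2) ((a - 1) / (\<bar>\<kappa>\<bar> + 1))"
  have e: "e > 0" "e < 1" unfolding e_def a_def using assms by auto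
  have "\<bar>\<kappa>\<bar> * e \<le> (\<bar>\<kappa>\<bar> + 1) * ((a - 1) / (\<bar>\<kappa>\<bar> + 1))"
    using e by (intro mult_mono) (auto simp: e_def a_def)
  then have "\<bar>\<kappa>\<bar> * e \<le> a - 1" by simp
  then have "(\<bar>\<kappa>\<bar> * e)\<^sup>2 \<le> (a - 1)\<^sup>2" using e by (intro power_mono) auto
  then have "Phi a (\<kappa>\<^sup>2 * e\<^sup>2) > 0"
    using assms(4) by (intro Phi_pos) (auto simp: a_def power_mult_distrib)
  moreover have "(e *\<^sub>R b) \<bullet> (e *\<^sub>R b) = e\<^sup>2"
    using assms(1) by (simp add: power2_eq_square)
  moreover have "planar b c (e *\<^sub>R b) = of_real e"
    using assms(1-3) by (simp add: planar_def inner_not_same_Basis)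
  ultimately have "mode b c m \<kappa> (e *\<^sub>R b) \<noteq> 0"
    using e unfolding mode_def a_def by simp
  moreover have "norm (e *\<^sub>R b) < 1" using e assms(1) by simp
  ultimately show ?thesis using that by blast
qed

section \<open>Choice of wave numbers and amplitudes, and the limit\<close>

text \<open>The larger of the two wave numbers is max n 1 times k, and it is placed between \<nu>
  and \<mu> \<nu>. The upper end controls both modes, and the lower end later drives k to
  infinity.\<close>

lemma eventually_transmission_data:
  assumes "n > 0" "n \<noteq> 1" "1 < \<mu>"
  shows "\<forall>\<^sub>F \<nu> in at_top. \<exists>k \<alpha> \<beta>. \<nu> / max n 1 \<le> k \<and> k \<le> \<mu> * \<nu> \<and> n * k \<le> \<mu> * \<nu> \<and> \<alpha> \<noteq> 0 \<and> \<beta> \<noteq> 0 \<and>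
    \<alpha> * Phi (\<nu> + 1) ((n * k)\<^sup>2) = \<beta> * Phi (\<nu> + 1) (k\<^sup>2) \<and>
    \<alpha> * ((n * k)\<^sup>2 * Phi (\<nu> + 2) ((n * k)\<^sup>2)) = \<beta> * (k\<^sup>2 * Phi (\<nu> + 2) (k\<^sup>2))"
proof (cases "n > 1")
  case True
  \<comment> \<open>The minimum meets both demands: at most \<mu> for the localization, at most n
    for the Rolle argument.\<close>
  have "\<forall>\<^sub>F \<nu> in at_top. \<exists>k. \<nu> \<le> n * k \<and> n * k \<le> min \<mu> n * \<nu> \<and>
    Phi (\<nu> + 1) (k\<^sup>2) \<noteq> 0 \<and> Phi (\<nu> + 1) ((n * k)\<^sup>2) \<noteq> 0 \<and>
    n\<^sup>2 * Phi (\<nu> + 2) ((n * k)\<^sup>2) * Phi (\<nu> + 1) (k\<^sup>2) = Phi (\<nu> + 2) (k\<^sup>2) * Phi (\<nu> + 1) ((n * k)\<^sup>2)"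
    by (rule eventually_eigenvalue) (use True assms in auto)
  then show ?thesis
    using eventually_gt_at_top[of 0]
  proof eventually_elim
    case (elim \<nu>)
    then obtain k where k: "\<nu> \<le> n * k" "n * k \<le> min \<mu> n * \<nu>"
      "Phi (\<nu> + 1) (k\<^sup>2) \<noteq> 0" "Phi (\<nu> + 1) ((n * k)\<^sup>2) \<noteq> 0"
      "n\<^sup>2 * Phi (\<nu> + 2) ((n * k)\<^sup>2) * Phi (\<nu> + 1) (k\<^sup>2) = Phi (\<nu> + 2) (k\<^sup>2) * Phi (\<nu> + 1) ((n * k)\<^sup>2)"
      by blast
    have "min \<mu> n * \<nu> \<le> \<mu> * \<nu>" using elim by (intro mult_right_mono) auto
    then have nk: "n * k \<le> \<mu> * \<nu>" using k by simp
    have k0: "k > 0" using k(1) elim assms by (smt (verit) zero_less_mult_pos)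
    then have "k \<le> n * k" using True by simp
    show ?case
    \<comment> \<open>The amplitudes are \<alpha> = Phi (\<nu> + 1) (k^2) and \<beta> = Phi (\<nu> +
      1) ((n k)^2). They make the first equation trivial, and the second is the critical point
      equation times k^2.\<close>
    proof (intro exI conjI)
      show "Phi (\<nu> + 1) (k\<^sup>2) * ((n * k)\<^sup>2 * Phi (\<nu> + 2) ((n * k)\<^sup>2)) =
          Phi (\<nu> + 1) ((n * k)\<^sup>2) * (k\<^sup>2 * Phi (\<nu> + 2) (k\<^sup>2))"
        using arg_cong[OF k(5), of "\<lambda>y. k\<^sup>2 * y"] by (simp add: power_mult_distrib mult_ac)
      show "\<nu> / max n 1 \<le> k" using k(1) True by (simp add: field_simps)
    qed (use nk \<open>k \<le> n * k\<close> k in \<open>auto simp: mult.commute\<close>)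
  qed
next
  case False
  then have n: "1 / n > 1" using assms by simp
  have "\<forall>\<^sub>F \<nu> in at_top. \<exists>k. \<nu> \<le> 1 / n * k \<and> 1 / n * k \<le> min \<mu> (1 / n) * \<nu> \<and>
    Phi (\<nu> + 1) (k\<^sup>2) \<noteq> 0 \<and> Phi (\<nu> + 1) ((1 / n * k)\<^sup>2) \<noteq> 0 \<and>
    (1 / n)\<^sup>2 * Phi (\<nu> + 2) ((1 / n * k)\<^sup>2) * Phi (\<nu> + 1) (k\<^sup>2) = Phi (\<nu> + 2) (k\<^sup>2) * Phi (\<nu> + 1) ((1 / n * k)\<^sup>2)"
    by (rule eventually_eigenvalue) (use n assms in auto)
  then show ?thesis
    using eventually_gt_at_top[of 0]
  proof eventually_elim
    case (elim \<nu>)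
    then obtain k' where k': "\<nu> \<le> 1 / n * k'" "1 / n * k' \<le> min \<mu> (1 / n) * \<nu>"
      "Phi (\<nu> + 1) (k'\<^sup>2) \<noteq> 0" "Phi (\<nu> + 1) ((1 / n * k')\<^sup>2) \<noteq> 0"
      "(1 / n)\<^sup>2 * Phi (\<nu> + 2) ((1 / n * k')\<^sup>2) * Phi (\<nu> + 1) (k'\<^sup>2) = Phi (\<nu> + 2) (k'\<^sup>2) * Phi (\<nu> + 1) ((1 / n * k')\<^sup>2)"
      by blast
    \<comment> \<open>The critical point k' for the ratio 1/n is the smaller wave number n k, and k
      itself is the larger one; the amplitudes keep the form they have for n > 1.\<close>
    define k where "k = 1 / n * k'"
    have kn: "k' = n * k" unfolding k_def using assms by simp
    have "min \<mu> (1 / n) * \<nu> \<le> \<mu> * \<nu>" using elim by (intro mult_right_mono) auto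
    then have kl: "k \<le> \<mu> * \<nu>" using k' unfolding k_def by simp
    have k0: "k \<ge> 0" using k'(1) elim unfolding k_def by simp
    then have nk: "n * k \<le> k" using False mult_right_mono[of n 1 k] by simp
    have eq: "(1 / n)\<^sup>2 * Phi (\<nu> + 2) (k\<^sup>2) * Phi (\<nu> + 1) ((n * k)\<^sup>2) = Phi (\<nu> + 2) ((n * k)\<^sup>2) * Phi (\<nu> + 1) (k\<^sup>2)"
      using k'(5)[unfolded k_def[symmetric], unfolded kn] .
    have nz: "Phi (\<nu> + 1) (k\<^sup>2) \<noteq> 0" "Phi (\<nu> + 1) ((n * k)\<^sup>2) \<noteq> 0"
      using k'(3,4) unfolding k_def[symmetric] unfolding kn by auto
    show ?case
    proof (intro exI conjI)
      show "Phi (\<nu> + 1) (k\<^sup>2) * ((n * k)\<^sup>2 * Phi (\<nu> + 2) ((n * k)\<^sup>2)) =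
          Phi (\<nu> + 1) ((n * k)\<^sup>2) * (k\<^sup>2 * Phi (\<nu> + 2) (k\<^sup>2))"
        using arg_cong[OF eq, of "\<lambda>y. n\<^sup>2 * k\<^sup>2 * y"] assms(1)
        by (auto simp: power_mult_distrib mult_ac power_one_over)
      show "\<nu> / max n 1 \<le> k" using k'(1) False unfolding k_def[symmetric] by simp
    qed (use nk kl nz in auto)
  qed
qed

lemma L2_norm_cmult: "L2_norm \<Omega> (\<lambda>x. z * f x) = cmod z * L2_norm \<Omega> f"
  unfolding L2_norm_def by (simp add: norm_mult power_mult_distrib real_sqrt_mult)

lemma L2_norm_nonneg: "L2_norm \<Omega> f \<ge> 0"
  unfolding L2_norm_def by simp

lemma mode_L2_norm_pos:
  fixes b c :: "'a::euclidean_space"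
  assumes "b \<in> Basis" "c \<in> Basis" "b \<noteq> c" "real m + real DIM('a) / 2 > 1"
  shows "L2_norm (ball 0 1) (mode b c m \<kappa>) > 0"
proof -
  have cont: "continuous_on UNIV (mode b c m \<kappa>)" by (rule smooth_continuous_on[OF smooth_mode])
  have "L2_norm (ball 0 1) (mode b c m \<kappa>) \<noteq> 0"
  proof
    assume "L2_norm (ball 0 1) (mode b c m \<kappa>) = 0"
    then have "AE x in lebesgue_on (ball 0 1). mode b c m \<kappa> x = 0"
      by (rule L2_norm_0_imp_AE[OF cont])
    then have "mode b c m \<kappa> x = 0" if "norm x < 1" for x
      using AE_zero_ball_imp_zero[OF cont] that by blast
    then show False using mode_nonzero[OF assms, of \<kappa>] by blast
  qed
  then show ?thesis using L2_norm_nonneg[of "ball 0 1" "mode b c m \<kappa>"] by simp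
qed

text \<open>Bounding \<kappa> by \<mu> \<nu> turns the condition on the dilated argument into one
  free of m, so that a single c serves all modes. The amplitude z cancels.\<close>

lemma mode_ratio_bound:
  fixes b d :: "'a::euclidean_space" and m :: nat
  defines "\<nu> \<equiv> real m + real DIM('a) / 2 - 1"
  assumes bd: "b \<in> Basis" "d \<in> Basis" "b \<noteq> d" and z: "z \<noteq> 0" and nu: "\<nu> > 0"
    and c: "0 \<le> c" "c < 1" and s: "\<sigma> \<ge> 1" "\<sigma> * \<tau> \<le> 1" and "\<tau> > 0"
    and k: "0 \<le> \<kappa>" "\<kappa> \<le> \<mu> * \<nu>" "(\<sigma> * \<mu> * \<tau>)\<^sup>2 \<le> 1 - c\<^sup>2"
  shows "L2_norm (ball 0 \<tau>) (\<lambda>x. z * mode b d m \<kappa> x) / L2_norm (ball 0 1) (\<lambda>x. z * mode b d m \<kappa> x)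
    \<le> \<sigma> powr (- (real m - (1 - c) * \<nu>))"
proof -
  define K where "K = \<sigma> powr (real m - (1 - c) * \<nu>)"
  have K: "K > 0" unfolding K_def using s by simp
  have pos: "L2_norm (ball 0 1) (mode b d m \<kappa>) > 0"
    by (rule mode_L2_norm_pos[OF bd]) (use nu in \<open>simp add: \<nu>_def\<close>)
  have "\<sigma> * \<kappa> * \<tau> \<le> \<sigma> * (\<mu> * \<nu>) * \<tau>"
    using k s \<open>\<tau> > 0\<close> by (intro mult_right_mono mult_left_mono) auto
  then have "(\<sigma> * \<kappa> * \<tau>)\<^sup>2 \<le> (\<sigma> * (\<mu> * \<nu>) * \<tau>)\<^sup>2"
    using k s \<open>\<tau> > 0\<close> by (intro power_mono) auto
  also have "\<dots> = (\<nu>)\<^sup>2 * (\<sigma> * \<mu> * \<tau>)\<^sup>2" by (simp add: power_mult_distrib mult_ac)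
  also have "\<dots> \<le> (\<nu>)\<^sup>2 * (1 - c\<^sup>2)" by (intro mult_left_mono k(3)) auto
  finally have le: "(\<sigma> * \<kappa> * \<tau>)\<^sup>2 \<le> (\<nu>)\<^sup>2 * (1 - c\<^sup>2)" .
  have "K * L2_norm (ball 0 \<tau>) (mode b d m \<kappa>) \<le> L2_norm (ball 0 1) (mode b d m \<kappa>)"
  proof (rule L2_norm_dilation[where \<sigma> = \<sigma>])
    show "continuous_on UNIV (mode b d m \<kappa>)" by (rule smooth_continuous_on[OF smooth_mode])
    show "K * cmod (mode b d m \<kappa> x) \<le> cmod (mode b d m \<kappa> (\<sigma> *\<^sub>R x))" if "norm x < \<tau>" for x
      unfolding K_def \<nu>_def
      by (rule mode_dilation[where \<tau> = \<tau>]) (use that nu c s le in \<open>auto simp: \<nu>_def\<close>)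
  qed (use s K in auto)
  then have "L2_norm (ball 0 \<tau>) (mode b d m \<kappa>) / L2_norm (ball 0 1) (mode b d m \<kappa>) \<le> 1 / K"
    using K pos by (simp add: field_simps)
  then show ?thesis
    unfolding L2_norm_cmult K_def powr_minus using z by (simp add: inverse_eq_divide)
qed

lemma surface_localized_eigenfunctions:
  fixes n \<tau> :: real and b d :: "'a::euclidean_space"
  assumes bd: "b \<in> Basis" "d \<in> Basis" "b \<noteq> d" and n: "n > 0" "n \<noteq> 1" and tau: "0 < \<tau>" "\<tau> < 1"
  shows "\<exists>(w :: nat \<Rightarrow> 'a \<Rightarrow> complex) (v :: nat \<Rightarrow> 'a \<Rightarrow> complex) (k :: nat \<Rightarrow> real).
    (\<forall>m. transmission_eigenvalue (ball (0 :: 'a) 1) (\<lambda>_. n) (k m) \<and>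
         transmission_eigenfunctions (ball 0 1) (\<lambda>_. n) (k m) (w m) (v m) \<and>
         L2_norm (ball 0 1) (w m) \<noteq> 0 \<and> L2_norm (ball 0 1) (v m) \<noteq> 0) \<and>
    filterlim k at_top sequentially \<and>
    (\<lambda>m. L2_norm (ball 0 \<tau>) (w m) / L2_norm (ball 0 1) (w m)) \<longlonglongrightarrow> 0 \<and>
    (\<lambda>m. L2_norm (ball 0 \<tau>) (v m) / L2_norm (ball 0 1) (v m)) \<longlonglongrightarrow> 0"
proof -
  \<comment> \<open>\<open>r\<close> serves both as the dilation factor and as the bound \<mu> on
    wave number over \<nu>. The product of both with \<tau> is r^2 \<tau> = 1/r < 1, and c is the
    largest constant allowed by (1/r)^2 <= 1 - c^2.\<close>
  define r where "r = root 3 (1 / \<tau>)"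
  have r: "r > 1" "r ^ 3 = 1 / \<tau>" unfolding r_def using tau by auto
  have r2: "r * r * \<tau> = 1 / r" using r tau by (simp add: field_simps power3_eq_cube)
  define c where "c = sqrt (1 - (1 / r)\<^sup>2)"
  have "0 < (1 / r)\<^sup>2" "(1 / r)\<^sup>2 < 1"
    using r by (auto simp: power_less_one_iff)
  then have c: "0 < c" "c < 1" "c\<^sup>2 = 1 - (1 / r)\<^sup>2" unfolding c_def by auto
  define \<nu> where "\<nu> m = real m + real DIM('a) / 2 - 1" for m
  have lim_nu: "filterlim \<nu> at_top sequentially"
    unfolding \<nu>_def by real_asymp
  have "\<forall>\<^sub>F m in sequentially. \<nu> m > 0 \<and> (\<exists>k \<alpha> \<beta>. \<nu> m / max n 1 \<le> k \<and> k \<le> r * \<nu> m \<and> n * k \<le> r * \<nu> m \<and> \<alpha> \<noteq> 0 \<and> \<beta> \<noteq> 0 \<and>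
    \<alpha> * Phi (\<nu> m + 1) ((n * k)\<^sup>2) = \<beta> * Phi (\<nu> m + 1) (k\<^sup>2) \<and>
    \<alpha> * ((n * k)\<^sup>2 * Phi (\<nu> m + 2) ((n * k)\<^sup>2)) = \<beta> * (k\<^sup>2 * Phi (\<nu> m + 2) (k\<^sup>2)))"
    using eventually_compose_filterlim[OF eventually_conj[OF eventually_gt_at_top[of 0] eventually_transmission_data[OF n r(1)]] lim_nu] .
  \<comment> \<open>The first \<open>M\<close> degrees are dropped so that every index of the
    sequence carries an eigenpair.\<close>
  then obtain M where M: "\<And>m. m \<ge> M \<Longrightarrow> \<nu> m > 0 \<and> (\<exists>k \<alpha> \<beta>. \<nu> m / max n 1 \<le> k \<and> k \<le> r * \<nu> m \<and> n * k \<le> r * \<nu> m \<and> \<alpha> \<noteq> 0 \<and> \<beta> \<noteq> 0 \<and>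
    \<alpha> * Phi (\<nu> m + 1) ((n * k)\<^sup>2) = \<beta> * Phi (\<nu> m + 1) (k\<^sup>2) \<and>
    \<alpha> * ((n * k)\<^sup>2 * Phi (\<nu> m + 2) ((n * k)\<^sup>2)) = \<beta> * (k\<^sup>2 * Phi (\<nu> m + 2) (k\<^sup>2)))"
    unfolding eventually_sequentially by blast
  then have "\<forall>m. \<exists>k \<alpha> \<beta>. \<nu> (m + M) / max n 1 \<le> k \<and> k \<le> r * \<nu> (m + M) \<and> n * k \<le> r * \<nu> (m + M) \<and> \<alpha> \<noteq> 0 \<and> \<beta> \<noteq> 0 \<and>
    \<alpha> * Phi (\<nu> (m + M) + 1) ((n * k)\<^sup>2) = \<beta> * Phi (\<nu> (m + M) + 1) (k\<^sup>2) \<and>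
    \<alpha> * ((n * k)\<^sup>2 * Phi (\<nu> (m + M) + 2) ((n * k)\<^sup>2)) = \<beta> * (k\<^sup>2 * Phi (\<nu> (m + M) + 2) (k\<^sup>2))"
    by simp
  then obtain k \<alpha> \<beta> where k: "\<And>m. \<nu> (m + M) / max n 1 \<le> k m" "\<And>m. k m \<le> r * \<nu> (m + M)" "\<And>m. n * k m \<le> r * \<nu> (m + M)"
    and nz: "\<And>m. \<alpha> m \<noteq> 0" "\<And>m. \<beta> m \<noteq> 0"
    and eq: "\<And>m. \<alpha> m * Phi (\<nu> (m + M) + 1) ((n * k m)\<^sup>2) = \<beta> m * Phi (\<nu> (m + M) + 1) ((k m)\<^sup>2)"
      "\<And>m. \<alpha> m * ((n * k m)\<^sup>2 * Phi (\<nu> (m + M) + 2) ((n * k m)\<^sup>2)) = \<beta> m * ((k m)\<^sup>2 * Phi (\<nu> (m + M) + 2) ((k m)\<^sup>2))"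
    by metis
  have nu: "\<nu> (m + M) > 0" for m using M[of "m + M"] by simp
  have a: "\<nu> m + 1 = real m + real DIM('a) / 2" "\<nu> m + 2 = real m + real DIM('a) / 2 + 1" for m
    unfolding \<nu>_def by simp_all
  have kpos: "k m > 0" for m
  proof -
    have "max n 1 > 0" by simp
    from divide_pos_pos[OF nu this, of m] show ?thesis using k(1)[of m] by linarith
  qed
  define w where "w m x = of_real (\<alpha> m) * mode b d (m + M) (n * k m) x" for m x
  define v where "v m x = of_real (\<beta> m) * mode b d (m + M) (k m) x" for m x
  have solves: "solves_transmission_problem (ball 0 1) (\<lambda>_. n) (k m) (w m) (v m)" for m
    unfolding w_def[abs_def] v_def[abs_def]
    by (rule mode_solves_transmission_problem[OF bd]) (use eq[of m] in \<open>simp_all only: a\<close>)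
  have pos: "L2_norm (ball 0 1) (mode b d (m + M) \<kappa>) > 0" for m \<kappa>
    by (rule mode_L2_norm_pos[OF bd]) (use nu[of m] in \<open>simp add: \<nu>_def\<close>)
  have norm_nz: "L2_norm (ball 0 1) (w m) \<noteq> 0" "L2_norm (ball 0 1) (v m) \<noteq> 0" for m
    unfolding w_def[abs_def] v_def[abs_def] L2_norm_cmult using nz[of m] pos[of m] by (auto simp: less_le)
  have "\<not> (AE x in lebesgue_on (ball 0 1). w m x = 0 \<and> v m x = 0)" for m
  proof
    assume "AE x in lebesgue_on (ball 0 1). w m x = 0 \<and> v m x = 0"
    then have "AE x in lebesgue_on (ball 0 1). (cmod (w m x))\<^sup>2 = 0" by eventually_elim simp
    then have "L2_norm (ball 0 1) (w m) = 0"
      unfolding L2_norm_def using integral_eq_zero_AE by fastforce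
    then show False using norm_nz by simp
  qed
  then have eig: "transmission_eigenfunctions (ball 0 1) (\<lambda>_. n) (k m) (w m) (v m)" for m
    unfolding transmission_eigenfunctions_def using solves by blast
  have lim_k: "filterlim k at_top sequentially"
  proof (rule filterlim_at_top_mono)
    show "filterlim (\<lambda>m. \<nu> (m + M) / max n 1) at_top sequentially"
    proof -
      have "max n 1 > 0" by simp
      then show ?thesis unfolding \<nu>_def by real_asymp
    qed
  qed (use k(1) in auto)
  \<comment> \<open>The exponent equals -(c (m + M) - (1 - c) (N/2 - 1)), so with r > 1 and c > 0
    the bound decays exponentially.\<close>
  define B where "B m = r powr (- (real (m + M) - (1 - c) * \<nu> (m + M)))" for m
  have lim_B: "B \<longlonglongrightarrow> 0"
    unfolding B_def \<nu>_def using r(1) c(1) by real_asymp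
  have ratio: "L2_norm (ball 0 \<tau>) (\<lambda>x. z * mode b d (m + M) \<kappa> x) / L2_norm (ball 0 1) (\<lambda>x. z * mode b d (m + M) \<kappa> x) \<le> B m"
    if "z \<noteq> 0" "0 \<le> \<kappa>" "\<kappa> \<le> r * \<nu> (m + M)" for z \<kappa> m
    unfolding B_def \<nu>_def
  proof (rule mode_ratio_bound[OF bd that(1)])
    show "\<kappa> \<le> r * (real (m + M) + real DIM('a) / 2 - 1)" "0 < real (m + M) + real DIM('a) / 2 - 1"
      using that nu[of m] unfolding \<nu>_def by auto
    show "(r * r * \<tau>)\<^sup>2 \<le> 1 - c\<^sup>2" unfolding r2 c(3) by simp
    have "r * \<tau> \<le> r * (r * \<tau>)" using r tau by simp
    also have "\<dots> = 1 / r" using r2 by simp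
    also have "\<dots> \<le> 1" using r by simp
    finally show "r * \<tau> \<le> 1" .
  qed (use c r tau that in auto)
  have rw: "(\<lambda>m. L2_norm (ball 0 \<tau>) (w m) / L2_norm (ball 0 1) (w m)) \<longlonglongrightarrow> 0"
  proof (rule tendsto_sandwich[OF _ _ tendsto_const lim_B])
    show "\<forall>\<^sub>F m in sequentially. L2_norm (ball 0 \<tau>) (w m) / L2_norm (ball 0 1) (w m) \<le> B m"
      unfolding w_def[abs_def] using nz(1) kpos k(3) n(1)
      by (intro always_eventually allI ratio) (auto simp: less_imp_le)
  qed (auto simp: L2_norm_nonneg)
  have rv: "(\<lambda>m. L2_norm (ball 0 \<tau>) (v m) / L2_norm (ball 0 1) (v m)) \<longlonglongrightarrow> 0"
  proof (rule tendsto_sandwich[OF _ _ tendsto_const lim_B])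
    show "\<forall>\<^sub>F m in sequentially. L2_norm (ball 0 \<tau>) (v m) / L2_norm (ball 0 1) (v m) \<le> B m"
      unfolding v_def[abs_def] using nz(2) kpos k(2)
      by (intro always_eventually allI ratio) (auto simp: less_imp_le)
  qed (auto simp: L2_norm_nonneg)
  show ?thesis
    unfolding transmission_eigenvalue_def using eig norm_nz kpos lim_k rw rv by blast
qed

theorem theorem2p1:
  fixes n \<tau> :: real
  assumes "CARD('N::finite) = 2 \<or> CARD('N) = 3"
    and "n > 0" and "n \<noteq> 1"
    and "0 < \<tau>" and "\<tau> < 1"
  shows "\<exists>(w :: nat \<Rightarrow> real ^ 'N \<Rightarrow> complex) (v :: nat \<Rightarrow> real ^ 'N \<Rightarrow> complex) (k :: nat \<Rightarrow> real).
    (\<forall>m. transmission_eigenvalue (ball (0 :: real ^ 'N) 1) (\<lambda>_. n) (k m) \<and>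
         transmission_eigenfunctions (ball 0 1) (\<lambda>_. n) (k m) (w m) (v m) \<and>
         L2_norm (ball 0 1) (w m) \<noteq> 0 \<and> L2_norm (ball 0 1) (v m) \<noteq> 0) \<and>
    filterlim k at_top sequentially \<and>
    (\<lambda>m. L2_norm (ball 0 \<tau>) (w m) / L2_norm (ball 0 1) (w m)) \<longlonglongrightarrow> 0 \<and>
    (\<lambda>m. L2_norm (ball 0 \<tau>) (v m) / L2_norm (ball 0 1) (v m)) \<longlonglongrightarrow> 0"
proof -
  have "2 \<le> card (Basis :: (real ^ 'N) set)" using assms(1) by auto
  then have "\<not> card (Basis :: (real ^ 'N) set) \<le> Suc 0" by simp
  then obtain b d :: "real ^ 'N" where "b \<in> Basis" "d \<in> Basis" "b \<noteq> d"
    unfolding card_le_Suc0_iff_eq[OF finite_Basis] by blast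
  then show ?thesis
    using assms(2-5) by (rule surface_localized_eigenfunctions)
qed

end
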